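(* Let $(\mathcal{M}^2,g)$ be a smooth two-manifold, let $\Omega\subset\mathcal{M}^2$ be a smooth open domain, and let $\omega$ be an admissible weight with associated function $\kappa$. If $\kappa\leq\lambda_1$ on $\Omega$, then every $f\in C_c^{\infty}(\Omega)$ satisfies $$\int_{\Omega} |\nabla\omega|^2 |f|^2\, d\mathrm{vol}_g \leq \int_{\Omega} \omega^2 |\nabla f|^2\, d\mathrm{vol}_g .$$
   Context: $(\mathcal{M}^2,g)$ is a smooth connected Riemannian manifold of dimension two, possibly with boundary; $\Omega\subset\mathcal M^2$ is a smooth connected open domain. $\nabla$ is the gradient with respect to $g$, and $\Delta_g$ is the Laplace--Beltrami operator with the sign convention $\int_\Omega -\Delta_g u\, v\, d\mathrm{vol}_g=\int_\Omega\langle\nabla u,\nabla v\rangle\, d\mathrm{vol}_g$ for all $v\in W^{1,2}_0(\Omega)$. Eigenvalue: $\lambda_1$ denotes the first Dirichlet eigenvalue of the Laplace--Beltrami operator on $\Omega$ (that of $-\Delta_g$, so $\lambda_1\int_\Omega |u|^2\,d\mathrm{vol}_g\le \int_\Omega|\nabla u|^2\,d\mathrm{vol}_g$ for $u\in W^{1,2}_0(\Omega)$). Convention: if the domain is unbounded (for example when $\mathcal M^2=\mathbb{R}^2$), one sets $\lambda_1=0$. Admissible weight: $\omega\in W^{1,2}(\mathcal M^2)$ is a positive weight (i.e. $\omega\ge 0$ and $\omega>0$ almost everywhere; it may vanish, e.g. at finitely many points), and there is a real-valued function $\kappa=\kappa(x)$ such that the weak form of $\omega^2\Delta_g\log\omega=-\kappa\,\omega^2$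 holds, namely for every $\phi\in C_c^\infty(\Omega)$, $$\int_{\Omega}\left[(4|\nabla\omega|^2-2\kappa\,\omega^2)\,\phi-\omega^2\Delta_g\phi\right]d\mathrm{vol}_g=0 .$$ The function $\kappa$ is measurable with $\kappa\omega^2$ locally integrable, so that this makes sense. *)

theory Defs
  imports "HOL-Analysis.Analysis"
begin

section \<open>Smooth maps between Euclidean spaces\<close>

text \<open>\<open>Ck_on k N f\<close> is meant for open \<open>N\<close>: all iterated directional derivatives of order up to \<open>k\<close>
  exist, and those of order \<open>k\<close> are continuous.  On an arbitrary set, smooth means locally
  extendable to a smooth map on an open set.\<close>

primrec Ck_on :: "nat \<Rightarrow> 'a::euclidean_space set \<Rightarrow> ('a \<Rightarrow> 'b::real_normed_vector) \<Rightarrow> bool" where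
  "Ck_on 0 N f \<longleftrightarrow> continuous_on N f"
| "Ck_on (Suc k) N f \<longleftrightarrow>
     f differentiable_on N \<and> (\<forall>v. Ck_on k N (\<lambda>x. frechet_derivative f (at x) v))"

definition smooth_on :: "'a::euclidean_space set \<Rightarrow> ('a \<Rightarrow> 'b::real_normed_vector) \<Rightarrow> bool" where
  "smooth_on S f \<longleftrightarrow>
     (\<forall>x\<in>S. \<exists>N F. open N \<and> x \<in> N \<and> (\<forall>k. Ck_on k N F) \<and> (\<forall>y\<in>S \<inter> N. F y = f y))"

section \<open>Smooth two-manifolds, possibly with boundary\<close>

text \<open>The manifold is the whole type \<open>'a\<close> (Hausdorff, second countable) together with an atlas, not
  necessarily maximal, of charts onto relatively open subsets of the closed half-plane.
  The map of a chart is irrelevant outside the chart domain.\<close>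

datatype 'a chart = Chart (chart_dom: "'a set") (coords: "'a \<Rightarrow> real^2")

definition half_plane :: "(real^2) set" where
  "half_plane = {x. 0 \<le> x $ 1}"

definition chart_inv :: "'a chart \<Rightarrow> real^2 \<Rightarrow> 'a" where
  "chart_inv c = inv_into (chart_dom c) (coords c)"

definition smooth_atlas :: "'a::{t2_space,second_countable_topology} chart set \<Rightarrow> bool" where
  "smooth_atlas A \<longleftrightarrow>
     (\<Union>c\<in>A. chart_dom c) = UNIV \<and>
     (\<forall>c\<in>A. open (chart_dom c) \<and>
        openin (top_of_set half_plane) (coords c ` chart_dom c) \<and>
        homeomorphism (chart_dom c) (coords c ` chart_dom c) (coords c) (chart_inv c)) \<and>
     (\<forall>c\<in>A. \<forall>d\<in>A. smooth_on (coords c ` (chart_dom c \<inter> chart_dom d)) (coords d \<circ> chart_inv c))"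

definition manifold_boundary :: "'a chart set \<Rightarrow> 'a set" where
  "manifold_boundary A = {p. \<exists>c\<in>A. p \<in> chart_dom c \<and> coords c p $ 1 = 0}"

definition smooth_fun_on ::
  "'a::{t2_space,second_countable_topology} chart set \<Rightarrow> 'a set \<Rightarrow> ('a \<Rightarrow> real) \<Rightarrow> bool" where
  "smooth_fun_on A V u \<longleftrightarrow>
     (\<forall>c\<in>A. smooth_on (coords c ` (V \<inter> chart_dom c)) (u \<circ> chart_inv c))"

text \<open>Coordinate derivatives are taken within the image of the chart, i.e. they are one-sided at
  boundary points of the manifold.\<close>

definition partial_deriv :: "'a chart \<Rightarrow> 2 \<Rightarrow> ('a \<Rightarrow> real) \<Rightarrow> 'a \<Rightarrow> real" where
  "partial_deriv c i u p =
     frechet_derivative (u \<circ> chart_inv c) (at (coords c p) within coords c ` chart_dom c) (axis i 1)"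

definition transition_jacobian :: "'a chart \<Rightarrow> 'a chart \<Rightarrow> 'a \<Rightarrow> real^2^2" where
  "transition_jacobian c d p =
     matrix (frechet_derivative (coords d \<circ> chart_inv c)
       (at (coords c p) within coords c ` (chart_dom c \<inter> chart_dom d)))"

text \<open>A chart around \<open>p\<close>; it is only used in expressions that do not depend on the choice.\<close>

definition chart_at :: "'a chart set \<Rightarrow> 'a \<Rightarrow> 'a chart" where
  "chart_at A p = (SOME c. c \<in> A \<and> p \<in> chart_dom c)"

section \<open>Riemannian metrics, vector fields and differential operators\<close>

text \<open>Tensor fields are given by their coordinate components in every chart, subject to the usual
  transformation rule: \<open>g c p\<close> is the Gram matrix of the metric at \<open>p\<close> in the chart \<open>c\<close>, and
  \<open>X c p\<close> is the vector of components at \<open>p\<close> of the vector field \<open>X\<close>.\<close>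

type_synonym 'a metric_field = "'a chart \<Rightarrow> 'a \<Rightarrow> real^2^2"
type_synonym 'a vector_field = "'a chart \<Rightarrow> 'a \<Rightarrow> real^2"

definition riemannian_metric ::
  "'a::{t2_space,second_countable_topology} chart set \<Rightarrow> 'a metric_field \<Rightarrow> bool" where
  "riemannian_metric A g \<longleftrightarrow>
     (\<forall>c\<in>A. smooth_on (coords c ` chart_dom c) (g c \<circ> chart_inv c)) \<and>
     (\<forall>c\<in>A. \<forall>p\<in>chart_dom c. transpose (g c p) = g c p \<and> (\<forall>v. v \<noteq> 0 \<longrightarrow> 0 < v \<bullet> (g c p *v v))) \<and>
     (\<forall>c\<in>A. \<forall>d\<in>A. \<forall>p\<in>chart_dom c \<inter> chart_dom d.
        g c p = transpose (transition_jacobian c d p) ** g d p ** transition_jacobian c d p)"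

definition measurable_vector_field ::
  "'a::{t2_space,second_countable_topology} chart set \<Rightarrow> 'a vector_field \<Rightarrow> bool" where
  "measurable_vector_field A X \<longleftrightarrow>
     (\<forall>c\<in>A. set_borel_measurable borel (chart_dom c) (X c)) \<and>
     (\<forall>c\<in>A. \<forall>d\<in>A. \<forall>p\<in>chart_dom c \<inter> chart_dom d. X d p = transition_jacobian c d p *v X c p)"

definition metric_inner ::
  "'a chart set \<Rightarrow> 'a metric_field \<Rightarrow> 'a vector_field \<Rightarrow> 'a vector_field \<Rightarrow> 'a \<Rightarrow> real" where
  "metric_inner A g X Y p = (let c = chart_at A p in X c p \<bullet> (g c p *v Y c p))"

definition grad :: "'a metric_field \<Rightarrow> ('a \<Rightarrow> real) \<Rightarrow> 'a vector_field" where
  "grad g u c p = matrix_inv (g c p) *v (\<chi> i. partial_deriv c i u p)"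

definition divergence :: "'a chart set \<Rightarrow> 'a metric_field \<Rightarrow> 'a vector_field \<Rightarrow> 'a \<Rightarrow> real" where
  "divergence A g X p =
     (let c = chart_at A p in
       (\<Sum>i\<in>UNIV. partial_deriv c i (\<lambda>q. sqrt (det (g c q)) * X c q $ i) p) / sqrt (det (g c p)))"

definition laplace_beltrami :: "'a chart set \<Rightarrow> 'a metric_field \<Rightarrow> ('a \<Rightarrow> real) \<Rightarrow> 'a \<Rightarrow> real" where
  "laplace_beltrami A g u = divergence A g (grad g u)"

text \<open>The chart formula determines the Riemannian volume measure \<open>vol\<close> uniquely.\<close>

definition riemannian_volume ::
  "'a::{t2_space,second_countable_topology} chart set \<Rightarrow> 'a metric_field \<Rightarrow> 'a measure \<Rightarrow> bool" where
  "riemannian_volume A g vol \<longleftrightarrow>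
     sets vol = sets borel \<and>
     (\<forall>c\<in>A. \<forall>B\<in>sets borel. B \<subseteq> chart_dom c \<longrightarrow>
        emeasure vol B =
          (\<integral>\<^sup>+x\<in>coords c ` B. ennreal (sqrt (det (g c (chart_inv c x)))) \<partial>lborel))"

section \<open>Riemannian distance\<close>

definition piecewise_C1_curve ::
  "'a::{t2_space,second_countable_topology} chart set \<Rightarrow> (real \<Rightarrow> 'a) \<Rightarrow> bool" where
  "piecewise_C1_curve A \<gamma> \<longleftrightarrow>
     path \<gamma> \<and>
     (\<forall>c\<in>A. \<forall>a b. 0 \<le> a \<longrightarrow> a < b \<longrightarrow> b \<le> 1 \<longrightarrow> \<gamma> ` {a..b} \<subseteq> chart_dom c \<longrightarrow>
        (coords c \<circ> \<gamma>) piecewise_C1_differentiable_on {a..b})"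

definition curve_length :: "'a chart set \<Rightarrow> 'a metric_field \<Rightarrow> (real \<Rightarrow> 'a) \<Rightarrow> ennreal" where
  "curve_length A g \<gamma> =
     (\<integral>\<^sup>+t\<in>{0..1}.
        (let c = chart_at A (\<gamma> t); v = vector_derivative (coords c \<circ> \<gamma>) (at t)
         in ennreal (sqrt (v \<bullet> (g c (\<gamma> t) *v v)))) \<partial>lborel)"

definition riemannian_dist ::
  "'a::{t2_space,second_countable_topology} chart set \<Rightarrow> 'a metric_field \<Rightarrow> 'a \<Rightarrow> 'a \<Rightarrow> ennreal" where
  "riemannian_dist A g p q =
     (INF \<gamma>\<in>{\<gamma>. piecewise_C1_curve A \<gamma> \<and> pathstart \<gamma> = p \<and> pathfinish \<gamma> = q}. curve_length A g \<gamma>)"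

definition riemannian_bounded ::
  "'a::{t2_space,second_countable_topology} chart set \<Rightarrow> 'a metric_field \<Rightarrow> 'a set \<Rightarrow> bool" where
  "riemannian_bounded A g S \<longleftrightarrow> (\<exists>p. \<exists>R::real. \<forall>q\<in>S. riemannian_dist A g p q \<le> ennreal R)"

section \<open>Domains, test functions and Sobolev spaces\<close>

text \<open>Smoothness of the domain: near every boundary point it is the positivity set of a local
  defining function with nonvanishing differential.  The topological boundary of the domain may meet
  the boundary of the manifold.\<close>

definition smooth_domain ::
  "'a::{t2_space,second_countable_topology} chart set \<Rightarrow> 'a set \<Rightarrow> bool" where
  "smooth_domain A \<Omega> \<longleftrightarrow>
     open \<Omega> \<and> connected \<Omega> \<and>
     (\<forall>p\<in>frontier \<Omega>. \<exists>V \<rho>. open V \<and> p \<in> V \<and> smooth_fun_on A V \<rho> \<and> \<rho> p = 0 \<and>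
        (\<exists>c\<in>A. p \<in> chart_dom c \<and> (\<exists>i. partial_deriv c i \<rho> p \<noteq> 0)) \<and>
        \<Omega> \<inter> V = {q\<in>V. 0 < \<rho> q})"

text \<open>Test functions are extended by zero to the manifold.  If the relatively open set \<open>\<Omega>\<close> contains
  boundary points of the manifold, test functions vanish near them: this is what makes the closure
  below the Dirichlet space, on which Green's formula holds without boundary terms.  If \<open>\<Omega>\<close> lies in
  the interior of the manifold, the removal of the boundary has no effect.\<close>

definition test_fun ::
  "'a::{t2_space,second_countable_topology} chart set \<Rightarrow> 'a set \<Rightarrow> ('a \<Rightarrow> real) \<Rightarrow> bool" where
  "test_fun A \<Omega> \<phi> \<longleftrightarrow>
     smooth_fun_on A UNIV \<phi> \<and> compact (closure {p. \<phi> p \<noteq> 0}) \<and>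
     closure {p. \<phi> p \<noteq> 0} \<subseteq> \<Omega> - manifold_boundary A"

definition L2_on ::
  "'a::{t2_space,second_countable_topology} measure \<Rightarrow> 'a set \<Rightarrow> ('a \<Rightarrow> real) \<Rightarrow> bool" where
  "L2_on vol S u \<longleftrightarrow> u \<in> borel_measurable borel \<and> set_integrable vol S (\<lambda>p. (u p)\<^sup>2)"

definition L2_field_on :: "'a::{t2_space,second_countable_topology} chart set \<Rightarrow> 'a metric_field \<Rightarrow>
    'a measure \<Rightarrow> 'a set \<Rightarrow> 'a vector_field \<Rightarrow> bool" where
  "L2_field_on A g vol S X \<longleftrightarrow>
     measurable_vector_field A X \<and> set_integrable vol S (metric_inner A g X X)"

text \<open>\<open>sobolev_closure A g vol S P u U\<close>: the function \<open>u\<close>, with weak gradient \<open>U\<close>, belongs to the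
  completion, with respect to the norm of \<open>W\<^sup>1\<^sup>,\<^sup>2(S)\<close>, of the functions of class \<open>P\<close> (contained in the
  smooth functions) whose norm is finite.  Taking for \<open>P\<close> all smooth functions yields \<open>W\<^sup>1\<^sup>,\<^sup>2\<close>, the
  usual definition on Riemannian manifolds (Aubin, Hebey); taking the test functions
  yields \<open>W\<^sub>0\<^sup>1\<^sup>,\<^sup>2\<close>.  The weak gradient is determined almost everywhere on \<open>S\<close> by \<open>u\<close>.\<close>

definition sobolev_closure :: "'a::{t2_space,second_countable_topology} chart set \<Rightarrow> 'a metric_field \<Rightarrow>
    'a measure \<Rightarrow> 'a set \<Rightarrow> (('a \<Rightarrow> real) \<Rightarrow> bool) \<Rightarrow> ('a \<Rightarrow> real) \<Rightarrow> 'a vector_field \<Rightarrow> bool" where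
  "sobolev_closure A g vol S P u U \<longleftrightarrow>
     L2_on vol S u \<and> L2_field_on A g vol S U \<and>
     (\<exists>s :: nat \<Rightarrow> 'a \<Rightarrow> real.
        (\<forall>n. P (s n) \<and> L2_on vol S (s n) \<and> L2_field_on A g vol S (grad g (s n))) \<and>
        (\<lambda>n. LINT p:S|vol. (s n p - u p)\<^sup>2) \<longlonglongrightarrow> 0 \<and>
        (\<lambda>n. LINT p:S|vol. metric_inner A g (grad g (s n) - U) (grad g (s n) - U) p) \<longlonglongrightarrow> 0)"

definition W12 :: "'a::{t2_space,second_countable_topology} chart set \<Rightarrow> 'a metric_field \<Rightarrow>
    'a measure \<Rightarrow> ('a \<Rightarrow> real) \<Rightarrow> 'a vector_field \<Rightarrow> bool" where
  "W12 A g vol u U \<longleftrightarrow> sobolev_closure A g vol UNIV (smooth_fun_on A UNIV) u U"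

definition W12_0 :: "'a::{t2_space,second_countable_topology} chart set \<Rightarrow> 'a metric_field \<Rightarrow>
    'a measure \<Rightarrow> 'a set \<Rightarrow> ('a \<Rightarrow> real) \<Rightarrow> 'a vector_field \<Rightarrow> bool" where
  "W12_0 A g vol \<Omega> u U \<longleftrightarrow> sobolev_closure A g vol \<Omega> (test_fun A \<Omega>) u U"

section \<open>Dirichlet eigenvalues\<close>

text \<open>\<open>weak_solution A g vol \<Omega> \<mu> F u U\<close>: the function \<open>u\<close>, with weak gradient \<open>U\<close>, solves
  \<open>- \<Delta> u - \<mu> u = F\<close> weakly with Dirichlet boundary condition.\<close>

definition weak_solution :: "'a::{t2_space,second_countable_topology} chart set \<Rightarrow> 'a metric_field \<Rightarrow>
    'a measure \<Rightarrow> 'a set \<Rightarrow> real \<Rightarrow> ('a \<Rightarrow> real) \<Rightarrow> ('a \<Rightarrow> real) \<Rightarrow> 'a vector_field \<Rightarrow> bool" where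
  "weak_solution A g vol \<Omega> \<mu> F u U \<longleftrightarrow>
     W12_0 A g vol \<Omega> u U \<and>
     (\<forall>v V. W12_0 A g vol \<Omega> v V \<longrightarrow>
        (LINT p:\<Omega>|vol. metric_inner A g U V p) - \<mu> * (LINT p:\<Omega>|vol. u p * v p)
          = (LINT p:\<Omega>|vol. F p * v p))"

definition dirichlet_eigenvalue :: "'a::{t2_space,second_countable_topology} chart set \<Rightarrow>
    'a metric_field \<Rightarrow> 'a measure \<Rightarrow> 'a set \<Rightarrow> real \<Rightarrow> bool" where
  "dirichlet_eigenvalue A g vol \<Omega> \<mu> \<longleftrightarrow>
     (\<exists>u U. weak_solution A g vol \<Omega> \<mu> (\<lambda>_. 0) u U \<and> \<not> (AE p in vol. p \<in> \<Omega> \<longrightarrow> u p = 0))"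

text \<open>The real spectrum of the Dirichlet Laplacian (a self-adjoint operator on \<open>L\<^sup>2(\<Omega>)\<close>): the
  complement of the set of \<open>\<mu>\<close> for which \<open>- \<Delta> - \<mu>\<close> has a bounded everywhere defined inverse.\<close>

definition dirichlet_spectrum :: "'a::{t2_space,second_countable_topology} chart set \<Rightarrow>
    'a metric_field \<Rightarrow> 'a measure \<Rightarrow> 'a set \<Rightarrow> real set" where
  "dirichlet_spectrum A g vol \<Omega> =
     {\<mu>. \<not> (\<not> dirichlet_eigenvalue A g vol \<Omega> \<mu> \<and>
            (\<exists>C. \<forall>F. L2_on vol \<Omega> F \<longrightarrow>
               (\<exists>u U. weak_solution A g vol \<Omega> \<mu> F u U \<and>
                  (LINT p:\<Omega>|vol. (u p)\<^sup>2) \<le> C * (LINT p:\<Omega>|vol. (F p)\<^sup>2))))}"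

text \<open>The first eigenvalue of a bounded domain is the eigenvalue at the bottom of the spectrum.  When
  the spectrum is discrete, e.g. for relatively compact \<open>\<Omega>\<close>, this just means the least eigenvalue;
  without discreteness the least eigenvalue may lie above other points of the spectrum, and then the
  Poincare inequality fails for it.  For unbounded domains the first eigenvalue is 0 by convention.\<close>

definition first_dirichlet_eigenvalue :: "'a::{t2_space,second_countable_topology} chart set \<Rightarrow>
    'a metric_field \<Rightarrow> 'a measure \<Rightarrow> 'a set \<Rightarrow> real \<Rightarrow> bool" where
  "first_dirichlet_eigenvalue A g vol \<Omega> \<mu> \<longleftrightarrow>
     (if riemannian_bounded A g \<Omega>
      then dirichlet_eigenvalue A g vol \<Omega> \<mu> \<and> (\<forall>\<nu>\<in>dirichlet_spectrum A g vol \<Omega>. \<mu> \<le> \<nu>)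
      else \<mu> = 0)"

section \<open>Admissible weights\<close>

text \<open>\<open>W\<close> is the weak gradient of the weight \<open>w\<close>.\<close>

definition admissible_weight :: "'a::{t2_space,second_countable_topology} chart set \<Rightarrow>
    'a metric_field \<Rightarrow> 'a measure \<Rightarrow> 'a set \<Rightarrow> ('a \<Rightarrow> real) \<Rightarrow> 'a vector_field \<Rightarrow> ('a \<Rightarrow> real) \<Rightarrow> bool" where
  "admissible_weight A g vol \<Omega> w W \<kappa> \<longleftrightarrow>
     W12 A g vol w W \<and> (\<forall>p. 0 \<le> w p) \<and> (AE p in vol. 0 < w p) \<and>
     set_borel_measurable borel \<Omega> \<kappa> \<and>
     (\<forall>K. compact K \<and> K \<subseteq> \<Omega> - manifold_boundary A \<longrightarrow>
        set_integrable vol K (\<lambda>p. \<kappa> p * (w p)\<^sup>2)) \<and>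
     (\<forall>\<phi>. test_fun A \<Omega> \<phi> \<longrightarrow>
        (LINT p:\<Omega>|vol. (4 * metric_inner A g W W p - 2 * \<kappa> p * (w p)\<^sup>2) * \<phi> p
            - (w p)\<^sup>2 * laplace_beltrami A g \<phi> p) = 0)"

end

theory Submission
  imports Defs
begin

text \<open>Write \<open>W = \<nabla>w\<close>. The weak equation for the weight, tested with \<open>\<phi> = f\<^sup>2\<close>, reads
\<open>4 \<integral> |W|\<^sup>2 f\<^sup>2 - 2 \<integral> \<kappa> w\<^sup>2 f\<^sup>2 = \<integral> w\<^sup>2 \<Delta>(f\<^sup>2) = - 4 \<integral> w f \<langle>W, \<nabla>f\<rangle>\<close>, where the second equality is
Green's formula for \<open>w\<^sup>2\<close>. Since \<open>\<kappa> \<le> \<lambda>\<^sub>1\<close> and \<open>w f\<close> lies in the Dirichlet space with gradient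
\<open>f W + w \<nabla>f\<close>, the Poincare inequality gives
\<open>2 \<integral> |W|\<^sup>2 f\<^sup>2 + 2 \<integral> w f \<langle>W, \<nabla>f\<rangle> = \<integral> \<kappa> w\<^sup>2 f\<^sup>2 \<le> \<integral> |f W + w \<nabla>f|\<^sup>2\<close>.
Expanding the square on the right, the mixed terms cancel and the claim remains.

Green's formula first holds for \<open>C\<^sup>1\<close> functions \<open>u\<close> against a test function (\<open>green_formula\<close>). Inside one
chart it is the Euclidean fact that derivatives of compactly supported functions have integral zero
(\<open>chart_divergence_theorem\<close>); cutoffs attached to finitely many coordinate balls then decompose \<open>u\<close>.
The coordinate expression of \<open>\<Delta>\<phi>\<close> does not depend on the chart, because in each chart it is
determined by duality with cutoff functions (\<open>chart_laplace_le\<close>). Finally \<open>weak_green\<close> passes from \<open>s\<^sub>n\<^sup>2\<close>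
with \<open>s\<^sub>n\<close> smooth to \<open>w\<^sup>2\<close>, by continuity of the quadratic functional
\<open>\<integral> u\<^sup>2 \<Delta>(f\<^sup>2) + 4 u f \<langle>\<nabla>u, \<nabla>f\<rangle>\<close> in the Sobolev norm.

The Poincare inequality (\<open>poincare_inequality\<close>) has to be extracted from the position of \<open>\<lambda>\<^sub>1\<close> at the
bottom of the spectrum. The best constant \<open>m\<close> belongs to the spectrum: a bounded resolvent at \<open>m\<close>
would, by the Cauchy--Schwarz inequality for the form \<open>\<integral> \<langle>\<nabla>u, \<nabla>v\<rangle> - m \<integral> u v\<close>, improve the constant.
Hence \<open>\<lambda>\<^sub>1 \<le> m\<close>.\<close>

section \<open>Calculus of \<open>C\<^sup>k\<close> functions on open sets\<close>

lemma frechet_derivative_eqI: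
  "(f has_derivative f') (at x) \<Longrightarrow> frechet_derivative f (at x) = f'"
  using frechet_derivative_at by metis

lemma differentiable_on_openD:
  "f differentiable_on N \<Longrightarrow> open N \<Longrightarrow> x \<in> N \<Longrightarrow> f differentiable (at x)"
  by (metis at_within_open differentiable_on_def)

lemma differentiable_onI_has_derivative:
  "(\<And>x. x \<in> N \<Longrightarrow> (f has_derivative f' x) (at x)) \<Longrightarrow> f differentiable_on N"
  unfolding differentiable_on_def by (meson differentiable_def has_derivative_at_withinI)

lemma has_derivative_frechet_of_differentiable_on:
  assumes "f differentiable_on N" "open N" "x \<in> N"
  shows "(f has_derivative frechet_derivative f (at x)) (at x)"
  using assms by (metis differentiable_on_openD frechet_derivative_works)

lemma Ck_on_subset:
  assumes "Ck_on k N f" "M \<subseteq> N"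
  shows "Ck_on k M f"
  using assms(1)
proof (induction k arbitrary: f)
  case 0
  then show ?case by (simp add: continuous_on_subset[OF _ assms(2)])
next
  case (Suc k)
  then show ?case by (simp add: differentiable_on_subset[OF _ assms(2)])
qed

lemma Ck_on_cong:
  assumes "open N" "\<And>x. x \<in> N \<Longrightarrow> f x = g x" "Ck_on k N f"
  shows "Ck_on k N g"
  using assms(2,3)
proof (induction k arbitrary: f g)
  case 0
  then show ?case using continuous_on_cong by force
next
  case (Suc k)
  have d: "(g has_derivative frechet_derivative f (at x)) (at x)" if "x \<in> N" for x
    by (rule has_derivative_transform_within_open[OF has_derivative_frechet_of_differentiable_on])
       (use Suc.prems that assms(1) in auto)
  have "g differentiable_on N"
    using d by (rule differentiable_onI_has_derivative)
  moreover have "Ck_on k N (\<lambda>x. frechet_derivative g (at x) v)" for v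
    by (rule Suc.IH[of "\<lambda>x. frechet_derivative f (at x) v"])
       (use Suc.prems frechet_derivative_eqI[OF d] in auto)
  ultimately show ?case by simp
qed

text \<open>Differentiability and derivatives at a point depend on the germ only. This is how functions given
by different formulas on overlapping open sets are shown to be \<open>C\<^sup>k\<close>.\<close>

lemma Ck_on_local:
  assumes "\<And>x. x \<in> N \<Longrightarrow> \<exists>M. open M \<and> x \<in> M \<and> Ck_on k M f"
  shows "Ck_on k N f"
  using assms
proof (induction k arbitrary: f)
  case 0
  have "continuous (at x within N) f" if x: "x \<in> N" for x
  proof -
    obtain M where "open M" "x \<in> M" "continuous_on M f" using 0[OF x] by auto
    then have "continuous (at x) f" by (simp add: continuous_on_eq_continuous_at)
    then show ?thesis by (rule continuous_at_imp_continuous_at_within)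
  qed
  then show ?case by (simp add: continuous_on_eq_continuous_within)
next
  case (Suc k)
  have "f differentiable (at x within N)" if x: "x \<in> N" for x
  proof -
    obtain M where "open M" "x \<in> M" "f differentiable_on M" using Suc.prems[OF x] by auto
    then show ?thesis using differentiable_on_openD differentiable_at_withinI by blast
  qed
  moreover have "Ck_on k N (\<lambda>x. frechet_derivative f (at x) v)" for v
    using Suc.prems by (intro Suc.IH) (metis Ck_on.simps(2))
  ultimately show ?case by (simp add: differentiable_on_def)
qed

lemma Ck_on_SucD: "Ck_on (Suc k) N f \<Longrightarrow> Ck_on k N f"
proof (induction k arbitrary: f)
  case 0
  then show ?case by (simp add: differentiable_imp_continuous_on)
next
  case (Suc k)
  then show ?case by (subst (asm) Ck_on.simps(2)) simp
qed

lemma Ck_on_imp_continuous_on: "Ck_on k N f \<Longrightarrow> continuous_on N f"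
  by (cases k) (auto intro: differentiable_imp_continuous_on)

lemma Ck_on_has_derivative:
  "Ck_on (Suc k) N f \<Longrightarrow> open N \<Longrightarrow> x \<in> N \<Longrightarrow>
    (f has_derivative frechet_derivative f (at x)) (at x)"
  by (auto intro: has_derivative_frechet_of_differentiable_on)

lemma Ck_on_SucI:
  assumes "open N" "\<And>x. x \<in> N \<Longrightarrow> (f has_derivative f' x) (at x)"
    and "\<And>v. Ck_on k N (\<lambda>x. f' x v)"
  shows "Ck_on (Suc k) N f"
proof -
  have "f differentiable_on N"
    using assms(2) by (rule differentiable_onI_has_derivative)
  moreover have "Ck_on k N (\<lambda>x. frechet_derivative f (at x) v)" for v
    by (rule Ck_on_cong[OF assms(1) _ assms(3)]) (simp add: frechet_derivative_eqI[OF assms(2)])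
  ultimately show ?thesis by simp
qed

lemma Ck_on_const: "Ck_on k N (\<lambda>x. c)"
  by (induction k arbitrary: c) auto

lemma Ck_on_add:
  assumes "open N" "Ck_on k N f" "Ck_on k N g"
  shows "Ck_on k N (\<lambda>x. f x + g x)"
  using assms(2,3)
proof (induction k arbitrary: f g)
  case (Suc k)
  show ?case
    by (rule Ck_on_SucI[OF assms(1) has_derivative_add[OF Ck_on_has_derivative Ck_on_has_derivative]])
       (use Suc assms(1) in auto)
qed (auto intro: continuous_on_add)

lemma Ck_on_sum:
  assumes "open N" "\<And>i. i \<in> I \<Longrightarrow> Ck_on k N (f i)"
  shows "Ck_on k N (\<lambda>x. \<Sum>i\<in>I. f i x)"
  using assms(2)
proof (induction I rule: infinite_finite_induct)
  case (insert i I)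
  then have "Ck_on k N (\<lambda>x. f i x + (\<Sum>i\<in>I. f i x))"
    by (intro Ck_on_add[OF assms(1)]) simp_all
  with insert show ?case by simp
qed (simp_all add: Ck_on_const)

lemma Ck_on_mult:
  fixes f g :: "'a::euclidean_space \<Rightarrow> real"
  assumes "open N" "Ck_on k N f" "Ck_on k N g"
  shows "Ck_on k N (\<lambda>x. f x * g x)"
  using assms(2,3)
proof (induction k arbitrary: f g)
  case (Suc k)
  show ?case
  proof (rule Ck_on_SucI[OF assms(1) has_derivative_mult[OF Ck_on_has_derivative Ck_on_has_derivative]])
    show "Ck_on k N (\<lambda>x. f x * frechet_derivative g (at x) v + frechet_derivative f (at x) v * g x)" for v
      using Suc.prems Suc.prems[THEN Ck_on_SucD]
      by (intro Ck_on_add assms(1) Suc.IH) auto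
  qed (use Suc assms(1) in auto)
qed (auto intro: continuous_on_mult)

lemma Ck_on_bounded_linear:
  assumes "open N" "Ck_on k N f" "bounded_linear L"
  shows "Ck_on k N (\<lambda>x. L (f x))"
  using assms(2)
proof (induction k arbitrary: f)
  case 0
  then show ?case using assms(3) by (auto intro: bounded_linear.continuous_on)
next
  case (Suc k)
  show ?case
    by (rule Ck_on_SucI[OF assms(1) bounded_linear.has_derivative[OF assms(3) Ck_on_has_derivative]])
       (use Suc assms(1) in auto)
qed

lemma Ck_on_component:
  "open N \<Longrightarrow> Ck_on k N f \<Longrightarrow> Ck_on k N (\<lambda>x. f x $ i)"
  using Ck_on_bounded_linear[OF _ _ bounded_linear_vec_nth] by blast

text \<open>Order one is the regularity of the cutoff functions below.\<close>

lemma Ck_on_1_compose: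
  fixes q :: "'a::euclidean_space \<Rightarrow> real"
  assumes "open N" "Ck_on 1 N q" "\<And>x. x \<in> N \<Longrightarrow> (h has_real_derivative h' (q x)) (at (q x))"
    and "continuous_on (q ` N) h'"
  shows "Ck_on 1 N (\<lambda>x. h (q x))"
proof -
  have q: "Ck_on (Suc 0) N q" using assms(2) by simp
  have "Ck_on (Suc 0) N (\<lambda>x. h (q x))"
  proof (rule Ck_on_SucI[OF assms(1)])
    show "((\<lambda>x. h (q x)) has_derivative (\<lambda>v. frechet_derivative q (at x) v * h' (q x))) (at x)"
      if "x \<in> N" for x
      using has_derivative_compose[OF Ck_on_has_derivative[OF q assms(1) that]
          assms(3)[OF that, unfolded has_field_derivative_def]]
      by (simp add: mult.commute)
    have "continuous_on N (\<lambda>x. h' (q x))"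
      by (rule continuous_on_compose2[OF assms(4)])
         (use Ck_on_imp_continuous_on[OF assms(2)] in auto)
    then show "Ck_on 0 N (\<lambda>x. frechet_derivative q (at x) v * h' (q x))" for v
      using q by (auto intro!: continuous_on_mult)
  qed
  then show ?thesis by simp
qed

section \<open>A \<open>C\<^sup>1\<close> cutoff profile\<close>

definition pos_sq :: "real \<Rightarrow> real" where
  "pos_sq t = (max 0 t)\<^sup>2"

lemma pos_sq_deriv: "(pos_sq has_real_derivative 2 * max 0 t) (at t)"
proof (cases t "0::real" rule: linorder_cases)
  case less
  have "((\<lambda>x. 0) has_real_derivative 2 * max 0 t) (at t)" using less by simp
  then show ?thesis
    by (rule has_field_derivative_transform_within_open[of _ _ _ "{..<0}"])
       (use less in \<open>auto simp: pos_sq_def\<close>)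
next
  case greater
  have "((\<lambda>x. x\<^sup>2) has_real_derivative 2 * max 0 t) (at t)"
    using greater by (auto intro!: derivative_eq_intros)
  then show ?thesis
    by (rule has_field_derivative_transform_within_open[of _ _ _ "{0<..}"])
       (use greater in \<open>auto simp: pos_sq_def\<close>)
next
  case equal
  have "((\<lambda>y. pos_sq y / y) \<longlongrightarrow> 0) (at 0)"
  proof (rule Lim_null_comparison)
    show "\<forall>\<^sub>F y in at 0. norm (pos_sq y / y) \<le> norm y"
      by (rule always_eventually) (auto simp: pos_sq_def max_def power2_eq_square)
    show "((\<lambda>y::real. norm y) \<longlongrightarrow> 0) (at 0)"
      using tendsto_norm_zero[OF tendsto_ident_at] .
  qed
  then show ?thesis
    using equal by (simp add: has_field_derivative_iff pos_sq_def)
qed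

text \<open>A piecewise polynomial profile, \<open>1\<close> on \<open>t \<le> 1\<close> and \<open>0\<close> on \<open>t \<ge> 2\<close>. Cutoff functions are
differentiated only once, so \<open>C\<^sup>1\<close> regularity suffices.\<close>

definition cutoff :: "real \<Rightarrow> real" where
  "cutoff t = pos_sq (1 - pos_sq (t - 1))"

definition cutoff' :: "real \<Rightarrow> real" where
  "cutoff' t = 2 * max 0 (1 - pos_sq (t - 1)) * - (2 * max 0 (t - 1))"

lemma cutoff_deriv: "(cutoff has_real_derivative cutoff' t) (at t)"
proof -
  have i: "((\<lambda>t. 1 - pos_sq (t - 1)) has_real_derivative - (2 * max 0 (t - 1))) (at t)"
    by (auto intro!: derivative_eq_intros DERIV_chain2[OF pos_sq_deriv])
  show ?thesis
    using DERIV_chain2[OF pos_sq_deriv i] unfolding cutoff_def[abs_def] cutoff'_def .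
qed

lemma continuous_cutoff': "continuous_on S cutoff'"
  unfolding cutoff'_def[abs_def] pos_sq_def by (intro continuous_intros)

lemma cutoff_eq_1: "t \<le> 1 \<Longrightarrow> cutoff t = 1"
  by (simp add: cutoff_def pos_sq_def)

lemma cutoff_eq_0:
  assumes "2 \<le> t" shows "cutoff t = 0"
proof -
  have "1 \<le> (t - 1)\<^sup>2" using assms by (simp add: one_le_power)
  with assms show ?thesis by (simp add: cutoff_def pos_sq_def max.absorb1 max.absorb2)
qed

lemma cutoff_nonneg: "0 \<le> cutoff t"
  by (simp add: cutoff_def pos_sq_def)

section \<open>Derivatives within the half-plane\<close>

lemma at_within_Int_open:
  "open N \<Longrightarrow> x \<in> N \<Longrightarrow> at x within T \<inter> N = at x within T"
  by (rule at_within_nhd) auto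

lemma openin_half_plane_ball:
  assumes "openin (top_of_set half_plane) T" "x \<in> T"
  obtains e where "0 < e" "ball x e \<inter> half_plane \<subseteq> T"
proof -
  obtain V where "open V" "T = half_plane \<inter> V" using assms(1) by (auto simp: openin_open)
  moreover from this obtain e where "0 < e" "ball x e \<subseteq> V"
    using assms(2) open_contains_ball by blast
  ultimately show ?thesis using that by blast
qed

text \<open>From every point of a relatively open subset of the half-plane one can move a little in each
positive coordinate direction, and a derivative is determined by its values along these. Thus
coordinate derivatives are meaningful up to the boundary of the manifold.\<close>

lemma half_plane_derivative_unique:
  fixes f :: "real^2 \<Rightarrow> 'b::real_normed_vector"
  assumes "openin (top_of_set half_plane) T" "x \<in> T"
    and "(f has_derivative f') (at x within T)" "(f has_derivative f'') (at x within T)"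
  shows "f' = f''"
proof (rule frechet_derivative_unique_within[OF assms(3,4)])
  fix i :: "real^2" and e :: real
  assume i: "i \<in> Basis" and e: "0 < e"
  obtain r where r: "0 < r" "ball x r \<inter> half_plane \<subseteq> T"
    using openin_half_plane_ball[OF assms(1,2)] .
  have x: "0 \<le> x $ 1"
    using assms(1,2) openin_imp_subset by (fastforce simp: half_plane_def)
  have i1: "0 \<le> i $ 1"
    using i by (auto simp: Basis_vec_def axis_def)
  define d where "d = min r e / 2"
  have d: "0 < d" "d < r" "d < e" using r(1) e by (auto simp: d_def)
  have "x + d *\<^sub>R i \<in> ball x r"
    using d i by (simp add: dist_norm)
  moreover have "x + d *\<^sub>R i \<in> half_plane"
    using x i1 d by (simp add: half_plane_def)
  ultimately show "\<exists>d. 0 < \<bar>d\<bar> \<and> \<bar>d\<bar> < e \<and> x + d *\<^sub>R i \<in> T"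
    using d r by (intro exI[of _ d]) auto
qed

lemma half_plane_frechet_derivative:
  fixes f :: "real^2 \<Rightarrow> 'b::real_normed_vector"
  assumes "openin (top_of_set half_plane) T" "x \<in> T" "(f has_derivative f') (at x within T)"
  shows "frechet_derivative f (at x within T) = f'"
  using half_plane_derivative_unique[OF assms(1,2)] assms(3)
  by (metis differentiableI frechet_derivative_works)

lemma smooth_onE:
  assumes "smooth_on S f" "x \<in> S"
  obtains N F where "open N" "x \<in> N" "\<forall>k. Ck_on k N F" "\<forall>y\<in>S \<inter> N. F y = f y"
proof -
  from assms(1)[unfolded smooth_on_def, THEN bspec, OF assms(2)]
  obtain N F where "open N \<and> x \<in> N \<and> (\<forall>k. Ck_on k N F) \<and> (\<forall>y\<in>S \<inter> N. F y = f y)"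
    by (elim exE)
  then show ?thesis by (intro that[of N F]) simp_all
qed

lemma smooth_onI:
  assumes "\<And>x. x \<in> S \<Longrightarrow>
    \<exists>N F. open N \<and> x \<in> N \<and> (\<forall>k. Ck_on k N F) \<and> (\<forall>y\<in>S \<inter> N. F y = f y)"
  shows "smooth_on S f"
  unfolding smooth_on_def using assms by (rule ballI)

lemma smooth_on_imp_differentiable:
  assumes "smooth_on T f" "x \<in> T"
  shows "f differentiable (at x within T)"
proof -
  obtain N F where N: "open N" "x \<in> N" "\<forall>k. Ck_on k N F" "\<forall>y\<in>T \<inter> N. F y = f y"
    using smooth_onE[OF assms(1,2)] .
  have "(F has_derivative frechet_derivative F (at x)) (at x within T \<inter> N)"
    using Ck_on_has_derivative[OF N(3)[rule_format] N(1,2)] has_derivative_at_withinI by blast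
  then have "(f has_derivative frechet_derivative F (at x)) (at x within T \<inter> N)"
    using N assms(2) by (intro has_derivative_transform[of x "T \<inter> N" f F]) auto
  then show ?thesis
    using N(1,2) by (metis at_within_Int_open differentiableI)
qed

lemma smooth_on_imp_continuous_on: "smooth_on T f \<Longrightarrow> continuous_on T f"
  using smooth_on_imp_differentiable differentiable_imp_continuous_within
  by (metis continuous_on_eq_continuous_within)

lemma smooth_on_imp_Ck_on:
  assumes "smooth_on T f" "open N" "N \<subseteq> T"
  shows "Ck_on k N f"
proof (rule Ck_on_local)
  fix x assume x: "x \<in> N"
  then have "x \<in> T" using assms(3) ..
  then obtain M F where M: "open M" "x \<in> M" "\<forall>k. Ck_on k M F" "\<forall>y\<in>T \<inter> M. F y = f y"
    using smooth_onE[OF assms(1)] by blast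
  have "Ck_on k (N \<inter> M) f"
    using M assms by (intro Ck_on_cong[OF _ _ Ck_on_subset[OF M(3)[rule_format]]]) auto
  then show "\<exists>M. open M \<and> x \<in> M \<and> Ck_on k M f"
    using M assms x by (intro exI[of _ "N \<inter> M"]) auto
qed

text \<open>The derivative within \<open>T\<close> agrees with that of any local smooth extension, which is continuous.\<close>

lemma smooth_on_continuous_derivative:
  fixes f :: "real^2 \<Rightarrow> 'b::real_normed_vector"
  assumes "smooth_on T f" "openin (top_of_set half_plane) T"
  shows "continuous_on T (\<lambda>x. frechet_derivative f (at x within T) v)"
proof (unfold continuous_on_eq_continuous_within, rule ballI)
  fix x assume x: "x \<in> T"
  obtain N F where N: "open N" "x \<in> N" "\<forall>k. Ck_on k N F" "\<forall>y\<in>T \<inter> N. F y = f y"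
    using smooth_onE[OF assms(1) x] .
  have eq: "frechet_derivative f (at y within T) = frechet_derivative F (at y)"
    if y: "y \<in> T \<inter> N" for y
  proof -
    have "(F has_derivative frechet_derivative F (at y)) (at y within T \<inter> N)"
      using Ck_on_has_derivative[OF N(3)[rule_format] N(1)] y has_derivative_at_withinI by blast
    then have "(f has_derivative frechet_derivative F (at y)) (at y within T \<inter> N)"
      using N y by (intro has_derivative_transform[of y "T \<inter> N" f F]) auto
    then have "(f has_derivative frechet_derivative F (at y)) (at y within T)"
      using N(1) y at_within_Int_open by (metis IntD2)
    then show ?thesis using half_plane_frechet_derivative[OF assms(2)] y by blast
  qed
  have "continuous_on N (\<lambda>y. frechet_derivative F (at y) v)"
    using N(3)[rule_format, of "Suc 0"] by simp
  then have "continuous_on (T \<inter> N) (\<lambda>y. frechet_derivative F (at y) v)"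
    using continuous_on_subset by blast
  then have "continuous_on (T \<inter> N) (\<lambda>y. frechet_derivative f (at y within T) v)"
    by (rule continuous_on_eq) (simp add: eq)
  then have "continuous (at x within T \<inter> N) (\<lambda>y. frechet_derivative f (at y within T) v)"
    using x N(2) by (simp add: continuous_on_eq_continuous_within)
  then show "continuous (at x within T) (\<lambda>y. frechet_derivative f (at y within T) v)"
    using N(1,2) by (simp add: continuous_within at_within_Int_open)
qed

lemma smooth_on_pointwise:
  fixes S :: "'a::euclidean_space set"
  assumes op: "\<And>k (N :: 'a set) F G. open N \<Longrightarrow> Ck_on k N F \<Longrightarrow> Ck_on k N G \<Longrightarrow> Ck_on k N (\<lambda>x. h (F x) (G x))"
    and f: "smooth_on S f" and g: "smooth_on S g"
  shows "smooth_on S (\<lambda>x. h (f x) (g x))"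
proof (rule smooth_onI)
  fix x assume x: "x \<in> S"
  obtain N F where N: "open N" "x \<in> N" "\<forall>k. Ck_on k N F" "\<forall>y\<in>S \<inter> N. F y = f y"
    using smooth_onE[OF f x] .
  obtain M G where M: "open M" "x \<in> M" "\<forall>k. Ck_on k M G" "\<forall>y\<in>S \<inter> M. G y = g y"
    using smooth_onE[OF g x] .
  have "Ck_on k (N \<inter> M) (\<lambda>x. h (F x) (G x))" for k
    using N M by (intro op) (auto intro: Ck_on_subset)
  then show "\<exists>N H. open N \<and> x \<in> N \<and> (\<forall>k. Ck_on k N H) \<and> (\<forall>y\<in>S \<inter> N. H y = h (f y) (g y))"
    using N M by (intro exI[of _ "N \<inter> M"] exI[of _ "\<lambda>x. h (F x) (G x)"]) auto
qed

lemma smooth_on_add: "smooth_on S f \<Longrightarrow> smooth_on S g \<Longrightarrow> smooth_on S (\<lambda>x. f x + g x)"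
  by (rule smooth_on_pointwise[of "(+)"]) (rule Ck_on_add)

lemma smooth_on_mult:
  fixes f g :: "'a::euclidean_space \<Rightarrow> real"
  shows "smooth_on S f \<Longrightarrow> smooth_on S g \<Longrightarrow> smooth_on S (\<lambda>x. f x * g x)"
  by (rule smooth_on_pointwise[of "(*)"]) (rule Ck_on_mult)

lemma smooth_on_const: "smooth_on S (\<lambda>x. c)"
proof (rule smooth_onI)
  fix x
  show "\<exists>N F. open N \<and> x \<in> N \<and> (\<forall>k. Ck_on k N F) \<and> (\<forall>y\<in>S \<inter> N. F y = c)"
    by (intro exI[of _ UNIV] exI[of _ "\<lambda>x. c"]) (simp add: Ck_on_const)
qed

section \<open>Compactly supported functions have derivatives of integral zero\<close>

lemma integral_lborel_translate:
  fixes F :: "'a::euclidean_space \<Rightarrow> real"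
  assumes "F \<in> borel_measurable borel"
  shows "integral\<^sup>L lborel (\<lambda>x. F (c + x)) = integral\<^sup>L lborel F"
proof -
  have "integral\<^sup>L (distr lborel borel ((+) c)) F = integral\<^sup>L lborel (\<lambda>x. F (c + x))"
    using assms by (intro integral_distr) auto
  then show ?thesis by (simp add: lborel_distr_plus)
qed

lemma integrable_lborel_compact_support:
  fixes F :: "'a::euclidean_space \<Rightarrow> real"
  assumes "continuous_on UNIV F" "compact C" "\<And>x. x \<notin> C \<Longrightarrow> F x = 0"
  shows "integrable lborel F"
proof -
  have "integrable lborel (\<lambda>x. indicator C x *\<^sub>R F x)"
    using assms by (intro borel_integrable_compact) (auto intro: continuous_on_subset)
  moreover have "(\<lambda>x. indicator C x *\<^sub>R F x) = F"
    using assms(3) by (auto simp: indicator_def fun_eq_iff)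
  ultimately show ?thesis by simp
qed

text \<open>By translation invariance the difference quotients \<open>(F (x + h v) - F x) / h\<close> have integral zero.
The mean value theorem bounds them by a constant on a fixed compact set, so the integral of their
limit, the derivative along \<open>v\<close>, is zero too.\<close>

lemma integral_derivative_compact_support:
  fixes F :: "'a::euclidean_space \<Rightarrow> real"
  assumes F: "Ck_on 1 UNIV F" and C: "compact C" and supp: "\<And>x. x \<notin> C \<Longrightarrow> F x = 0"
  shows "integrable lborel (\<lambda>x. frechet_derivative F (at x) v)" (is "integrable _ ?D")
    and "integral\<^sup>L lborel (\<lambda>x. frechet_derivative F (at x) v) = 0"
proof -
  have F1: "Ck_on (Suc 0) UNIV F" using F by simp
  have der: "(F has_derivative frechet_derivative F (at x)) (at x)" for x
    using Ck_on_has_derivative[OF F1] by simp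
  have contF: "continuous_on UNIV F" using F by (rule Ck_on_imp_continuous_on)
  have contD: "continuous_on UNIV ?D" using F by simp
  have D0: "?D x = 0" if "x \<notin> C" for x
  proof -
    have "((\<lambda>x. 0) has_derivative (\<lambda>h. 0)) (at x)" by simp
    then have "(F has_derivative (\<lambda>h. 0)) (at x)"
      by (rule has_derivative_transform_within_open[of _ _ _ _ "- C"])
         (use that supp compact_imp_closed[OF C] in auto)
    then show ?thesis by (simp add: frechet_derivative_eqI)
  qed
  show int: "integrable lborel ?D"
    by (rule integrable_lborel_compact_support[OF contD C D0])
  have intF: "integrable lborel F"
    by (rule integrable_lborel_compact_support[OF contF C supp])
  define h where "h n = inverse (real (Suc n))" for n
  have h: "0 < h n" "h n \<le> 1" for n by (auto simp: h_def field_simps)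
  have h0: "h \<longlonglongrightarrow> 0" unfolding h_def by (rule LIMSEQ_inverse_real_of_nat)
  define q where "q n x = (F (h n *\<^sub>R v + x) - F x) / h n" for n x
  have line: "((\<lambda>s. F (s *\<^sub>R v + x)) has_real_derivative ?D (t *\<^sub>R v + x)) (at t)" for t x
  proof -
    have "((\<lambda>s. F (s *\<^sub>R v + x)) has_derivative
        (\<lambda>s. frechet_derivative F (at (t *\<^sub>R v + x)) (s *\<^sub>R v))) (at t)"
      by (rule has_derivative_compose[OF _ der]) (auto intro!: derivative_eq_intros)
    moreover have "frechet_derivative F (at (t *\<^sub>R v + x)) (s *\<^sub>R v) = ?D (t *\<^sub>R v + x) * s" for s
      using linear_scale[OF has_derivative_linear[OF der]] by simp
    ultimately show ?thesis
      by (simp add: has_field_derivative_def)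
  qed
  have lim: "(\<lambda>n. q n x) \<longlonglongrightarrow> ?D x" for x
  proof -
    have "((\<lambda>s. (F (s *\<^sub>R v + x) - F x) / s) \<longlongrightarrow> ?D x) (at 0)"
      using line[of x 0] by (simp add: has_field_derivative_iff)
    moreover have "filterlim h (at 0) sequentially"
      using h0 h(1) by (auto simp: filterlim_at less_imp_neq[symmetric])
    ultimately show ?thesis unfolding q_def by (rule filterlim_compose)
  qed
  obtain L where L: "\<And>x. \<bar>?D x\<bar> \<le> L"
  proof -
    have "bounded (?D ` C)"
      using contD C by (intro compact_imp_bounded compact_continuous_image) (auto intro: continuous_on_subset)
    then obtain B where B: "\<And>x. x \<in> C \<Longrightarrow> \<bar>?D x\<bar> \<le> B" by (auto simp: bounded_iff)
    have "\<bar>?D x\<bar> \<le> max B 0" for x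
      using B[of x] D0[of x] by (cases "x \<in> C") auto
    then show ?thesis using that by blast
  qed
  have L0: "0 \<le> L" using L[of 0] by linarith
  \<comment> \<open>the starting points of the segments \<open>{x + s v | 0 \<le> s \<le> 1}\<close> that meet \<open>C\<close>\<close>
  define K where "K = (\<lambda>(s, y). y - s *\<^sub>R v) ` ({0..1} \<times> C)"
  have K: "compact K"
    unfolding K_def using C
    by (intro compact_continuous_image compact_Times) (auto intro!: continuous_intros simp: split_beta)
  have bound: "norm (q n x) \<le> indicator K x *\<^sub>R L" for n x
  proof -
    obtain t where t: "0 < t" "t < h n" and eq: "F (h n *\<^sub>R v + x) - F (0 *\<^sub>R v + x) = (h n - 0) * ?D (t *\<^sub>R v + x)"
      using MVT2[OF h(1)[of n], where f = "\<lambda>s. F (s *\<^sub>R v + x)" and f' = "\<lambda>t. ?D (t *\<^sub>R v + x)"] line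
      by blast
    have q: "q n x = ?D (t *\<^sub>R v + x)" using eq h(1)[of n] by (simp add: q_def)
    show ?thesis
    proof (cases "t *\<^sub>R v + x \<in> C")
      case True
      have "x = (\<lambda>(s, y). y - s *\<^sub>R v) (t, t *\<^sub>R v + x)" by simp
      moreover have "(t, t *\<^sub>R v + x) \<in> {0..1} \<times> C" using True t h(2)[of n] by auto
      ultimately have "x \<in> K" unfolding K_def by (rule image_eqI)
      then show ?thesis using L q by simp
    next
      case False
      then show ?thesis using D0 q L0 by simp
    qed
  qed
  have "(\<lambda>n. integral\<^sup>L lborel (q n)) \<longlonglongrightarrow> integral\<^sup>L lborel ?D"
  proof (rule integral_dominated_convergence)
    show "integrable lborel (\<lambda>x. indicator K x *\<^sub>R L)"
      using K by (intro borel_integrable_compact) auto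
    show "?D \<in> borel_measurable lborel"
      using contD by (simp add: borel_measurable_continuous_onI)
    have "F \<in> borel_measurable borel" using contF by (rule borel_measurable_continuous_onI)
    then show "q n \<in> borel_measurable lborel" for n
      unfolding q_def[abs_def] by measurable
  qed (use lim bound in auto)
  moreover have "integral\<^sup>L lborel (q n) = 0" for n
  proof -
    have mF: "F \<in> borel_measurable borel" using contF by (rule borel_measurable_continuous_onI)
    have "integrable (distr lborel borel ((+) (h n *\<^sub>R v))) F"
      using intF by (simp add: lborel_distr_plus)
    then have "integrable lborel (\<lambda>x. F (h n *\<^sub>R v + x))"
      by (subst (asm) integrable_distr_eq) (use mF in auto)
    then show ?thesis
      unfolding q_def[abs_def] using intF integral_lborel_translate[OF mF, of "h n *\<^sub>R v"]
      by simp
  qed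
  ultimately show "integral\<^sup>L lborel ?D = 0"
    by (simp add: LIMSEQ_const_iff)
qed

section \<open>Positive definite \<open>2 \<times> 2\<close> matrices\<close>

lemma matrix_inv_mult:
  fixes G :: "real^'n^'n"
  assumes "invertible G"
  shows "G ** matrix_inv G = mat 1"
  using someI_ex[OF assms[unfolded invertible_def]] unfolding matrix_inv_def by blast

lemma positive_definite_invertible:
  fixes G :: "real^'n^'n"
  assumes "\<forall>v. v \<noteq> 0 \<longrightarrow> 0 < v \<bullet> (G *v v)"
  shows "invertible G"
proof -
  have "G *v x = 0 \<longrightarrow> x = 0" for x using assms by force
  then show ?thesis by (simp add: invertible_left_inverse matrix_left_invertible_ker)
qed

lemma inner_matrix_transpose:
  fixes M :: "real^'n^'m"
  shows "(M *v x) \<bullet> y = x \<bullet> (transpose M *v y)"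
  by (metis dot_lmul_matrix transpose_transpose vector_transpose_matrix)

lemma positive_definite_det_pos:
  fixes G :: "real^2^2"
  assumes "transpose G = G" "\<forall>v. v \<noteq> 0 \<longrightarrow> 0 < v \<bullet> (G *v v)"
  shows "0 < det G"
proof -
  have sym: "G $ 1 $ 2 = G $ 2 $ 1"
    using arg_cong[OF assms(1), of "\<lambda>M. M $ 2 $ 1"] by (simp add: transpose_def)
  have "0 < axis 1 1 \<bullet> (G *v axis 1 1)" using assms(2) by (simp add: axis_eq_0_iff)
  then have a: "0 < G $ 1 $ 1"
    by (simp add: inner_axis' matrix_vector_mult_basis column_def)
  \<comment> \<open>chosen so that \<open>v \<bullet> (G *v v) = G $ 1 $ 1 * det G\<close>\<close>
  define v :: "real^2" where "v = vector [- (G $ 1 $ 2), G $ 1 $ 1]"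
  have "v \<noteq> 0" using a by (auto simp: v_def vec_eq_iff forall_2)
  then have "0 < v \<bullet> (G *v v)" using assms(2) by blast
  also have "v \<bullet> (G *v v) = G $ 1 $ 1 * det G"
    by (simp add: v_def inner_vec_def matrix_vector_mult_def sum_2 det_2 sym algebra_simps)
  finally show ?thesis using a by (simp add: zero_less_mult_iff)
qed

lemma cramer_2:
  fixes G :: "real^2^2"
  assumes "G *v x = a" "det G \<noteq> 0"
  shows "x $ 1 = (G $ 2 $ 2 * a $ 1 - G $ 1 $ 2 * a $ 2) / det G"
    and "x $ 2 = (G $ 1 $ 1 * a $ 2 - G $ 2 $ 1 * a $ 1) / det G"
proof -
  have "a $ 1 = G $ 1 $ 1 * x $ 1 + G $ 1 $ 2 * x $ 2" "a $ 2 = G $ 2 $ 1 * x $ 1 + G $ 2 $ 2 * x $ 2"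
    using assms(1) by (auto simp: matrix_vector_mult_def sum_2)
  then show "x $ 1 = (G $ 2 $ 2 * a $ 1 - G $ 1 $ 2 * a $ 2) / det G"
    and "x $ 2 = (G $ 1 $ 1 * a $ 2 - G $ 2 $ 1 * a $ 1) / det G"
    using assms(2) by (simp_all add: det_2 field_simps)
qed

section \<open>Charts\<close>

abbreviation chart_image :: "'a chart \<Rightarrow> (real^2) set" where
  "chart_image c \<equiv> coords c ` chart_dom c"

text \<open>A point outside \<open>manifold_boundary A\<close> has positive first coordinate in every chart around it, so
the interior parts of charts carry all the calculus on supports of test functions. They are open
in the plane.\<close>

definition chart_interior :: "'a chart \<Rightarrow> (real^2) set" where
  "chart_interior c = {x \<in> chart_image c. 0 < x $ 1}"

definition interior_dom :: "'a chart \<Rightarrow> 'a set" where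
  "interior_dom c = {p \<in> chart_dom c. 0 < coords c p $ 1}"

definition chart_grad :: "'a chart \<Rightarrow> ('a \<Rightarrow> real) \<Rightarrow> 'a \<Rightarrow> real^2" where
  "chart_grad c u p = (\<chi> i. partial_deriv c i u p)"

definition chart_differentiable :: "'a chart \<Rightarrow> ('a \<Rightarrow> real) \<Rightarrow> 'a \<Rightarrow> bool" where
  "chart_differentiable c u p \<longleftrightarrow>
     (u \<circ> chart_inv c) differentiable (at (coords c p) within chart_image c)"

locale riemannian_surface =
  fixes A :: "'a::{t2_space,second_countable_topology} chart set"
    and g :: "'a metric_field" and vol :: "'a measure"
  assumes atlas: "smooth_atlas A"
    and metric: "riemannian_metric A g"
    and volume: "riemannian_volume A g vol"
begin

lemma open_chart_dom: "c \<in> A \<Longrightarrow> open (chart_dom c)"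
  using atlas by (simp add: smooth_atlas_def)

lemma openin_chart_image: "c \<in> A \<Longrightarrow> openin (top_of_set half_plane) (chart_image c)"
  using atlas by (simp add: smooth_atlas_def)

lemma chart_homeomorphism:
  "c \<in> A \<Longrightarrow> homeomorphism (chart_dom c) (chart_image c) (coords c) (chart_inv c)"
  using atlas by (simp add: smooth_atlas_def)

lemma chart_inv_coords [simp]: "c \<in> A \<Longrightarrow> p \<in> chart_dom c \<Longrightarrow> chart_inv c (coords c p) = p"
  using chart_homeomorphism homeomorphism_apply1 by blast

lemma coords_chart_inv [simp]: "c \<in> A \<Longrightarrow> x \<in> chart_image c \<Longrightarrow> coords c (chart_inv c x) = x"
  using chart_homeomorphism homeomorphism_apply2 by blast

lemma chart_inv_in_dom [simp]: "c \<in> A \<Longrightarrow> x \<in> chart_image c \<Longrightarrow> chart_inv c x \<in> chart_dom c"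
  by (metis chart_inv_coords imageE)

lemma continuous_on_coords: "c \<in> A \<Longrightarrow> continuous_on (chart_dom c) (coords c)"
  using chart_homeomorphism homeomorphism_def by blast

lemma continuous_on_chart_inv: "c \<in> A \<Longrightarrow> continuous_on (chart_image c) (chart_inv c)"
  using chart_homeomorphism homeomorphism_def by blast

lemma chart_cover: obtains c where "c \<in> A" "p \<in> chart_dom c"
proof -
  have "p \<in> (\<Union>c\<in>A. chart_dom c)" using atlas by (simp add: smooth_atlas_def)
  then show ?thesis using that by blast
qed

lemma chart_at: "chart_at A p \<in> A" "p \<in> chart_dom (chart_at A p)"
proof -
  have "\<exists>c. c \<in> A \<and> p \<in> chart_dom c" using chart_cover by blast
  then have "chart_at A p \<in> A \<and> p \<in> chart_dom (chart_at A p)"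
    unfolding chart_at_def by (rule someI_ex)
  then show "chart_at A p \<in> A" "p \<in> chart_dom (chart_at A p)" by auto
qed

lemma coords_nonneg: "c \<in> A \<Longrightarrow> p \<in> chart_dom c \<Longrightarrow> 0 \<le> coords c p $ 1"
  using openin_imp_subset[OF openin_chart_image] by (fastforce simp: half_plane_def)

lemma continuous_on_chart_domI:
  assumes "c \<in> A" "continuous_on (chart_image c) (f \<circ> chart_inv c)"
  shows "continuous_on (chart_dom c) f"
proof -
  have "continuous_on (chart_dom c) (\<lambda>p. (f \<circ> chart_inv c) (coords c p))"
    by (rule continuous_on_compose2[OF assms(2) continuous_on_coords[OF assms(1)]]) auto
  then show ?thesis
    by (rule continuous_on_eq) (simp add: assms(1))
qed

lemma continuous_on_UNIV_charts:
  fixes f :: "'a \<Rightarrow> 'b::topological_space"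
  assumes "\<And>c. c \<in> A \<Longrightarrow> continuous_on (chart_dom c) f"
  shows "continuous_on UNIV f"
proof -
  have "continuous_on (\<Union>c\<in>A. chart_dom c) f"
    by (rule continuous_on_open_UN) (use assms open_chart_dom in auto)
  moreover have "(\<Union>c\<in>A. chart_dom c) = UNIV" using atlas by (simp add: smooth_atlas_def)
  ultimately show ?thesis by simp
qed

section \<open>Transition maps\<close>

lemma openin_overlap:
  assumes "c \<in> A" "open V"
  obtains W where "open W" "coords c ` (chart_dom c \<inter> V) = chart_image c \<inter> W"
proof -
  have "openin (top_of_set (chart_dom c)) (chart_dom c \<inter> V)"
    using assms(2) by (auto simp: openin_open)
  then have "openin (top_of_set (chart_image c)) (coords c ` (chart_dom c \<inter> V))"
    using chart_homeomorphism[OF assms(1)] homeomorphism_imp_open_map by blast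
  then show ?thesis using that by (auto simp: openin_open)
qed

lemma at_within_overlap:
  assumes "c \<in> A" "open V" "p \<in> chart_dom c \<inter> V"
  shows "at (coords c p) within coords c ` (chart_dom c \<inter> V) = at (coords c p) within chart_image c"
proof -
  obtain W where W: "open W" "coords c ` (chart_dom c \<inter> V) = chart_image c \<inter> W"
    using openin_overlap[OF assms(1,2)] .
  have "coords c p \<in> W" using W(2) assms(3) by blast
  then show ?thesis unfolding W(2) by (rule at_within_Int_open[OF W(1)])
qed

lemma smooth_transition:
  "c \<in> A \<Longrightarrow> d \<in> A \<Longrightarrow> smooth_on (coords c ` (chart_dom c \<inter> chart_dom d)) (coords d \<circ> chart_inv c)"
  using atlas by (simp add: smooth_atlas_def)

lemma has_derivative_transition:
  assumes "c \<in> A" "d \<in> A" "p \<in> chart_dom c \<inter> chart_dom d"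
  shows "((coords d \<circ> chart_inv c) has_derivative (\<lambda>v. transition_jacobian c d p *v v))
    (at (coords c p) within coords c ` (chart_dom c \<inter> chart_dom d))"
proof -
  let ?S = "coords c ` (chart_dom c \<inter> chart_dom d)"
  have "(coords d \<circ> chart_inv c) differentiable (at (coords c p) within ?S)"
    using smooth_transition[OF assms(1,2)] assms(3) by (intro smooth_on_imp_differentiable) auto
  then have D: "((coords d \<circ> chart_inv c) has_derivative
      frechet_derivative (coords d \<circ> chart_inv c) (at (coords c p) within ?S)) (at (coords c p) within ?S)"
    by (simp add: frechet_derivative_works)
  moreover have "frechet_derivative (coords d \<circ> chart_inv c) (at (coords c p) within ?S) =
      (\<lambda>v. transition_jacobian c d p *v v)"
    unfolding transition_jacobian_def using has_derivative_linear[OF D] by simp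
  ultimately show ?thesis by simp
qed

lemma partial_deriv_eq:
  assumes "c \<in> A" "p \<in> chart_dom c" "((u \<circ> chart_inv c) has_derivative D) (at (coords c p) within chart_image c)"
  shows "partial_deriv c i u p = D (axis i 1)"
  unfolding partial_deriv_def using assms
  by (subst half_plane_frechet_derivative[OF openin_chart_image]) auto

lemma chart_differentiable_works:
  assumes "c \<in> A" "p \<in> chart_dom c" "chart_differentiable c u p"
  shows "((u \<circ> chart_inv c) has_derivative (\<lambda>v. chart_grad c u p \<bullet> v)) (at (coords c p) within chart_image c)"
proof -
  obtain D where D: "((u \<circ> chart_inv c) has_derivative D) (at (coords c p) within chart_image c)"
    using assms(3) by (auto simp: chart_differentiable_def differentiable_def)
  have lin: "linear D" using has_derivative_linear[OF D] .
  have "D v = chart_grad c u p \<bullet> v" for v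
  proof -
    have "D v = D (\<Sum>i\<in>UNIV. v $ i *\<^sub>R axis i 1)"
      using basis_expansion[of v] by (simp add: scalar_mult_eq_scaleR)
    also have "\<dots> = (\<Sum>i\<in>UNIV. v $ i * D (axis i 1))"
      using lin by (simp add: linear_sum linear_scale)
    finally show ?thesis
      using partial_deriv_eq[OF assms(1,2) D] by (simp add: chart_grad_def inner_vec_def mult.commute)
  qed
  then show ?thesis using D by (metis (no_types, lifting) ext)
qed

lemma chart_grad_eqI:
  assumes "c \<in> A" "p \<in> chart_dom c"
    and "((u \<circ> chart_inv c) has_derivative (\<lambda>v. a \<bullet> v)) (at (coords c p) within chart_image c)"
  shows "chart_differentiable c u p" "chart_grad c u p = a"
proof -
  show "chart_differentiable c u p"
    using assms(3) by (auto simp: chart_differentiable_def differentiable_def)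
  show "chart_grad c u p = a"
    using partial_deriv_eq[OF assms] by (simp add: chart_grad_def vec_eq_iff inner_axis)
qed

text \<open>The chain rule for the transition map. Derivatives within the image of the overlap coincide with
those within the image of the whole chart, as the former is relatively open in the latter.\<close>

lemma chart_grad_transform:
  assumes "c \<in> A" "d \<in> A" "p \<in> chart_dom c" "p \<in> chart_dom d" "chart_differentiable d u p"
  shows "chart_differentiable c u p"
    and "chart_grad c u p = transpose (transition_jacobian c d p) *v chart_grad d u p"
proof -
  let ?S = "coords c ` (chart_dom c \<inter> chart_dom d)"
  let ?J = "transition_jacobian c d p"
  have tau: "((coords d \<circ> chart_inv c) has_derivative (\<lambda>v. ?J *v v)) (at (coords c p) within ?S)"
    using assms by (intro has_derivative_transition) auto
  have img: "(coords d \<circ> chart_inv c) ` ?S \<subseteq> chart_image d"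
    using assms(1) by auto
  have "(coords d \<circ> chart_inv c) (coords c p) = coords d p" using assms by simp
  then have "((u \<circ> chart_inv d) has_derivative (\<lambda>v. chart_grad d u p \<bullet> v))
      (at ((coords d \<circ> chart_inv c) (coords c p)) within chart_image d)"
    using chart_differentiable_works[OF assms(2,4,5)] by simp
  then have "((u \<circ> chart_inv d) has_derivative (\<lambda>v. chart_grad d u p \<bullet> v))
      (at ((coords d \<circ> chart_inv c) (coords c p)) within (coords d \<circ> chart_inv c) ` ?S)"
    using img has_derivative_subset by blast
  from diff_chain_within[OF tau this]
  have "((u \<circ> chart_inv d \<circ> (coords d \<circ> chart_inv c)) has_derivative
      (\<lambda>v. chart_grad d u p \<bullet> (?J *v v))) (at (coords c p) within ?S)"
    by (simp add: o_def)
  then have "((u \<circ> chart_inv c) has_derivative (\<lambda>v. chart_grad d u p \<bullet> (?J *v v)))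
      (at (coords c p) within ?S)"
    by (rule has_derivative_transform[rotated 2]) (use assms in auto)
  moreover have adj: "(\<lambda>v. chart_grad d u p \<bullet> (?J *v v)) = (\<lambda>v. (transpose ?J *v chart_grad d u p) \<bullet> v)"
    by (intro ext) (metis inner_matrix_transpose transpose_transpose)
  ultimately have "((u \<circ> chart_inv c) has_derivative (\<lambda>v. (transpose ?J *v chart_grad d u p) \<bullet> v))
      (at (coords c p) within chart_image c)"
    using at_within_overlap[OF assms(1) open_chart_dom[OF assms(2)], of p] assms(3,4)
    by (simp only: adj Int_iff simp_thms)
  then show "chart_differentiable c u p" "chart_grad c u p = transpose ?J *v chart_grad d u p"
    using chart_grad_eqI[OF assms(1,3)] by blast+
qed

section \<open>The metric\<close>

lemma metric_symmetric: "c \<in> A \<Longrightarrow> p \<in> chart_dom c \<Longrightarrow> transpose (g c p) = g c p"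
  using metric unfolding riemannian_metric_def by blast

lemma metric_positive: "c \<in> A \<Longrightarrow> p \<in> chart_dom c \<Longrightarrow> v \<noteq> 0 \<Longrightarrow> 0 < v \<bullet> (g c p *v v)"
  using metric unfolding riemannian_metric_def by blast

lemma metric_transform:
  "c \<in> A \<Longrightarrow> d \<in> A \<Longrightarrow> p \<in> chart_dom c \<Longrightarrow> p \<in> chart_dom d \<Longrightarrow>
    g c p = transpose (transition_jacobian c d p) ** g d p ** transition_jacobian c d p"
  using metric unfolding riemannian_metric_def by blast

lemma metric_smooth: "c \<in> A \<Longrightarrow> smooth_on (chart_image c) (g c \<circ> chart_inv c)"
  using metric unfolding riemannian_metric_def by blast

lemma metric_det_pos: "c \<in> A \<Longrightarrow> p \<in> chart_dom c \<Longrightarrow> 0 < det (g c p)"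
  using metric_symmetric metric_positive by (intro positive_definite_det_pos) auto

lemma continuous_on_metric: "c \<in> A \<Longrightarrow> continuous_on (chart_dom c) (g c)"
  using continuous_on_chart_domI smooth_on_imp_continuous_on[OF metric_smooth] by blast

lemma metric_grad: "c \<in> A \<Longrightarrow> p \<in> chart_dom c \<Longrightarrow> g c p *v grad g u c p = chart_grad c u p"
proof -
  assume c: "c \<in> A" "p \<in> chart_dom c"
  have "invertible (g c p)"
    using metric_positive[OF c] by (intro positive_definite_invertible) auto
  then show ?thesis
    by (simp add: grad_def chart_grad_def matrix_vector_mul_assoc matrix_inv_mult)
qed

lemma metric_cancel:
  assumes "c \<in> A" "p \<in> chart_dom c" "g c p *v x = g c p *v y"
  shows "x = y"
proof (rule ccontr)
  assume "x \<noteq> y"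
  then have "0 < (x - y) \<bullet> (g c p *v (x - y))" using metric_positive[OF assms(1,2)] by simp
  then show False using assms(3) by (simp add: matrix_vector_mult_diff_distrib)
qed

lemma grad_eqI: "c \<in> A \<Longrightarrow> p \<in> chart_dom c \<Longrightarrow> g c p *v X = chart_grad c u p \<Longrightarrow> grad g u c p = X"
  by (metis metric_cancel metric_grad)

text \<open>A pointwise condition, because gradients of functions that are only differentiable in the interior
satisfy the transformation rule only there.\<close>

definition transforms_at :: "'a vector_field \<Rightarrow> 'a \<Rightarrow> bool" where
  "transforms_at X p \<longleftrightarrow> (\<forall>c\<in>A. \<forall>d\<in>A. p \<in> chart_dom c \<longrightarrow> p \<in> chart_dom d \<longrightarrow>
      X d p = transition_jacobian c d p *v X c p)"

lemma transforms_atD: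
  "transforms_at X p \<Longrightarrow> c \<in> A \<Longrightarrow> d \<in> A \<Longrightarrow> p \<in> chart_dom c \<Longrightarrow> p \<in> chart_dom d \<Longrightarrow>
    X d p = transition_jacobian c d p *v X c p"
  unfolding transforms_at_def by blast

text \<open>With \<open>J\<close> the Jacobian, \<open>g c p = J\<^sup>T (g d p) J\<close> is positive definite, so \<open>J\<close> is injective and hence
so is \<open>J\<^sup>T\<close>. The chain rule gives the claim after application of \<open>J\<^sup>T (g d p)\<close>, which can be
cancelled.\<close>

lemma grad_transforms_at:
  assumes "\<And>c. c \<in> A \<Longrightarrow> p \<in> chart_dom c \<Longrightarrow> chart_differentiable c u p"
  shows "transforms_at (grad g u) p"
  unfolding transforms_at_def
proof (intro ballI impI)
  fix c d assume c: "c \<in> A" "p \<in> chart_dom c" and d: "d \<in> A" "p \<in> chart_dom d"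
  let ?J = "transition_jacobian c d p"
  have gc: "g c p = transpose ?J ** g d p ** ?J" using metric_transform c d by blast
  have ker: "x = 0" if "?J *v x = 0" for x
  proof (rule ccontr)
    assume "x \<noteq> 0"
    then have "0 < x \<bullet> (g c p *v x)" using metric_positive[OF c] by blast
    then show False using that by (simp add: gc matrix_vector_mul_assoc[symmetric])
  qed
  then have "invertible ?J" by (simp add: invertible_left_inverse matrix_left_invertible_ker)
  then obtain B where "?J ** B = mat 1" by (auto simp: invertible_def)
  then have "transpose B ** transpose ?J = mat 1" by (metis matrix_transpose_mul transpose_mat)
  then have inj: "x = y" if "transpose ?J *v x = transpose ?J *v y" for x y
    using arg_cong[OF that, of "\<lambda>z. transpose B *v z"]
    by (simp only: matrix_vector_mul_assoc matrix_vector_mul_lid)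
  have "transpose ?J *v (g d p *v (?J *v grad g u c p)) = transpose ?J *v (g d p *v grad g u d p)"
    using metric_grad[OF c, of u] metric_grad[OF d, of u]
      chart_grad_transform(2)[OF c(1) d(1) c(2) d(2) assms[OF d]]
    by (simp only: gc matrix_vector_mul_assoc matrix_mul_assoc)
  then have "g d p *v (?J *v grad g u c p) = g d p *v grad g u d p" by (rule inj)
  then show "grad g u d p = ?J *v grad g u c p" using metric_cancel[OF d] by metis
qed

lemma metric_inner_chart:
  assumes "transforms_at X p" "transforms_at Y p" "c \<in> A" "p \<in> chart_dom c"
  shows "metric_inner A g X Y p = X c p \<bullet> (g c p *v Y c p)"
proof -
  let ?d = "chart_at A p"
  let ?J = "transition_jacobian c ?d p"
  have d: "?d \<in> A" "p \<in> chart_dom ?d" by (rule chart_at)+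
  have "X ?d p = ?J *v X c p" "Y ?d p = ?J *v Y c p"
    using transforms_atD[OF assms(1,3) d(1) assms(4) d(2)]
      transforms_atD[OF assms(2,3) d(1) assms(4) d(2)] by simp_all
  then have "metric_inner A g X Y p = (?J *v X c p) \<bullet> (g ?d p *v (?J *v Y c p))"
    by (simp add: metric_inner_def Let_def)
  also have "\<dots> = X c p \<bullet> (g c p *v Y c p)"
    by (simp only: inner_matrix_transpose matrix_vector_mul_assoc metric_transform[OF assms(3) d(1) assms(4) d(2)]
        matrix_mul_assoc)
  finally show ?thesis .
qed

lemma metric_inner_grad_chart:
  assumes "transforms_at (grad g u) p" "transforms_at X p" "c \<in> A" "p \<in> chart_dom c"
  shows "metric_inner A g (grad g u) X p = chart_grad c u p \<bullet> X c p"
  using metric_inner_chart[OF assms] metric_symmetric[OF assms(3,4)] metric_grad[OF assms(3,4), of u]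
  by (metis inner_matrix_transpose)

section \<open>Pointwise algebra of the metric\<close>

lemma metric_inner_commute: "metric_inner A g X Y p = metric_inner A g Y X p"
  using metric_symmetric[OF chart_at(1,2), of p]
  by (simp add: metric_inner_def Let_def) (metis inner_commute inner_matrix_transpose)

lemma metric_inner_nonneg: "0 \<le> metric_inner A g X X p"
  using metric_positive[OF chart_at(1,2), of "X (chart_at A p) p" p]
  by (cases "X (chart_at A p) p = 0") (auto simp: metric_inner_def Let_def intro: less_imp_le)

lemma metric_inner_cong:
  assumes "X (chart_at A p) p = X' (chart_at A p) p" "Y (chart_at A p) p = Y' (chart_at A p) p"
  shows "metric_inner A g X Y p = metric_inner A g X' Y' p"
  using assms by (simp add: metric_inner_def Let_def)

text \<open>The coefficients are functions, so that \<open>\<nabla>(s f) = f \<nabla>s + s \<nabla>f\<close> has this form.\<close>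

definition lin_comb :: "('a \<Rightarrow> real) \<Rightarrow> 'a vector_field \<Rightarrow> ('a \<Rightarrow> real) \<Rightarrow> 'a vector_field \<Rightarrow> 'a vector_field" where
  "lin_comb a X b Y c p = a p *\<^sub>R X c p + b p *\<^sub>R Y c p"

lemma metric_inner_lin_comb_left:
  "metric_inner A g (lin_comb a X b Y) Z p = a p * metric_inner A g X Z p + b p * metric_inner A g Y Z p"
  by (simp add: metric_inner_def Let_def lin_comb_def inner_add_left)

lemma metric_inner_lin_comb_right:
  "metric_inner A g Z (lin_comb a X b Y) p = a p * metric_inner A g Z X p + b p * metric_inner A g Z Y p"
  using metric_inner_lin_comb_left[of a X b Y Z p] by (simp add: metric_inner_commute[of Z])

lemma metric_inner_lin_comb_self:
  "metric_inner A g (lin_comb a X b Y) (lin_comb a X b Y) p =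
    (a p)\<^sup>2 * metric_inner A g X X p + 2 * a p * b p * metric_inner A g X Y p + (b p)\<^sup>2 * metric_inner A g Y Y p"
  using metric_inner_commute[of Y X p]
  by (simp add: metric_inner_lin_comb_left metric_inner_lin_comb_right power2_eq_square algebra_simps)

lemma metric_inner_lin_comb_self_le:
  "metric_inner A g (lin_comb a X b Y) (lin_comb a X b Y) p
    \<le> 2 * (a p)\<^sup>2 * metric_inner A g X X p + 2 * (b p)\<^sup>2 * metric_inner A g Y Y p"
proof -
  have "0 \<le> metric_inner A g (lin_comb a X (\<lambda>q. - b q) Y) (lin_comb a X (\<lambda>q. - b q) Y) p"
    by (rule metric_inner_nonneg)
  then show ?thesis by (simp add: metric_inner_lin_comb_self algebra_simps)
qed

lemma metric_inner_abs_le: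
  "2 * \<bar>metric_inner A g X Y p\<bar> \<le> metric_inner A g X X p + metric_inner A g Y Y p"
  using metric_inner_nonneg[of "lin_comb (\<lambda>_. 1) X (\<lambda>_. 1) Y" p]
    metric_inner_nonneg[of "lin_comb (\<lambda>_. 1) X (\<lambda>_. -1) Y" p]
  by (simp add: metric_inner_lin_comb_self abs_le_iff)

section \<open>Smooth functions and their gradients\<close>

lemma smooth_fun_chart: "smooth_fun_on A UNIV u \<Longrightarrow> c \<in> A \<Longrightarrow> smooth_on (chart_image c) (u \<circ> chart_inv c)"
  by (simp add: smooth_fun_on_def)

lemma smooth_fun_chart_differentiable:
  "smooth_fun_on A UNIV u \<Longrightarrow> c \<in> A \<Longrightarrow> p \<in> chart_dom c \<Longrightarrow> chart_differentiable c u p"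
  unfolding chart_differentiable_def
  by (rule smooth_on_imp_differentiable[OF smooth_fun_chart]) auto

lemma smooth_fun_continuous: "smooth_fun_on A UNIV u \<Longrightarrow> continuous_on UNIV u"
  by (intro continuous_on_UNIV_charts continuous_on_chart_domI smooth_on_imp_continuous_on smooth_fun_chart)

lemma smooth_fun_transforms_at: "smooth_fun_on A UNIV u \<Longrightarrow> transforms_at (grad g u) p"
  by (rule grad_transforms_at) (rule smooth_fun_chart_differentiable)

lemma smooth_fun_add:
  assumes "smooth_fun_on A UNIV u" "smooth_fun_on A UNIV v"
  shows "smooth_fun_on A UNIV (\<lambda>p. u p + v p)"
  unfolding smooth_fun_on_def
  using smooth_on_add[OF smooth_fun_chart[OF assms(1)] smooth_fun_chart[OF assms(2)]]
  by (simp add: o_def)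

lemma smooth_fun_mult:
  assumes "smooth_fun_on A UNIV u" "smooth_fun_on A UNIV v"
  shows "smooth_fun_on A UNIV (\<lambda>p. u p * v p)"
  unfolding smooth_fun_on_def
  using smooth_on_mult[OF smooth_fun_chart[OF assms(1)] smooth_fun_chart[OF assms(2)]]
  by (simp add: o_def)

lemma smooth_fun_const: "smooth_fun_on A UNIV (\<lambda>p. t)"
  by (simp add: smooth_fun_on_def o_def smooth_on_const)

lemma chart_grad_add:
  assumes "c \<in> A" "p \<in> chart_dom c" "chart_differentiable c u p" "chart_differentiable c v p"
  shows "chart_differentiable c (\<lambda>q. u q + v q) p"
    and "chart_grad c (\<lambda>q. u q + v q) p = chart_grad c u p + chart_grad c v p"
proof -
  have "((\<lambda>q. u q + v q) \<circ> chart_inv c has_derivative (\<lambda>h. (chart_grad c u p + chart_grad c v p) \<bullet> h))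
      (at (coords c p) within chart_image c)"
    using has_derivative_add[OF chart_differentiable_works[OF assms(1,2,3)] chart_differentiable_works[OF assms(1,2,4)]]
    by (simp add: o_def inner_add_left)
  from chart_grad_eqI[OF assms(1,2) this]
  show "chart_differentiable c (\<lambda>q. u q + v q) p"
    and "chart_grad c (\<lambda>q. u q + v q) p = chart_grad c u p + chart_grad c v p" by auto
qed

lemma chart_grad_mult:
  assumes "c \<in> A" "p \<in> chart_dom c" "chart_differentiable c u p" "chart_differentiable c v p"
  shows "chart_differentiable c (\<lambda>q. u q * v q) p"
    and "chart_grad c (\<lambda>q. u q * v q) p = u p *\<^sub>R chart_grad c v p + v p *\<^sub>R chart_grad c u p"
proof -
  have "((\<lambda>q. u q * v q) \<circ> chart_inv c has_derivative
      (\<lambda>h. (u p *\<^sub>R chart_grad c v p + v p *\<^sub>R chart_grad c u p) \<bullet> h))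
      (at (coords c p) within chart_image c)"
    using has_derivative_mult[OF chart_differentiable_works[OF assms(1,2,3)] chart_differentiable_works[OF assms(1,2,4)]]
    by (simp add: o_def inner_add_left assms(1,2) mult.commute)
  from chart_grad_eqI[OF assms(1,2) this]
  show "chart_differentiable c (\<lambda>q. u q * v q) p"
    and "chart_grad c (\<lambda>q. u q * v q) p = u p *\<^sub>R chart_grad c v p + v p *\<^sub>R chart_grad c u p" by auto
qed

lemma chart_grad_const:
  assumes "c \<in> A" "p \<in> chart_dom c"
  shows "chart_differentiable c (\<lambda>q. t) p" "chart_grad c (\<lambda>q. t) p = 0"
  using chart_grad_eqI[OF assms, of "\<lambda>q. t" 0] by (simp_all add: o_def)

lemma grad_add:
  assumes "c \<in> A" "p \<in> chart_dom c" "chart_differentiable c u p" "chart_differentiable c v p"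
  shows "grad g (\<lambda>q. u q + v q) c p = grad g u c p + grad g v c p"
  using assms by (intro grad_eqI) (simp_all add: chart_grad_add matrix_vector_right_distrib metric_grad)

lemma grad_mult:
  assumes "c \<in> A" "p \<in> chart_dom c" "chart_differentiable c u p" "chart_differentiable c v p"
  shows "grad g (\<lambda>q. u q * v q) c p = u p *\<^sub>R grad g v c p + v p *\<^sub>R grad g u c p"
  using assms
  by (intro grad_eqI) (simp_all add: chart_grad_mult matrix_vector_right_distrib metric_grad matrix_vector_mult_scaleR)

lemma chart_grad_locally_const:
  assumes "c \<in> A" "p \<in> chart_dom c" "open V" "p \<in> V" "\<And>q. q \<in> V \<Longrightarrow> u q = t"
  shows "chart_differentiable c u p" "chart_grad c u p = 0"
proof -
  have "((\<lambda>x. t) has_derivative (\<lambda>h. 0 \<bullet> h)) (at (coords c p) within coords c ` (chart_dom c \<inter> V))"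
    by simp
  then have "(u \<circ> chart_inv c has_derivative (\<lambda>h. 0 \<bullet> h)) (at (coords c p) within coords c ` (chart_dom c \<inter> V))"
    by (rule has_derivative_transform[rotated 2]) (use assms in auto)
  then have "(u \<circ> chart_inv c has_derivative (\<lambda>h. 0 \<bullet> h)) (at (coords c p) within chart_image c)"
    using at_within_overlap[OF assms(1,3), of p] assms by simp
  from chart_grad_eqI[OF assms(1,2) this]
  show "chart_differentiable c u p" "chart_grad c u p = 0" by auto
qed

lemma grad_locally_const:
  assumes "c \<in> A" "p \<in> chart_dom c" "open V" "p \<in> V" "\<And>q. q \<in> V \<Longrightarrow> u q = t"
  shows "grad g u c p = 0"
  using chart_grad_locally_const(2)[OF assms] by (intro grad_eqI assms) simp_all

lemma continuous_on_chart_grad: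
  assumes "smooth_fun_on A UNIV u" "c \<in> A"
  shows "continuous_on (chart_dom c) (chart_grad c u)"
proof -
  have "continuous_on (chart_dom c) (\<lambda>p. chart_grad c u p $ i)" for i
    unfolding chart_grad_def partial_deriv_def
    using continuous_on_compose2[OF smooth_on_continuous_derivative[OF smooth_fun_chart[OF assms]
          openin_chart_image[OF assms(2)], of "axis i 1"] continuous_on_coords[OF assms(2)]]
    by simp
  then have "continuous_on (chart_dom c) (\<lambda>p. \<chi> i. chart_grad c u p $ i)"
    by (intro continuous_on_vec_lambda)
  then show ?thesis by simp
qed

lemma grad_components:
  assumes "c \<in> A" "p \<in> chart_dom c"
  shows "grad g u c p $ 1 = (g c p $ 2 $ 2 * chart_grad c u p $ 1 - g c p $ 1 $ 2 * chart_grad c u p $ 2) / det (g c p)"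
    and "grad g u c p $ 2 = (g c p $ 1 $ 1 * chart_grad c u p $ 2 - g c p $ 2 $ 1 * chart_grad c u p $ 1) / det (g c p)"
  using cramer_2[OF metric_grad[OF assms, of u]] metric_det_pos[OF assms] by simp_all

lemma continuous_on_det_metric: "c \<in> A \<Longrightarrow> continuous_on (chart_dom c) (\<lambda>p. det (g c p))"
  unfolding det_2 by (intro continuous_intros continuous_on_component continuous_on_metric)

lemma continuous_on_grad:
  assumes "smooth_fun_on A UNIV u" "c \<in> A"
  shows "continuous_on (chart_dom c) (grad g u c)"
proof -
  have nz: "\<forall>p\<in>chart_dom c. det (g c p) \<noteq> 0" using metric_det_pos[OF assms(2)] by force
  have "continuous_on (chart_dom c) (\<lambda>p. grad g u c p $ i)" for i
  proof (cases "i = 1")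
    case True
    have "continuous_on (chart_dom c) (\<lambda>p. (g c p $ 2 $ 2 * chart_grad c u p $ 1 - g c p $ 1 $ 2 * chart_grad c u p $ 2) / det (g c p))"
      using nz by (intro continuous_intros continuous_on_component continuous_on_metric
          continuous_on_chart_grad continuous_on_det_metric assms)
    then show ?thesis
      by (rule continuous_on_eq) (simp add: True grad_components(1)[OF assms(2)])
  next
    case False
    then have i: "i = 2" using exhaust_2 by blast
    have "continuous_on (chart_dom c) (\<lambda>p. (g c p $ 1 $ 1 * chart_grad c u p $ 2 - g c p $ 2 $ 1 * chart_grad c u p $ 1) / det (g c p))"
      using nz by (intro continuous_intros continuous_on_component continuous_on_metric
          continuous_on_chart_grad continuous_on_det_metric assms)
    then show ?thesis
      by (rule continuous_on_eq) (simp add: i grad_components(2)[OF assms(2)])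
  qed
  then have "continuous_on (chart_dom c) (\<lambda>p. \<chi> i. grad g u c p $ i)"
    by (intro continuous_on_vec_lambda)
  then show ?thesis by simp
qed

lemma continuous_on_matrix_vector:
  fixes M :: "'z::topological_space \<Rightarrow> real^'n^'m"
  assumes "continuous_on S M" "continuous_on S x"
  shows "continuous_on S (\<lambda>p. M p *v x p)"
  unfolding matrix_vector_mult_def
  by (intro continuous_on_vec_lambda continuous_intros continuous_on_component assms)

lemma continuous_metric_inner_grad:
  assumes "smooth_fun_on A UNIV u" "smooth_fun_on A UNIV v"
  shows "continuous_on UNIV (metric_inner A g (grad g u) (grad g v))"
proof (rule continuous_on_UNIV_charts)
  fix c assume c: "c \<in> A"
  have "continuous_on (chart_dom c) (\<lambda>p. grad g u c p \<bullet> (g c p *v grad g v c p))"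
    by (intro continuous_intros continuous_on_matrix_vector continuous_on_metric continuous_on_grad assms c)
  then show "continuous_on (chart_dom c) (metric_inner A g (grad g u) (grad g v))"
    by (rule continuous_on_eq)
       (simp add: metric_inner_chart[OF smooth_fun_transforms_at smooth_fun_transforms_at c] assms)
qed

section \<open>Measurability\<close>

text \<open>By Lindelof's theorem countably many charts cover the manifold.\<close>

lemma measurable_on_charts:
  fixes f :: "'a \<Rightarrow> 'b::real_normed_vector"
  assumes "\<And>c. c \<in> A \<Longrightarrow> set_borel_measurable borel (chart_dom c) f"
  shows "f \<in> borel_measurable borel"
proof -
  obtain D where D: "D \<subseteq> chart_dom ` A" "countable D" "\<Union>D = \<Union>(chart_dom ` A)"
    using Lindelof[of "chart_dom ` A"] open_chart_dom by blast
  have "\<Union>(chart_dom ` A) = UNIV" using atlas by (simp add: smooth_atlas_def)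
  then have cover: "space borel \<subseteq> \<Union>D" using D(3) by simp
  show ?thesis
  proof (rule measurable_piecewise_restrict[OF D(2) _ cover])
    fix S assume "S \<in> D"
    then obtain c where c: "c \<in> A" "S = chart_dom c" using D(1) by blast
    then show "S \<inter> space borel \<in> sets borel" using open_chart_dom by simp
    show "f \<in> borel_measurable (restrict_space borel S)"
      using assms[OF c(1)] c open_chart_dom[OF c(1)]
      by (subst borel_measurable_restrict_space_iff) (auto simp: set_borel_measurable_def)
  qed
qed

lemma measurable_field_component: "measurable_vector_field A X \<Longrightarrow> c \<in> A \<Longrightarrow> set_borel_measurable borel (chart_dom c) (X c)"
  unfolding measurable_vector_field_def by blast

lemma measurable_field_transforms_at: "measurable_vector_field A X \<Longrightarrow> transforms_at X p"
  unfolding measurable_vector_field_def transforms_at_def by blast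

lemma measurable_vector_fieldI:
  "(\<And>c. c \<in> A \<Longrightarrow> set_borel_measurable borel (chart_dom c) (X c)) \<Longrightarrow>
   (\<And>p. transforms_at X p) \<Longrightarrow> measurable_vector_field A X"
  unfolding measurable_vector_field_def transforms_at_def by blast

lemma measurable_field_grad:
  assumes "smooth_fun_on A UNIV u"
  shows "measurable_vector_field A (grad g u)"
  using assms
  by (intro measurable_vector_fieldI smooth_fun_transforms_at)
     (auto simp: set_borel_measurable_def
       intro!: borel_measurable_continuous_on_indicator continuous_on_grad open_chart_dom borel_open)

lemma measurable_field_lin_comb:
  assumes "measurable_vector_field A X" "measurable_vector_field A Y"
    and [measurable]: "a \<in> borel_measurable borel" "b \<in> borel_measurable borel"
  shows "measurable_vector_field A (lin_comb a X b Y)"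
proof (rule measurable_vector_fieldI)
  fix c assume c: "c \<in> A"
  have [measurable]: "(\<lambda>x. indicat_real (chart_dom c) x *\<^sub>R X c x) \<in> borel_measurable borel"
    "(\<lambda>x. indicat_real (chart_dom c) x *\<^sub>R Y c x) \<in> borel_measurable borel"
    using assms(1,2)[THEN measurable_field_component, OF c] by (auto simp: set_borel_measurable_def)
  have "(\<lambda>x. a x *\<^sub>R (indicat_real (chart_dom c) x *\<^sub>R X c x) + b x *\<^sub>R (indicat_real (chart_dom c) x *\<^sub>R Y c x))
      \<in> borel_measurable borel" by measurable
  moreover have "(\<lambda>x. indicat_real (chart_dom c) x *\<^sub>R lin_comb a X b Y c x) =
     (\<lambda>x. a x *\<^sub>R (indicat_real (chart_dom c) x *\<^sub>R X c x) + b x *\<^sub>R (indicat_real (chart_dom c) x *\<^sub>R Y c x))"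
    by (auto simp: lin_comb_def indicator_def)
  ultimately show "set_borel_measurable borel (chart_dom c) (lin_comb a X b Y c)"
    by (simp only: set_borel_measurable_def)
next
  fix p
  show "transforms_at (lin_comb a X b Y) p"
    unfolding transforms_at_def
  proof (intro ballI impI)
    fix c d assume "c \<in> A" "d \<in> A" "p \<in> chart_dom c" "p \<in> chart_dom d"
    then have "X d p = transition_jacobian c d p *v X c p" "Y d p = transition_jacobian c d p *v Y c p"
      using measurable_field_transforms_at[OF assms(1), of p] measurable_field_transforms_at[OF assms(2), of p]
      by (blast dest: transforms_atD)+
    then show "lin_comb a X b Y d p = transition_jacobian c d p *v lin_comb a X b Y c p"
      by (simp only: lin_comb_def matrix_vector_right_distrib matrix_vector_mult_scaleR)
  qed
qed

text \<open>The inner product is defined through an arbitrary choice of charts, but in each fixed chart it is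
given by the components there.\<close>

lemma measurable_metric_inner:
  assumes "measurable_vector_field A X" "measurable_vector_field A Y"
  shows "metric_inner A g X Y \<in> borel_measurable borel"
proof (rule measurable_on_charts)
  fix c assume c: "c \<in> A"
  have XY: "X c \<in> borel_measurable (restrict_space borel (chart_dom c))"
    "Y c \<in> borel_measurable (restrict_space borel (chart_dom c))"
    using assms[THEN measurable_field_component, OF c] open_chart_dom[OF c]
    by (auto simp: borel_measurable_restrict_space_iff set_borel_measurable_def)
  have G: "g c \<in> borel_measurable (restrict_space borel (chart_dom c))"
    by (rule borel_measurable_continuous_on_restrict[OF continuous_on_metric[OF c]])
  have comp: "(\<lambda>p. g c p $ i $ j) \<in> borel_measurable (restrict_space borel (chart_dom c))" for i j
    by (rule borel_measurable_continuous_on_restrict)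
       (intro continuous_on_component continuous_on_metric c)
  have nth: "(\<lambda>v::real^2. v $ i) \<in> borel_measurable borel" for i
    by (rule borel_measurable_continuous_onI) (intro continuous_intros continuous_on_component)
  have Xi: "(\<lambda>p. X c p $ i) \<in> borel_measurable (restrict_space borel (chart_dom c))"
    and Yi: "(\<lambda>p. Y c p $ i) \<in> borel_measurable (restrict_space borel (chart_dom c))" for i
    using measurable_compose[OF XY(1) nth] measurable_compose[OF XY(2) nth] by auto
  have "(\<lambda>p. \<Sum>i\<in>UNIV. X c p $ i * (\<Sum>j\<in>UNIV. g c p $ i $ j * Y c p $ j))
      \<in> borel_measurable (restrict_space borel (chart_dom c))"
    by (intro borel_measurable_sum borel_measurable_times Xi Yi comp)
  then have "(\<lambda>p. indicator (chart_dom c) p *\<^sub>R (\<Sum>i\<in>UNIV. X c p $ i * (\<Sum>j\<in>UNIV. g c p $ i $ j * Y c p $ j)))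
      \<in> borel_measurable borel"
    using open_chart_dom[OF c] by (simp add: borel_measurable_restrict_space_iff)
  moreover have "indicator (chart_dom c) p *\<^sub>R metric_inner A g X Y p =
      indicator (chart_dom c) p *\<^sub>R (\<Sum>i\<in>UNIV. X c p $ i * (\<Sum>j\<in>UNIV. g c p $ i $ j * Y c p $ j))" for p
    using metric_inner_chart[OF measurable_field_transforms_at[OF assms(1)] measurable_field_transforms_at[OF assms(2)] c, of p]
    by (cases "p \<in> chart_dom c") (simp_all add: inner_vec_def matrix_vector_mult_def)
  ultimately show "set_borel_measurable borel (chart_dom c) (metric_inner A g X Y)"
    by (simp only: set_borel_measurable_def)
qed

section \<open>The volume in a chart\<close>

lemma sets_vol [simp, measurable_cong]: "sets vol = sets borel"
  using volume by (simp add: riemannian_volume_def)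

lemma space_vol [simp]: "space vol = UNIV"
  using sets_eq_imp_space_eq[OF sets_vol] by simp

lemma emeasure_vol_chart:
  "c \<in> A \<Longrightarrow> B \<in> sets borel \<Longrightarrow> B \<subseteq> chart_dom c \<Longrightarrow>
    emeasure vol B = (\<integral>\<^sup>+x\<in>coords c ` B. ennreal (sqrt (det (g c (chart_inv c x)))) \<partial>lborel)"
  using volume unfolding riemannian_volume_def by blast

lemma chart_image_borel: "c \<in> A \<Longrightarrow> chart_image c \<in> sets borel"
proof -
  assume "c \<in> A"
  then obtain V where "open V" "chart_image c = half_plane \<inter> V"
    using openin_chart_image by (meson openin_open)
  moreover have "closed half_plane"
    unfolding half_plane_def by (intro closed_Collect_le continuous_intros continuous_on_component)
  ultimately show ?thesis by auto
qed

lemma continuous_on_density: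
  assumes "c \<in> A"
  shows "continuous_on (chart_image c) (\<lambda>x. sqrt (det (g c (chart_inv c x))))"
  by (rule continuous_on_compose2[OF _ continuous_on_chart_inv[OF assms], of "chart_dom c" "\<lambda>p. sqrt (det (g c p))"])
     (use assms in \<open>auto intro!: continuous_intros continuous_on_det_metric\<close>)

text \<open>The chart formula for the volume of sets says that \<open>vol\<close> is, on the chart domain, the image of the
measure with density \<open>sqrt (det g)\<close> on the plane.\<close>

lemma restrict_vol_chart:
  assumes "c \<in> A"
  shows "restrict_space vol (chart_dom c) =
    distr (density (restrict_space lborel (chart_image c)) (\<lambda>x. ennreal (sqrt (det (g c (chart_inv c x))))))
      (restrict_space borel (chart_dom c)) (chart_inv c)"
    and "chart_inv c \<in> measurable (restrict_space lborel (chart_image c)) (restrict_space borel (chart_dom c))"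
    and "(\<lambda>x. sqrt (det (g c (chart_inv c x)))) \<in> borel_measurable (restrict_space lborel (chart_image c))"
proof -
  let ?T = "chart_image c" and ?D = "chart_dom c"
  let ?R = "restrict_space lborel ?T"
  let ?rho = "\<lambda>x. sqrt (det (g c (chart_inv c x)))"
  have sR: "sets ?R = sets (restrict_space borel ?T)"
    by (rule sets_restrict_space_cong) simp
  have spR: "space ?R = ?T" by (simp add: space_restrict_space)
  have D: "?D \<in> sets borel" using open_chart_dom[OF assms] by simp
  have T: "?T \<in> sets borel" by (rule chart_image_borel[OF assms])
  have "chart_inv c \<in> borel_measurable (restrict_space borel ?T)"
    by (rule borel_measurable_continuous_on_restrict[OF continuous_on_chart_inv[OF assms]])
  then show ci: "chart_inv c \<in> measurable ?R (restrict_space borel ?D)"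
    using assms by (intro measurable_restrict_space2) (auto simp: measurable_cong_sets[OF sR refl] space_restrict_space)
  show rho: "?rho \<in> borel_measurable ?R"
    using borel_measurable_continuous_on_restrict[OF continuous_on_density[OF assms]]
    by (simp add: measurable_cong_sets[OF sR refl])
  have ci': "chart_inv c \<in> measurable (density ?R (\<lambda>x. ennreal (?rho x))) (restrict_space borel ?D)"
    using ci by simp
  show "restrict_space vol ?D =
    distr (density ?R (\<lambda>x. ennreal (?rho x))) (restrict_space borel ?D) (chart_inv c)"
  proof (rule measure_eqI)
    show "sets (restrict_space vol ?D) =
        sets (distr (density ?R (\<lambda>x. ennreal (?rho x))) (restrict_space borel ?D) (chart_inv c))"
      by (simp add: sets_restrict_space)
    fix B assume "B \<in> sets (restrict_space vol ?D)"
    then have B: "B \<in> sets borel" "B \<subseteq> ?D" and B': "B \<in> sets (restrict_space borel ?D)"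
      using D by (auto simp: sets_restrict_space_iff sets_restrict_space)
    have pre: "chart_inv c -` B \<inter> ?T = coords c ` B"
      using B(2) assms by (auto simp: image_iff)
    have preS: "coords c ` B \<in> sets ?R"
      using measurable_sets[OF ci B'] by (simp add: spR pre)
    have "emeasure (distr (density ?R (\<lambda>x. ennreal (?rho x))) (restrict_space borel ?D) (chart_inv c)) B
      = emeasure (density ?R (\<lambda>x. ennreal (?rho x))) (coords c ` B)"
      using emeasure_distr[OF ci' B'] by (simp add: spR pre)
    also have "\<dots> = (\<integral>\<^sup>+x\<in>coords c ` B. ennreal (?rho x) \<partial>?R)"
      using rho preS by (intro emeasure_density) auto
    also have "\<dots> = (\<integral>\<^sup>+x\<in>coords c ` B. ennreal (?rho x) \<partial>lborel)"
    proof (subst nn_integral_restrict_space)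
      have "coords c ` B \<subseteq> ?T" using B(2) by (rule image_mono)
      then show "(\<integral>\<^sup>+x. ennreal (?rho x) * indicator (coords c ` B) x * indicator ?T x \<partial>lborel) =
          (\<integral>\<^sup>+x\<in>coords c ` B. ennreal (?rho x) \<partial>lborel)"
        by (intro nn_integral_cong) (auto split: split_indicator)
    qed (use T in simp)
    also have "\<dots> = emeasure vol B" by (simp add: emeasure_vol_chart[OF assms B])
    also have "\<dots> = emeasure (restrict_space vol ?D) B"
      using D B by (subst emeasure_restrict_space) auto
    finally show "emeasure (restrict_space vol ?D) B =
        emeasure (distr (density ?R (\<lambda>x. ennreal (?rho x))) (restrict_space borel ?D) (chart_inv c)) B" by simp
  qed
qed

lemma integral_vol_chart:
  fixes h :: "'a \<Rightarrow> real"
  assumes "c \<in> A" "h \<in> borel_measurable borel" "\<And>p. p \<notin> chart_dom c \<Longrightarrow> h p = 0"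
  shows "integrable vol h \<longleftrightarrow>
      integrable lborel (\<lambda>x. indicator (chart_image c) x *\<^sub>R (sqrt (det (g c (chart_inv c x))) * h (chart_inv c x)))"
    and "integral\<^sup>L vol h =
      integral\<^sup>L lborel (\<lambda>x. indicator (chart_image c) x *\<^sub>R (sqrt (det (g c (chart_inv c x))) * h (chart_inv c x)))"
proof -
  let ?T = "chart_image c" and ?D = "chart_dom c"
  let ?R = "restrict_space lborel ?T"
  let ?rho = "\<lambda>x. sqrt (det (g c (chart_inv c x)))"
  let ?N = "density ?R (\<lambda>x. ennreal (?rho x))"
  note r = restrict_vol_chart[OF assms(1)]
  have D: "?D \<inter> space vol \<in> sets vol" using open_chart_dom[OF assms(1)] by simp
  have T: "?T \<inter> space lborel \<in> sets lborel" using chart_image_borel[OF assms(1)] by simp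
  have hD: "h \<in> borel_measurable (restrict_space borel ?D)"
    by (rule measurable_restrict_space1[OF assms(2)])
  have hR: "(\<lambda>x. h (chart_inv c x)) \<in> borel_measurable ?R"
    by (rule measurable_compose[OF r(2) hD])
  have ci': "chart_inv c \<in> measurable ?N (restrict_space borel ?D)" using r(2) by simp
  have nn: "AE x in ?R. 0 \<le> ?rho x"
    using metric_det_pos assms(1) by (intro AE_I2) (auto simp: space_restrict_space less_imp_le)
  have h: "(\<lambda>p. indicator ?D p *\<^sub>R h p) = h" using assms(3) by (auto simp: indicator_def fun_eq_iff)
  have "integrable vol h \<longleftrightarrow> integrable (restrict_space vol ?D) h"
    by (subst integrable_restrict_space[OF D]) (simp only: h)
  also have "\<dots> \<longleftrightarrow> integrable ?N (\<lambda>x. h (chart_inv c x))"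
    unfolding r(1) by (rule integrable_distr_eq[OF ci' hD])
  also have "\<dots> \<longleftrightarrow> integrable ?R (\<lambda>x. ?rho x *\<^sub>R h (chart_inv c x))"
    by (rule integrable_density[OF hR r(3) nn])
  also have "\<dots> \<longleftrightarrow> integrable lborel (\<lambda>x. indicator ?T x *\<^sub>R (?rho x * h (chart_inv c x)))"
    by (subst integrable_restrict_space[OF T]) simp
  finally show "integrable vol h \<longleftrightarrow> integrable lborel (\<lambda>x. indicator ?T x *\<^sub>R (?rho x * h (chart_inv c x)))" .
  have "integral\<^sup>L vol h = integral\<^sup>L (restrict_space vol ?D) h"
    by (subst integral_restrict_space[OF D]) (simp only: h)
  also have "\<dots> = integral\<^sup>L ?N (\<lambda>x. h (chart_inv c x))"
    unfolding r(1) by (rule integral_distr[OF ci' hD])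
  also have "\<dots> = integral\<^sup>L ?R (\<lambda>x. ?rho x *\<^sub>R h (chart_inv c x))"
    by (rule integral_density[OF hR r(3) nn])
  also have "\<dots> = integral\<^sup>L lborel (\<lambda>x. indicator ?T x *\<^sub>R (?rho x * h (chart_inv c x)))"
    by (subst integral_restrict_space[OF T]) simp
  finally show "integral\<^sup>L vol h = integral\<^sup>L lborel (\<lambda>x. indicator ?T x *\<^sub>R (?rho x * h (chart_inv c x)))" .
qed

section \<open>Interior points of charts\<close>

lemma open_chart_interior: "c \<in> A \<Longrightarrow> open (chart_interior c)"
proof -
  assume "c \<in> A"
  then obtain V where V: "open V" "chart_image c = half_plane \<inter> V"
    using openin_chart_image by (meson openin_open)
  then have "chart_interior c = {x. 0 < x $ 1} \<inter> V"
    by (auto simp: chart_interior_def half_plane_def)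
  then show ?thesis
    using V(1) by (auto intro!: open_Int open_Collect_less continuous_intros continuous_on_component)
qed

lemma chart_interior_subset: "chart_interior c \<subseteq> chart_image c"
  by (auto simp: chart_interior_def)

lemma chart_interior_image: "x \<in> chart_interior c \<Longrightarrow> x \<in> chart_image c"
  by (simp add: chart_interior_def)

lemma chart_inv_interior: "c \<in> A \<Longrightarrow> x \<in> chart_interior c \<Longrightarrow> chart_inv c x \<in> interior_dom c"
  by (auto simp: chart_interior_def interior_dom_def)

lemma coords_interior: "p \<in> interior_dom c \<Longrightarrow> coords c p \<in> chart_interior c"
  by (auto simp: chart_interior_def interior_dom_def)

lemma interior_dom_dom: "p \<in> interior_dom c \<Longrightarrow> p \<in> chart_dom c"
  by (simp add: interior_dom_def)

lemma interior_dom_subset: "interior_dom c \<subseteq> chart_dom c"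
  by (auto simp: interior_dom_def)

lemma open_interior_dom: "c \<in> A \<Longrightarrow> open (interior_dom c)"
proof -
  assume c: "c \<in> A"
  have "open (chart_dom c \<inter> coords c -` {x. 0 < x $ 1})"
    by (rule continuous_open_preimage[OF continuous_on_coords[OF c] open_chart_dom[OF c]])
       (intro open_Collect_less continuous_intros continuous_on_component)
  moreover have "interior_dom c = chart_dom c \<inter> coords c -` {x. 0 < x $ 1}"
    by (auto simp: interior_dom_def)
  ultimately show ?thesis by simp
qed

lemma at_within_chart_interior:
  "c \<in> A \<Longrightarrow> x \<in> chart_interior c \<Longrightarrow> at x within chart_image c = at x"
  using open_chart_interior chart_interior_subset by (metis at_within_open_subset)

lemma not_boundary_interior_dom:
  "c \<in> A \<Longrightarrow> p \<in> chart_dom c \<Longrightarrow> p \<notin> manifold_boundary A \<Longrightarrow> p \<in> interior_dom c"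
  using coords_nonneg[of c p] by (auto simp: manifold_boundary_def interior_dom_def)

lemma open_coords_image:
  assumes "c \<in> A" "open V" "V \<subseteq> interior_dom c"
  shows "open (coords c ` V)"
proof -
  obtain W where W: "open W" "coords c ` (chart_dom c \<inter> V) = chart_image c \<inter> W"
    using openin_overlap[OF assms(1,2)] .
  have "chart_dom c \<inter> V = V" using assms(3) by (auto intro: interior_dom_dom)
  moreover have "coords c ` V \<subseteq> chart_interior c" using assms(3) by (auto intro: coords_interior)
  ultimately have "coords c ` V = chart_interior c \<inter> W"
    using W(2) chart_interior_subset[of c] by auto
  then show ?thesis using W(1) open_chart_interior[OF assms(1)] by auto
qed

lemma continuous_on_interior_domI:
  assumes "c \<in> A" "continuous_on (chart_interior c) f"
  shows "continuous_on (interior_dom c) (\<lambda>p. f (coords c p))"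
proof (rule continuous_on_compose2[OF assms(2)])
  show "continuous_on (interior_dom c) (coords c)"
    by (rule continuous_on_subset[OF continuous_on_coords[OF assms(1)]]) (auto intro: interior_dom_dom)
  show "coords c ` interior_dom c \<subseteq> chart_interior c" by (auto intro: coords_interior)
qed

definition C1_in :: "'a chart \<Rightarrow> ('a \<Rightarrow> real) \<Rightarrow> bool" where
  "C1_in c u \<longleftrightarrow> Ck_on 1 (chart_interior c) (u \<circ> chart_inv c)"

text \<open>The class of functions that Green's formula is proved for: it contains the smooth functions and the
cutoffs, and is closed under products.\<close>

definition C1_fun :: "('a \<Rightarrow> real) \<Rightarrow> bool" where
  "C1_fun u \<longleftrightarrow> (\<forall>c\<in>A. C1_in c u)"

lemma smooth_imp_C1_fun: "smooth_fun_on A UNIV u \<Longrightarrow> C1_fun u"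
  unfolding C1_fun_def C1_in_def
  using smooth_on_imp_Ck_on[OF smooth_fun_chart open_chart_interior chart_interior_subset] by blast

lemma C1_fun_mult: "C1_fun u \<Longrightarrow> C1_fun v \<Longrightarrow> C1_fun (\<lambda>p. u p * v p)"
  unfolding C1_fun_def C1_in_def
  using Ck_on_mult[OF open_chart_interior, of _ 1 "u \<circ> chart_inv _" "v \<circ> chart_inv _"]
  by (simp add: o_def)

lemma C1_fun_one_minus:
  assumes "C1_fun u" shows "C1_fun (\<lambda>p. 1 - u p)"
  unfolding C1_fun_def C1_in_def
proof
  fix c assume c: "c \<in> A"
  note N = open_chart_interior[OF c]
  have u: "Ck_on 1 (chart_interior c) (u \<circ> chart_inv c)"
    using assms c by (simp add: C1_fun_def C1_in_def)
  have "Ck_on 1 (chart_interior c) (\<lambda>x. 1 + (-1) * (u \<circ> chart_inv c) x)"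
    by (rule Ck_on_add[OF N Ck_on_const Ck_on_mult[OF N Ck_on_const u]])
  then show "Ck_on 1 (chart_interior c) ((\<lambda>p. 1 - u p) \<circ> chart_inv c)"
    by (simp add: o_def)
qed

lemma C1_in_grad:
  assumes "c \<in> A" "p \<in> interior_dom c" "C1_in c v"
  shows "chart_differentiable c v p"
    and "chart_grad c v p $ i = frechet_derivative (v \<circ> chart_inv c) (at (coords c p)) (axis i 1)"
proof -
  have "Ck_on (Suc 0) (chart_interior c) (v \<circ> chart_inv c)" using assms(3) by (simp add: C1_in_def)
  from Ck_on_has_derivative[OF this open_chart_interior[OF assms(1)] coords_interior[OF assms(2)]]
  have D: "((v \<circ> chart_inv c) has_derivative frechet_derivative (v \<circ> chart_inv c) (at (coords c p)))
      (at (coords c p) within chart_image c)"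
    by (simp add: at_within_chart_interior[OF assms(1) coords_interior[OF assms(2)]])
  then show "chart_differentiable c v p"
    by (auto simp: chart_differentiable_def differentiable_def)
  show "chart_grad c v p $ i = frechet_derivative (v \<circ> chart_inv c) (at (coords c p)) (axis i 1)"
    using partial_deriv_eq[OF assms(1) interior_dom_dom[OF assms(2)] D] by (simp add: chart_grad_def)
qed

lemma C1_in_transforms_at:
  assumes "c \<in> A" "p \<in> interior_dom c" "C1_in c v"
  shows "transforms_at (grad g v) p"
  using C1_in_grad(1)[OF assms] chart_grad_transform(1)[OF _ assms(1) _ interior_dom_dom[OF assms(2)]]
  by (intro grad_transforms_at) blast

lemma C1_in_continuous:
  assumes "c \<in> A" "C1_in c v"
  shows "continuous_on (interior_dom c) v" "continuous_on (interior_dom c) (chart_grad c v)"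
proof -
  have Ck: "Ck_on 1 (chart_interior c) (v \<circ> chart_inv c)" using assms(2) by (simp add: C1_in_def)
  have "continuous_on (interior_dom c) (\<lambda>p. (v \<circ> chart_inv c) (coords c p))"
    by (rule continuous_on_interior_domI[OF assms(1) Ck_on_imp_continuous_on[OF Ck]])
  then show "continuous_on (interior_dom c) v"
    by (rule continuous_on_eq) (simp add: assms(1) interior_dom_dom)
  have "continuous_on (interior_dom c) (\<lambda>p. chart_grad c v p $ i)" for i
  proof -
    have "continuous_on (chart_interior c) (\<lambda>x. frechet_derivative (v \<circ> chart_inv c) (at x) (axis i 1))"
      using Ck by simp
    from continuous_on_interior_domI[OF assms(1) this] show ?thesis
      by (rule continuous_on_eq) (simp add: C1_in_grad(2)[OF assms(1) _ assms(2)])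
  qed
  then have "continuous_on (interior_dom c) (\<lambda>p. \<chi> i. chart_grad c v p $ i)"
    by (intro continuous_on_vec_lambda)
  then show "continuous_on (interior_dom c) (chart_grad c v)" by simp
qed

section \<open>Cutoff functions in charts\<close>

text \<open>Equal to \<open>1\<close> on the coordinate ball \<open>chart_ball c y r\<close>, and supported in the coordinate ball of
radius \<open>2 * r\<close>.\<close>

definition chart_bump :: "'a chart \<Rightarrow> real^2 \<Rightarrow> real \<Rightarrow> 'a \<Rightarrow> real" where
  "chart_bump c y r p = (if p \<in> chart_dom c then cutoff ((norm (coords c p - y))\<^sup>2 / r\<^sup>2) else 0)"

definition chart_ball :: "'a chart \<Rightarrow> real^2 \<Rightarrow> real \<Rightarrow> 'a set" where
  "chart_ball c y r = {p \<in> chart_dom c. coords c p \<in> ball y r}"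

definition valid_ball :: "'a chart \<Rightarrow> real^2 \<Rightarrow> real \<Rightarrow> bool" where
  "valid_ball c y r \<longleftrightarrow> c \<in> A \<and> 0 < r \<and> cball y (2 * r) \<subseteq> chart_interior c"

lemma chart_bump_nonneg: "0 \<le> chart_bump c y r p"
  by (simp add: chart_bump_def cutoff_nonneg)

lemma open_chart_ball: "c \<in> A \<Longrightarrow> open (chart_ball c y r)"
proof -
  assume c: "c \<in> A"
  have "chart_ball c y r = chart_dom c \<inter> coords c -` ball y r" by (auto simp: chart_ball_def)
  then show ?thesis
    using continuous_open_preimage[OF continuous_on_coords[OF c] open_chart_dom[OF c] open_ball] by simp
qed

lemma chart_bump_eq_1: "p \<in> chart_ball c y r \<Longrightarrow> chart_bump c y r p = 1"
proof -
  assume p: "p \<in> chart_ball c y r"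
  then have d: "norm (coords c p - y) < r" by (simp add: chart_ball_def dist_norm norm_minus_commute)
  then have "0 < r" using norm_ge_zero le_less_trans by blast
  with d have "(norm (coords c p - y))\<^sup>2 / r\<^sup>2 \<le> 1"
    by (simp add: power_mono)
  then show ?thesis using p by (simp add: chart_bump_def chart_ball_def cutoff_eq_1)
qed

lemma chart_bump_eq_0:
  assumes "valid_ball c y r" "p \<notin> chart_inv c ` cball y (2 * r)"
  shows "chart_bump c y r p = 0"
proof (cases "p \<in> chart_dom c")
  case True
  have r: "0 < r" "c \<in> A" using assms(1) by (auto simp: valid_ball_def)
  have "coords c p \<notin> cball y (2 * r)"
    using assms(2) True r(2) by (metis chart_inv_coords imageI)
  then have "2 * r < norm (coords c p - y)" by (simp add: dist_norm norm_minus_commute)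
  then have "(2 * r)\<^sup>2 \<le> (norm (coords c p - y))\<^sup>2" using r(1) by (intro power_mono) auto
  then have "4 * r\<^sup>2 \<le> (norm (coords c p - y))\<^sup>2" by (simp add: power_mult_distrib)
  then have "2 * r\<^sup>2 \<le> (norm (coords c p - y))\<^sup>2" using zero_le_power2[of r] by linarith
  then have "2 \<le> (norm (coords c p - y))\<^sup>2 / r\<^sup>2" using r(1) by (simp add: field_simps)
  then show ?thesis by (simp add: chart_bump_def cutoff_eq_0)
qed (simp add: chart_bump_def)

lemma compact_chart_inv_image:
  assumes "c \<in> A" "compact C" "C \<subseteq> chart_interior c"
  shows "compact (chart_inv c ` C)" "chart_inv c ` C \<subseteq> interior_dom c"
    "coords c ` chart_inv c ` C = C"
proof -
  have sub: "C \<subseteq> chart_image c" using assms(3) chart_interior_subset by blast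
  then show "compact (chart_inv c ` C)"
    using assms(2) continuous_on_chart_inv[OF assms(1)]
    by (metis compact_continuous_image continuous_on_subset)
  show "chart_inv c ` C \<subseteq> interior_dom c" using assms(1,3) chart_inv_interior by blast
  have "coords c (chart_inv c x) = x" if "x \<in> C" for x using assms(1) sub that by auto
  then show "coords c ` chart_inv c ` C = C" by (simp add: image_image)
qed

text \<open>In another chart the cutoff is a \<open>C\<^sup>1\<close> function of the smooth transition map on the overlap, and
vanishes off the compact image of the ball; these two open sets cover the chart.\<close>

lemma C1_fun_chart_bump:
  assumes "valid_ball c y r"
  shows "C1_fun (chart_bump c y r)"
  unfolding C1_fun_def C1_in_def
proof
  fix d assume d: "d \<in> A"
  have r: "0 < r" "c \<in> A" "cball y (2 * r) \<subseteq> chart_interior c" using assms by (auto simp: valid_ball_def)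
  let ?K = "chart_inv c ` cball y (2 * r)"
  have K: "closed ?K"
    using compact_chart_inv_image(1)[OF r(2) _ r(3)] by (simp add: compact_imp_closed)
  show "Ck_on 1 (chart_interior d) (chart_bump c y r \<circ> chart_inv d)"
  proof (rule Ck_on_local)
    fix x assume x: "x \<in> chart_interior d"
    have p: "chart_inv d x \<in> chart_dom d" "coords d (chart_inv d x) = x"
      using d chart_interior_image[OF x] by auto
    show "\<exists>M. open M \<and> x \<in> M \<and> Ck_on 1 M (chart_bump c y r \<circ> chart_inv d)"
    proof (cases "chart_inv d x \<in> chart_dom c")
      case True
      let ?M = "coords d ` (interior_dom d \<inter> chart_dom c)"
      let ?t = "coords c \<circ> chart_inv d"
      have M: "open ?M"
        using d r(2) by (intro open_coords_image open_Int open_interior_dom open_chart_dom) auto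
      have "?M \<subseteq> coords d ` (chart_dom d \<inter> chart_dom c)"
        using interior_dom_subset[of d] by auto
      then have "Ck_on 1 ?M ?t"
        by (rule smooth_on_imp_Ck_on[OF smooth_transition[OF d r(2)] M])
      then have "Ck_on 1 ?M (\<lambda>z. (?t z $ i + - y $ i) * (?t z $ i + - y $ i))" for i
        by (intro Ck_on_mult Ck_on_add Ck_on_component Ck_on_const M)
      then have "Ck_on 1 ?M (\<lambda>z. (\<Sum>i\<in>UNIV. (?t z $ i + - y $ i) * (?t z $ i + - y $ i)) * (1 / r\<^sup>2))"
        by (rule Ck_on_mult[OF M Ck_on_sum[OF M] Ck_on_const])
      then have "Ck_on 1 ?M (\<lambda>z. cutoff ((\<Sum>i\<in>UNIV. (?t z $ i + - y $ i) * (?t z $ i + - y $ i)) * (1 / r\<^sup>2)))"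
        by (rule Ck_on_1_compose[OF M]) (auto intro: cutoff_deriv continuous_cutoff')
      then have "Ck_on 1 ?M (chart_bump c y r \<circ> chart_inv d)"
        by (rule Ck_on_cong[OF M, rotated])
           (use d interior_dom_subset[of d] in \<open>auto simp: chart_bump_def power2_norm_eq_inner inner_vec_def\<close>)
      moreover have "x \<in> ?M"
        using True p chart_inv_interior[OF d x] by (metis IntI imageI)
      ultimately show ?thesis using M by blast
    next
      case False
      let ?M = "coords d ` (interior_dom d \<inter> - ?K)"
      have M: "open ?M"
        using d K by (intro open_coords_image open_Int open_interior_dom) auto
      have "Ck_on 1 ?M (chart_bump c y r \<circ> chart_inv d)"
        by (rule Ck_on_cong[OF M _ Ck_on_const[of 1 ?M 0]])
           (use d interior_dom_subset[of d] chart_bump_eq_0[OF assms] in auto)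
      moreover have "chart_inv d x \<notin> ?K"
        using False compact_chart_inv_image(2)[OF r(2) compact_cball r(3)] interior_dom_subset[of c] by blast
      then have "x \<in> ?M" using p chart_inv_interior[OF d x] by (metis IntI ComplI imageI)
      ultimately show ?thesis using M by blast
    qed
  qed
qed

section \<open>The divergence theorem in a chart\<close>

text \<open>The Euclidean vector field whose divergence, divided by \<open>sqrt (det g)\<close>, is the Laplacian.\<close>

definition flux :: "'a chart \<Rightarrow> ('a \<Rightarrow> real) \<Rightarrow> 2 \<Rightarrow> 'a \<Rightarrow> real" where
  "flux c u i q = sqrt (det (g c q)) * grad g u c q $ i"

definition chart_laplace :: "'a chart \<Rightarrow> ('a \<Rightarrow> real) \<Rightarrow> 'a \<Rightarrow> real" where
  "chart_laplace c u p = (\<Sum>i\<in>UNIV. partial_deriv c i (flux c u i) p) / sqrt (det (g c p))"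

lemma laplace_beltrami_eq: "laplace_beltrami A g u p = chart_laplace (chart_at A p) u p"
  by (simp add: laplace_beltrami_def divergence_def chart_laplace_def flux_def[abs_def] Let_def)

lemma flux_components:
  assumes "c \<in> A" "p \<in> chart_dom c"
  shows "flux c u 1 p = (g c p $ 2 $ 2 * chart_grad c u p $ 1 - g c p $ 1 $ 2 * chart_grad c u p $ 2)
      * inverse (sqrt (det (g c p)))"
    and "flux c u 2 p = (g c p $ 1 $ 1 * chart_grad c u p $ 2 - g c p $ 2 $ 1 * chart_grad c u p $ 1)
      * inverse (sqrt (det (g c p)))"
proof -
  have "sqrt (det (g c p)) * (t / det (g c p)) = t * inverse (sqrt (det (g c p)))" for t
    using sqrt_divide_self_eq[of "det (g c p)"] metric_det_pos[OF assms]
    by (simp add: divide_inverse mult.commute mult.left_commute)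
  then show "flux c u 1 p = (g c p $ 2 $ 2 * chart_grad c u p $ 1 - g c p $ 1 $ 2 * chart_grad c u p $ 2)
      * inverse (sqrt (det (g c p)))"
    and "flux c u 2 p = (g c p $ 1 $ 1 * chart_grad c u p $ 2 - g c p $ 2 $ 1 * chart_grad c u p $ 1)
      * inverse (sqrt (det (g c p)))"
    by (simp_all only: flux_def grad_components[OF assms])
qed

lemma C1_in_flux:
  assumes "smooth_fun_on A UNIV u" "c \<in> A"
  shows "C1_in c (flux c u i)"
  unfolding C1_in_def
proof -
  let ?N = "chart_interior c"
  note N = open_chart_interior[OF assms(2)]
  have G: "Ck_on 1 ?N (\<lambda>x. g c (chart_inv c x) $ i $ j)" for i j
    using smooth_on_imp_Ck_on[OF metric_smooth[OF assms(2)] N chart_interior_subset, of 1]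
    by (intro Ck_on_component N) (simp add: o_def)
  have D: "Ck_on 1 ?N (\<lambda>x. det (g c (chart_inv c x)))"
  proof -
    have "Ck_on 1 ?N (\<lambda>x. g c (chart_inv c x) $ 1 $ 1 * g c (chart_inv c x) $ 2 $ 2
        + (-1) * (g c (chart_inv c x) $ 1 $ 2 * g c (chart_inv c x) $ 2 $ 1))"
      by (intro Ck_on_add Ck_on_mult Ck_on_const G N)
    then show ?thesis by (simp add: det_2)
  qed
  have pos: "0 < det (g c (chart_inv c x))" if "x \<in> ?N" for x
    using metric_det_pos[OF assms(2)] chart_inv_interior[OF assms(2) that] interior_dom_subset[of c] by blast
  have S: "Ck_on 1 ?N (\<lambda>x. inverse (sqrt (det (g c (chart_inv c x)))))"
  proof (rule Ck_on_1_compose[OF N D, where h = "\<lambda>t. inverse (sqrt t)"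
        and h' = "\<lambda>t. - (inverse (sqrt t) / 2 * inverse ((sqrt t) ^ Suc (Suc 0)))"])
    fix x assume "x \<in> ?N"
    then show "((\<lambda>t. inverse (sqrt t)) has_real_derivative
        - (inverse (sqrt (det (g c (chart_inv c x)))) / 2 *
           inverse (sqrt (det (g c (chart_inv c x))) ^ Suc (Suc 0)))) (at (det (g c (chart_inv c x))))"
      using pos[of x] by (intro DERIV_inverse_fun DERIV_real_sqrt) auto
  next
    show "continuous_on ((\<lambda>x. det (g c (chart_inv c x))) ` ?N)
        (\<lambda>t. - (inverse (sqrt t) / 2 * inverse ((sqrt t) ^ Suc (Suc 0))))"
      using pos by (intro continuous_intros) force+
  qed
  have P: "Ck_on 1 ?N (\<lambda>x. chart_grad c u (chart_inv c x) $ i)" for i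
  proof -
    have "Ck_on (Suc 1) ?N (u \<circ> chart_inv c)"
      by (rule smooth_on_imp_Ck_on[OF smooth_fun_chart[OF assms] N chart_interior_subset])
    then have "Ck_on 1 ?N (\<lambda>x. frechet_derivative (u \<circ> chart_inv c) (at x) (axis i 1))" by simp
    then show ?thesis
      by (rule Ck_on_cong[OF N, rotated])
         (simp add: chart_grad_def partial_deriv_def assms chart_interior_image at_within_chart_interior)
  qed
  have dom: "chart_inv c x \<in> chart_dom c" if "x \<in> ?N" for x
    by (rule interior_dom_dom[OF chart_inv_interior[OF assms(2) that]])
  show "Ck_on 1 ?N (flux c u i \<circ> chart_inv c)"
  proof (cases "i = 1")
    case True
    have "Ck_on 1 ?N (\<lambda>x. (g c (chart_inv c x) $ 2 $ 2 * chart_grad c u (chart_inv c x) $ 1 +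
        (-1) * (g c (chart_inv c x) $ 1 $ 2 * chart_grad c u (chart_inv c x) $ 2)) * inverse (sqrt (det (g c (chart_inv c x)))))"
      by (intro Ck_on_add Ck_on_mult Ck_on_const G P S N)
    then show ?thesis
      by (rule Ck_on_cong[OF N, rotated]) (simp add: True flux_components(1)[OF assms(2) dom])
  next
    case False
    then have i: "i = 2" using exhaust_2 by blast
    have "Ck_on 1 ?N (\<lambda>x. (g c (chart_inv c x) $ 1 $ 1 * chart_grad c u (chart_inv c x) $ 2 +
        (-1) * (g c (chart_inv c x) $ 2 $ 1 * chart_grad c u (chart_inv c x) $ 1)) * inverse (sqrt (det (g c (chart_inv c x)))))"
      by (intro Ck_on_add Ck_on_mult Ck_on_const G P S N)
    then show ?thesis
      by (rule Ck_on_cong[OF N, rotated]) (simp add: i flux_components(2)[OF assms(2) dom])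
  qed
qed

lemma chart_laplace_eq:
  "chart_laplace c u p = (\<Sum>i\<in>UNIV. chart_grad c (flux c u i) p $ i) / sqrt (det (g c p))"
  by (simp add: chart_laplace_def chart_grad_def)

lemma continuous_on_chart_laplace:
  assumes "smooth_fun_on A UNIV u" "c \<in> A"
  shows "continuous_on (interior_dom c) (chart_laplace c u)"
proof -
  have sub: "interior_dom c \<subseteq> chart_dom c" by (auto intro: interior_dom_dom)
  have "continuous_on (interior_dom c) (\<lambda>p. (\<Sum>i\<in>UNIV. chart_grad c (flux c u i) p $ i) / sqrt (det (g c p)))"
    using metric_det_pos[OF assms(2)] sub
    by (intro continuous_intros continuous_on_component C1_in_continuous(2) C1_in_flux assms
        continuous_on_subset[OF continuous_on_det_metric[OF assms(2)] sub]) force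
  then show ?thesis by (simp add: chart_laplace_eq[abs_def])
qed

text \<open>Times the density \<open>sqrt (det g)\<close>, the integrand \<open>v \<Delta>\<phi> + \<langle>\<nabla>v, \<nabla>\<phi>\<rangle>\<close> is the Euclidean
divergence of \<open>v\<close> times the flux of \<open>\<phi>\<close>, extended by zero to the plane.\<close>

lemma chart_divergence_theorem:
  assumes phi: "smooth_fun_on A UNIV \<phi>" and c: "c \<in> A" and v: "C1_in c v"
    and C: "compact C" "C \<subseteq> chart_interior c"
    and supp: "\<And>p. p \<notin> chart_inv c ` C \<Longrightarrow> v p = 0"
  defines "G \<equiv> \<lambda>p. if p \<in> chart_inv c ` C
      then v p * chart_laplace c \<phi> p + chart_grad c v p \<bullet> grad g \<phi> c p else 0"
  shows "integrable vol G" "integral\<^sup>L vol G = 0"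
proof -
  let ?N = "chart_interior c" and ?K = "chart_inv c ` C" and ?ci = "chart_inv c"
  note N = open_chart_interior[OF c]
  note K = compact_chart_inv_image[OF c C]
  have cl: "closed ?K" using K(1) by (rule compact_imp_closed)
  have Kdom: "?K \<subseteq> chart_dom c" using K(2) interior_dom_subset[of c] by blast
  have Gint: "G p = v p * chart_laplace c \<phi> p + chart_grad c v p \<bullet> grad g \<phi> c p" if "p \<in> interior_dom c" for p
  proof (cases "p \<in> ?K")
    case False
    then have "chart_grad c v p = 0"
      using chart_grad_locally_const(2)[OF c interior_dom_dom[OF that], of "- ?K" v 0] cl supp by auto
    then show ?thesis using False supp by (simp add: G_def)
  qed (simp add: G_def)
  have "continuous_on (interior_dom c) (\<lambda>p. v p * chart_laplace c \<phi> p + chart_grad c v p \<bullet> grad g \<phi> c p)"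
    using interior_dom_subset[of c]
    by (intro continuous_intros C1_in_continuous[OF c v] continuous_on_chart_laplace phi c
        continuous_on_subset[OF continuous_on_grad[OF phi c]]) blast
  then have "continuous_on (interior_dom c) G"
    by (rule continuous_on_eq) (simp add: Gint)
  moreover have "continuous_on (- ?K) G"
    by (rule continuous_on_eq[OF continuous_on_const[of _ 0]]) (simp add: G_def)
  ultimately have "continuous_on (interior_dom c \<union> - ?K) G"
    using open_interior_dom[OF c] cl by (intro continuous_on_open_Un) auto
  moreover have "interior_dom c \<union> - ?K = UNIV" using K(2) by blast
  ultimately have Gm: "G \<in> borel_measurable borel" by (intro borel_measurable_continuous_onI) simp
  have G0: "G p = 0" if "p \<notin> chart_dom c" for p
    using that Kdom by (auto simp: G_def)
  define F where "F i x = (if x \<in> ?N then v (?ci x) * flux c \<phi> i (?ci x) else 0)" for i x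
  have F0: "F i x = 0" if "x \<notin> C" for i x
  proof (cases "x \<in> ?N")
    case True
    then have "?ci x \<notin> ?K"
      using that K(3) c chart_interior_image[OF True] by (metis coords_chart_inv imageI)
    then show ?thesis using supp by (simp add: F_def)
  qed (simp add: F_def)
  have flux: "C1_in c (flux c \<phi> i)" for i by (rule C1_in_flux[OF phi c])
  have vC: "Ck_on 1 ?N (v \<circ> ?ci)" and fC: "Ck_on 1 ?N (flux c \<phi> i \<circ> ?ci)" for i
    using v flux[of i] by (simp_all only: C1_in_def)
  have FC1: "Ck_on 1 UNIV (F i)" for i
  proof (rule Ck_on_local)
    fix x
    show "\<exists>M. open M \<and> x \<in> M \<and> Ck_on 1 M (F i)"
    proof (cases "x \<in> ?N")
      case True
      have "Ck_on 1 ?N (\<lambda>x. (v \<circ> ?ci) x * (flux c \<phi> i \<circ> ?ci) x)"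
        by (rule Ck_on_mult[OF N vC fC])
      then have "Ck_on 1 ?N (F i)"
        by (rule Ck_on_cong[OF N, rotated]) (simp add: F_def)
      then show ?thesis using True N by blast
    next
      case False
      then have "x \<in> - C" using C(2) by blast
      moreover have "open (- C)" using compact_imp_closed[OF C(1)] by (rule open_Compl)
      moreover have "Ck_on 1 (- C) (F i)"
        by (rule Ck_on_cong[OF _ _ Ck_on_const[of 1 _ 0]]) (use F0 \<open>open (- C)\<close> in auto)
      ultimately show ?thesis by blast
    qed
  qed
  have div: "integrable lborel (\<lambda>x. frechet_derivative (F i) (at x) h)"
    "integral\<^sup>L lborel (\<lambda>x. frechet_derivative (F i) (at x) h) = 0" for i h
    by (rule integral_derivative_compact_support[OF FC1 C(1) F0], assumption)+
  have eq: "indicator (chart_image c) x *\<^sub>R (sqrt (det (g c (?ci x))) * G (?ci x)) =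
      (\<Sum>i\<in>UNIV. frechet_derivative (F i) (at x) (axis i 1))" for x
  proof (cases "x \<in> C")
    case True
    then have x: "x \<in> ?N" using C(2) by blast
    then have p: "?ci x \<in> interior_dom c" "coords c (?ci x) = x"
      using c chart_interior_image[OF x] chart_inv_interior[OF c x] by auto
    note pd = interior_dom_dom[OF p(1)]
    have pos: "0 < sqrt (det (g c (?ci x)))" using metric_det_pos[OF c pd] by simp
    have dF: "frechet_derivative (F i) (at x) (axis i 1) =
        v (?ci x) * chart_grad c (flux c \<phi> i) (?ci x) $ i + chart_grad c v (?ci x) $ i * flux c \<phi> i (?ci x)" for i
    proof -
      have "((\<lambda>x. (v \<circ> ?ci) x * (flux c \<phi> i \<circ> ?ci) x) has_derivative
          (\<lambda>h. (v \<circ> ?ci) x * frechet_derivative (flux c \<phi> i \<circ> ?ci) (at x) h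
            + frechet_derivative (v \<circ> ?ci) (at x) h * (flux c \<phi> i \<circ> ?ci) x)) (at x)"
        using vC fC[of i]
        by (intro has_derivative_mult Ck_on_has_derivative[OF _ N x, of 0]) (simp_all only: One_nat_def)
      then have "(F i has_derivative
          (\<lambda>h. (v \<circ> ?ci) x * frechet_derivative (flux c \<phi> i \<circ> ?ci) (at x) h
            + frechet_derivative (v \<circ> ?ci) (at x) h * (flux c \<phi> i \<circ> ?ci) x)) (at x)"
        by (rule has_derivative_transform_within_open[OF _ N x]) (simp add: F_def)
      from frechet_derivative_eqI[OF this] show ?thesis
        by (simp add: C1_in_grad(2)[OF c p(1) v] C1_in_grad(2)[OF c p(1) flux] p(2))
    qed
    have "(\<Sum>i\<in>UNIV. frechet_derivative (F i) (at x) (axis i 1)) =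
        v (?ci x) * (\<Sum>i\<in>UNIV. chart_grad c (flux c \<phi> i) (?ci x) $ i)
        + sqrt (det (g c (?ci x))) * (chart_grad c v (?ci x) \<bullet> grad g \<phi> c (?ci x))"
      by (simp add: dF sum.distrib sum_distrib_left inner_vec_def flux_def algebra_simps)
    also have "\<dots> = sqrt (det (g c (?ci x))) * G (?ci x)"
      using True pos by (simp add: G_def chart_laplace_eq distrib_left)
    finally show ?thesis using chart_interior_image[OF x] by simp
  next
    case False
    have "((\<lambda>x. 0) has_derivative (\<lambda>h. 0)) (at x)" by simp
    then have dF: "(F i has_derivative (\<lambda>h. 0)) (at x)" for i
      by (rule has_derivative_transform_within_open[of _ _ _ _ "- C"])
         (use False F0 compact_imp_closed[OF C(1)] in auto)
    have "(\<Sum>i\<in>UNIV. frechet_derivative (F i) (at x) (axis i 1)) = 0"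
      by (simp add: frechet_derivative_eqI[OF dF])
    moreover have "x \<in> chart_image c \<Longrightarrow> ?ci x \<notin> ?K"
      using False K(3) c by (metis coords_chart_inv imageI)
    ultimately show ?thesis by (auto simp: G_def indicator_def)
  qed
  have "integrable lborel (\<lambda>x. \<Sum>i\<in>UNIV. frechet_derivative (F i) (at x) (axis i 1))"
    by (intro Bochner_Integration.integrable_sum div(1))
  then show "integrable vol G"
    unfolding eq[symmetric] by (subst integral_vol_chart(1)[OF c Gm]) (rule G0)
  have "integral\<^sup>L lborel (\<lambda>x. \<Sum>i\<in>UNIV. frechet_derivative (F i) (at x) (axis i 1)) = 0"
    by (subst Bochner_Integration.integral_sum) (simp_all add: div)
  then show "integral\<^sup>L vol G = 0"
    unfolding eq[symmetric] by (subst integral_vol_chart(2)[OF c Gm]) (rule G0)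
qed

section \<open>The Laplace--Beltrami operator does not depend on the chart\<close>

lemma chart_ball_positive_volume:
  assumes "valid_ball c y r"
  shows "emeasure vol (chart_ball c y r) \<noteq> 0"
proof
  assume 0: "emeasure vol (chart_ball c y r) = 0"
  have r: "0 < r" "c \<in> A" "cball y (2 * r) \<subseteq> chart_interior c" using assms by (auto simp: valid_ball_def)
  have "ball y r \<subseteq> cball y (2 * r)" using r(1) by auto
  then have sub: "ball y r \<subseteq> chart_image c" using r(3) chart_interior_subset[of c] by blast
  then have img: "coords c ` chart_ball c y r = ball y r"
    by (auto simp: chart_ball_def)
  let ?rho = "\<lambda>x. sqrt (det (g c (chart_inv c x)))"
  have "(\<lambda>x. indicat_real (ball y r) x *\<^sub>R ?rho x) \<in> borel_measurable borel"
    by (intro borel_measurable_continuous_on_indicator continuous_on_subset[OF continuous_on_density[OF r(2)] sub]) simp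
  then have "(\<lambda>x. ennreal (indicat_real (ball y r) x *\<^sub>R ?rho x)) \<in> borel_measurable lborel" by simp
  moreover have "(\<lambda>x. ennreal (indicat_real (ball y r) x *\<^sub>R ?rho x)) = (\<lambda>x. ennreal (?rho x) * indicator (ball y r) x)"
    by (auto simp: indicator_def fun_eq_iff)
  ultimately have m: "(\<lambda>x. ennreal (?rho x) * indicator (ball y r) x) \<in> borel_measurable lborel" by simp
  have "chart_ball c y r \<in> sets borel" using open_chart_ball[OF r(2)] by simp
  moreover have "chart_ball c y r \<subseteq> chart_dom c" by (auto simp: chart_ball_def)
  ultimately have "emeasure vol (chart_ball c y r) = (\<integral>\<^sup>+x\<in>ball y r. ennreal (?rho x) \<partial>lborel)"
    by (simp only: emeasure_vol_chart[OF r(2)] img)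
  with 0 have "AE x in lborel. ennreal (?rho x) * indicator (ball y r) x = 0"
    using nn_integral_0_iff_AE[OF m] by simp
  then have "AE x in lborel. x \<notin> ball y r"
  proof (rule AE_mp, intro AE_I2 impI)
    fix x assume x: "ennreal (?rho x) * indicator (ball y r) x = 0"
    show "x \<notin> ball y r"
    proof
      assume b: "x \<in> ball y r"
      then have "chart_inv c x \<in> chart_dom c" using sub r(2) by auto
      then have "0 < ?rho x" using metric_det_pos[OF r(2)] by simp
      then show False using x b by simp
    qed
  qed
  then have "ball y r \<in> null_sets lborel"
    by (subst (asm) AE_iff_null_sets[symmetric]) auto
  then have "negligible (ball y r)"
    by (simp add: negligible_iff_null_sets null_sets_completionI)
  then show False using open_not_negligible[OF open_ball, of y r] r(1) by simp
qed

lemma valid_ball_in_open: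
  assumes "c \<in> A" "open V" "V \<subseteq> interior_dom c" "p \<in> V"
  obtains r where "valid_ball c (coords c p) r" "chart_inv c ` cball (coords c p) (2 * r) \<subseteq> V"
    "p \<in> chart_ball c (coords c p) r"
proof -
  obtain e where e: "0 < e" "cball (coords c p) e \<subseteq> coords c ` V"
    using open_coords_image[OF assms(1-3)] assms(4) open_contains_cball by blast
  have "coords c ` V \<subseteq> chart_interior c" using assms(3) by (auto intro: coords_interior)
  then have "valid_ball c (coords c p) (e / 2)" using e assms(1) by (simp add: valid_ball_def)
  moreover have "chart_inv c ` coords c ` V \<subseteq> V"
    using assms(1,3) interior_dom_subset[of c] by auto
  then have "chart_inv c ` cball (coords c p) (2 * (e / 2)) \<subseteq> V"
    using image_mono[OF e(2), of "chart_inv c"] by simp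
  moreover have "p \<in> chart_ball c (coords c p) (e / 2)"
    using assms(3,4) interior_dom_subset[of c] e(1) by (auto simp: chart_ball_def)
  ultimately show ?thesis using that by blast
qed

text \<open>If the expression in \<open>c\<close> exceeded that in \<open>d\<close> at \<open>p\<close>, it would do so on a neighbourhood.
For a cutoff \<open>v\<close> supported there, \<open>\<integral> v \<Delta>\<phi> = - \<integral> \<langle>\<nabla>v, \<nabla>\<phi>\<rangle>\<close> in both charts, with a right-hand side
that does not depend on the chart; so the difference of the Laplacians, multiplied by \<open>v\<close>, has
integral zero although it is positive on a ball. This avoids second derivatives of transition
maps.\<close>

lemma chart_laplace_le:
  assumes phi: "smooth_fun_on A UNIV \<phi>" and c: "c \<in> A" and d: "d \<in> A"
    and p: "p \<in> interior_dom c" "p \<in> interior_dom d"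
  shows "chart_laplace c \<phi> p \<le> chart_laplace d \<phi> p"
proof (rule ccontr)
  assume gt: "\<not> ?thesis"
  let ?E = "\<lambda>q. chart_laplace c \<phi> q - chart_laplace d \<phi> q"
  let ?O = "interior_dom c \<inter> interior_dom d"
  have O: "open ?O" using c d open_interior_dom by auto
  have "continuous_on ?O ?E"
    by (intro continuous_on_diff continuous_on_subset[OF continuous_on_chart_laplace[OF phi c]]
        continuous_on_subset[OF continuous_on_chart_laplace[OF phi d]]) auto
  then have V: "open (?O \<inter> ?E -` {0<..})"
    by (rule continuous_open_preimage[OF _ O]) simp
  let ?V = "?O \<inter> ?E -` {0<..}"
  have pV: "p \<in> ?V" using p gt by simp
  let ?y = "coords c p"
  have Vsub: "?V \<subseteq> interior_dom c" by blast
  obtain r where r: "valid_ball c ?y r" "chart_inv c ` cball ?y (2 * r) \<subseteq> ?V"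
    using valid_ball_in_open[OF c V Vsub pV] .
  let ?K = "chart_inv c ` cball ?y (2 * r)" and ?v = "chart_bump c ?y r"
  have C: "compact (cball ?y (2 * r))" "cball ?y (2 * r) \<subseteq> chart_interior c"
    using r(1) by (auto simp: valid_ball_def)
  note K = compact_chart_inv_image[OF c C]
  have Kd: "?K \<subseteq> interior_dom d" using r(2) by blast
  have Cd: "compact (coords d ` ?K)" "coords d ` ?K \<subseteq> chart_interior d"
    using Kd interior_dom_subset[of d]
    by (auto intro!: compact_continuous_image K(1) continuous_on_subset[OF continuous_on_coords[OF d]]
        intro: coords_interior)
  have Kd': "chart_inv d ` coords d ` ?K = ?K"
  proof -
    have "chart_inv d (coords d q) = q" if "q \<in> ?K" for q
      using that Kd interior_dom_subset[of d] d by (intro chart_inv_coords) auto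
    then show ?thesis by (simp add: image_image)
  qed
  have v: "C1_in c ?v" "C1_in d ?v" using C1_fun_chart_bump[OF r(1)] c d by (auto simp: C1_fun_def)
  have v0: "?v q = 0" if "q \<notin> ?K" for q using chart_bump_eq_0[OF r(1) that] .
  let ?G = "\<lambda>e q. if q \<in> ?K then ?v q * chart_laplace e \<phi> q + chart_grad e ?v q \<bullet> grad g \<phi> e q else 0"
  have Gc: "integrable vol (?G c)" "integral\<^sup>L vol (?G c) = 0"
    using chart_divergence_theorem[OF phi c v(1) C] v0 by auto
  have Gd: "integrable vol (?G d)" "integral\<^sup>L vol (?G d) = 0"
    using chart_divergence_theorem[OF phi d v(2) Cd] v0 unfolding Kd' by auto
  let ?H = "\<lambda>q. ?G c q - ?G d q"
  have H: "integrable vol ?H" "integral\<^sup>L vol ?H = 0" using Gc Gd by simp_all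
  have Heq: "?H q = (if q \<in> ?K then ?v q * ?E q else 0)" for q
  proof (cases "q \<in> ?K")
    case True
    then have q: "q \<in> interior_dom c" "q \<in> interior_dom d" using r(2) by auto
    have tr: "transforms_at (grad g ?v) q" "transforms_at (grad g \<phi>) q"
      using C1_in_transforms_at[OF c q(1) v(1)] smooth_fun_transforms_at[OF phi] by auto
    have "chart_grad c ?v q \<bullet> grad g \<phi> c q = chart_grad d ?v q \<bullet> grad g \<phi> d q"
      using metric_inner_grad_chart[OF tr c interior_dom_dom[OF q(1)]]
        metric_inner_grad_chart[OF tr d interior_dom_dom[OF q(2)]] by simp
    then show ?thesis using True by (simp add: algebra_simps)
  qed simp
  have Hnn: "0 \<le> ?H q" for q
  proof (cases "q \<in> ?K")
    case True
    then have "0 \<le> ?E q" using r(2) by auto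
    then show ?thesis unfolding Heq using chart_bump_nonneg[of c ?y r q] by simp
  qed simp
  then have "AE q in vol. ?H q = 0"
    using integral_nonneg_eq_0_iff_AE[OF H(1)] H(2) by simp
  then have "AE q in vol. q \<notin> chart_ball c ?y r"
  proof (rule AE_mp, intro AE_I2 impI)
    fix q assume H0: "?H q = 0"
    show "q \<notin> chart_ball c ?y r"
    proof
      assume q: "q \<in> chart_ball c ?y r"
      then have "?v q = 1" by (rule chart_bump_eq_1)
      then have "q \<in> ?K" using v0 by force
      then have "0 < ?E q" using r(2) by auto
      with H0 \<open>?v q = 1\<close> \<open>q \<in> ?K\<close> show False unfolding Heq by simp
    qed
  qed
  then have "emeasure vol (chart_ball c ?y r) = 0"
    using open_chart_ball[OF c, of ?y r] by (subst (asm) AE_iff_null_sets[symmetric]) auto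
  then show False using chart_ball_positive_volume[OF r(1)] by simp
qed

lemma chart_laplace_independent:
  assumes "smooth_fun_on A UNIV \<phi>" "c \<in> A" "d \<in> A" "p \<in> interior_dom c" "p \<in> interior_dom d"
  shows "chart_laplace c \<phi> p = chart_laplace d \<phi> p"
  using chart_laplace_le[OF assms] chart_laplace_le[OF assms(1,3,2,5,4)] by simp

section \<open>Green's formula\<close>

abbreviation supp :: "('a \<Rightarrow> real) \<Rightarrow> 'a set" where
  "supp \<phi> \<equiv> closure {p. \<phi> p \<noteq> 0}"

lemma test_fun_smooth: "test_fun A \<Omega> \<phi> \<Longrightarrow> smooth_fun_on A UNIV \<phi>"
  by (simp add: test_fun_def)

lemma test_fun_compact: "test_fun A \<Omega> \<phi> \<Longrightarrow> compact (supp \<phi>)"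
  by (simp add: test_fun_def)

lemma test_fun_subset: "test_fun A \<Omega> \<phi> \<Longrightarrow> supp \<phi> \<subseteq> \<Omega>"
  by (auto simp: test_fun_def)

lemma supp_interior_dom:
  "test_fun A \<Omega> \<phi> \<Longrightarrow> p \<in> supp \<phi> \<Longrightarrow> c \<in> A \<Longrightarrow> p \<in> chart_dom c \<Longrightarrow> p \<in> interior_dom c"
  by (rule not_boundary_interior_dom) (auto simp: test_fun_def)

lemma zero_outside_supp: "p \<notin> supp \<phi> \<Longrightarrow> \<phi> p = 0"
  using closure_subset by force

lemma grad_outside_supp:
  assumes "c \<in> A" "p \<in> chart_dom c" "p \<notin> supp \<phi>"
  shows "chart_grad c \<phi> p = 0" "grad g \<phi> c p = 0"
proof -
  have V: "open (- supp \<phi>)" "p \<in> - supp \<phi>" using assms(3) by auto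
  show "chart_grad c \<phi> p = 0"
    by (rule chart_grad_locally_const(2)[OF assms(1,2) V, where t = 0]) (rule zero_outside_supp, simp)
  show "grad g \<phi> c p = 0"
    by (rule grad_locally_const[OF assms(1,2) V, where t = 0]) (rule zero_outside_supp, simp)
qed

lemma laplace_outside_supp:
  assumes "c \<in> A" "p \<in> chart_dom c" "p \<notin> supp \<phi>"
  shows "chart_laplace c \<phi> p = 0"
proof -
  have "chart_grad c (flux c \<phi> i) p = 0" for i
  proof (rule chart_grad_locally_const(2)[OF assms(1,2), where t = 0])
    show "open (chart_dom c \<inter> - supp \<phi>)" using open_chart_dom[OF assms(1)] by auto
  qed (use assms grad_outside_supp(2)[OF assms(1)] in \<open>auto simp: flux_def\<close>)
  then show ?thesis by (simp add: chart_laplace_eq)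
qed

lemma laplace_eq_chart:
  assumes "test_fun A \<Omega> \<phi>" "c \<in> A" "p \<in> interior_dom c"
  shows "laplace_beltrami A g \<phi> p = chart_laplace c \<phi> p"
proof (cases "p \<in> supp \<phi>")
  case True
  have "p \<in> interior_dom (chart_at A p)"
    by (rule supp_interior_dom[OF assms(1) True chart_at])
  then show ?thesis
    unfolding laplace_beltrami_eq
    by (rule chart_laplace_independent[OF test_fun_smooth[OF assms(1)] chart_at(1) assms(2) _ assms(3)])
next
  case False
  then show ?thesis
    unfolding laplace_beltrami_eq
    using laplace_outside_supp[OF chart_at False] laplace_outside_supp[OF assms(2) interior_dom_dom[OF assms(3)] False]
    by simp
qed

text \<open>Each point has a neighbourhood on which one coordinate expression is valid: the interior part of
a chart for points of the support, the complement of the support otherwise.\<close>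

lemma continuous_laplace:
  assumes "test_fun A \<Omega> \<phi>"
  shows "continuous_on UNIV (laplace_beltrami A g \<phi>)"
proof -
  have "continuous_on (interior_dom c) (laplace_beltrami A g \<phi>)" if c: "c \<in> A" for c
    by (rule continuous_on_eq[OF continuous_on_chart_laplace[OF test_fun_smooth[OF assms] c]])
       (simp add: laplace_eq_chart[OF assms c])
  moreover have "continuous_on (- supp \<phi>) (laplace_beltrami A g \<phi>)"
    by (rule continuous_on_eq[OF continuous_on_const[of _ 0]])
       (simp add: laplace_beltrami_eq laplace_outside_supp[OF chart_at])
  ultimately have "continuous_on (\<Union>S\<in>insert (- supp \<phi>) (interior_dom ` A). S) (laplace_beltrami A g \<phi>)"
    using open_interior_dom by (intro continuous_on_open_UN) auto
  moreover have "(\<Union>S\<in>insert (- supp \<phi>) (interior_dom ` A). S) = UNIV"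
    using supp_interior_dom[OF assms _ chart_at] chart_at(1) by auto
  ultimately show ?thesis by simp
qed

lemma bounded_compact_support:
  fixes h :: "'a \<Rightarrow> real"
  assumes "continuous_on UNIV h" "compact K" "\<And>p. p \<notin> K \<Longrightarrow> h p = 0"
  obtains B where "0 \<le> B" "\<And>p. \<bar>h p\<bar> \<le> B"
proof -
  have "bounded (h ` K)"
    using assms by (intro compact_imp_bounded compact_continuous_image) (auto intro: continuous_on_subset)
  then obtain B where B: "\<And>p. p \<in> K \<Longrightarrow> \<bar>h p\<bar> \<le> B" by (auto simp: bounded_iff)
  have "\<bar>h p\<bar> \<le> max B 0" for p using B[of p] assms(3)[of p] by (cases "p \<in> K") auto
  then show ?thesis using that[of "max B 0"] by simp
qed

text \<open>The divergence of \<open>u \<nabla>\<phi>\<close>.\<close>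

definition green :: "('a \<Rightarrow> real) \<Rightarrow> ('a \<Rightarrow> real) \<Rightarrow> 'a \<Rightarrow> real" where
  "green \<phi> u p = u p * laplace_beltrami A g \<phi> p + metric_inner A g (grad g u) (grad g \<phi>) p"

lemma green_outside_supp: "p \<notin> supp \<phi> \<Longrightarrow> green \<phi> u p = 0"
  using grad_outside_supp(2)[OF chart_at, of p \<phi>] laplace_outside_supp[OF chart_at, of p \<phi>]
  by (simp add: green_def laplace_beltrami_eq metric_inner_def Let_def)

lemma green_chart:
  assumes "test_fun A \<Omega> \<phi>" "C1_in c u" "c \<in> A" "p \<in> interior_dom c"
  shows "green \<phi> u p = u p * chart_laplace c \<phi> p + chart_grad c u p \<bullet> grad g \<phi> c p"
  using C1_in_transforms_at[OF assms(3,4,2)] smooth_fun_transforms_at[OF test_fun_smooth[OF assms(1)], of p]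
  by (simp add: green_def laplace_eq_chart[OF assms(1,3,4)]
      metric_inner_grad_chart[OF _ _ assms(3) interior_dom_dom[OF assms(4)]])

lemma green_add:
  assumes "test_fun A \<Omega> \<phi>" "C1_fun u" "C1_fun v" "C1_fun w" "\<And>p. w p = u p + v p"
  shows "green \<phi> w p = green \<phi> u p + green \<phi> v p"
proof (cases "p \<in> supp \<phi>")
  case True
  let ?c = "chart_at A p"
  have p: "p \<in> interior_dom ?c" by (rule supp_interior_dom[OF assms(1) True chart_at])
  have C: "C1_in ?c u" "C1_in ?c v" "C1_in ?c w" using assms(2-4) chart_at(1) by (auto simp: C1_fun_def)
  have w: "w = (\<lambda>p. u p + v p)" using assms(5) by auto
  have "chart_grad ?c w p = chart_grad ?c u p + chart_grad ?c v p"
    unfolding w using C1_in_grad(1)[OF chart_at(1) p] C(1,2) by (intro chart_grad_add chart_at)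
  then show ?thesis
    by (simp add: green_chart[OF assms(1) _ chart_at(1) p] C assms(5) inner_add_left distrib_right)
qed (simp add: green_outside_supp)

lemma green_local:
  assumes phi: "test_fun A \<Omega> \<phi>" and b: "valid_ball c y r" and u: "C1_fun u"
  shows "integrable vol (green \<phi> (\<lambda>p. chart_bump c y r p * u p))"
    and "integral\<^sup>L vol (green \<phi> (\<lambda>p. chart_bump c y r p * u p)) = 0"
proof -
  let ?v = "\<lambda>p. chart_bump c y r p * u p" and ?C = "cball y (2 * r)"
  have c: "c \<in> A" and C: "compact ?C" "?C \<subseteq> chart_interior c" using b by (auto simp: valid_ball_def)
  have v: "C1_fun ?v" by (rule C1_fun_mult[OF C1_fun_chart_bump[OF b] u])
  then have vc: "C1_in c ?v" using c by (simp add: C1_fun_def)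
  have v0: "?v p = 0" if "p \<notin> chart_inv c ` ?C" for p using chart_bump_eq_0[OF b that] by simp
  have cl: "closed (chart_inv c ` ?C)"
    using compact_chart_inv_image(1)[OF c C] by (rule compact_imp_closed)
  have "green \<phi> ?v = (\<lambda>p. if p \<in> chart_inv c ` ?C
      then ?v p * chart_laplace c \<phi> p + chart_grad c ?v p \<bullet> grad g \<phi> c p else 0)"
  proof
    fix p
    show "green \<phi> ?v p = (if p \<in> chart_inv c ` ?C
      then ?v p * chart_laplace c \<phi> p + chart_grad c ?v p \<bullet> grad g \<phi> c p else 0)"
    proof (cases "p \<in> chart_inv c ` ?C")
      case True
      then have "p \<in> interior_dom c" using compact_chart_inv_image(2)[OF c C] by blast
      then show ?thesis using True green_chart[OF phi vc c] by simp
    next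
      case False
      have "grad g ?v (chart_at A p) p = 0"
        by (rule grad_locally_const[OF chart_at, where V = "- (chart_inv c ` ?C)" and t = 0])
           (use False v0 cl in auto)
      then have "green \<phi> ?v p = 0"
        using v0[OF False] by (simp add: green_def metric_inner_def Let_def)
      then show ?thesis using False by simp
    qed
  qed
  then show "integrable vol (green \<phi> ?v)" "integral\<^sup>L vol (green \<phi> ?v) = 0"
    using chart_divergence_theorem[OF test_fun_smooth[OF phi] c vc C] v0 by simp_all
qed

text \<open>Induction over the balls: \<open>u = b u + (1 - b) u\<close> with the cutoff \<open>b\<close> of one ball; the first part is
supported in a chart and the second one vanishes on that ball. The set \<open>W\<close> is kept fixed so that
in the end \<open>u\<close> vanishes on a neighbourhood of the support of \<open>\<phi>\<close>, and its gradient with it.\<close>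

lemma green_cover:
  assumes phi: "test_fun A \<Omega> \<phi>" and W: "open W" "supp \<phi> \<subseteq> W"
    and "finite B" "\<And>c y r. (c, y, r) \<in> B \<Longrightarrow> valid_ball c y r"
    and "C1_fun u" "\<And>p. p \<in> W \<Longrightarrow> u p \<noteq> 0 \<Longrightarrow> \<exists>(c, y, r)\<in>B. p \<in> chart_ball c y r"
  shows "integrable vol (green \<phi> u) \<and> integral\<^sup>L vol (green \<phi> u) = 0"
  using assms(4-)
proof (induction B arbitrary: u rule: finite_induct)
  case empty
  have "green \<phi> u p = 0" for p
  proof (cases "p \<in> supp \<phi>")
    case True
    then have p: "p \<in> W" using W(2) by blast
    have "u p = 0" using empty p by auto
    moreover have "grad g u (chart_at A p) p = 0"
      by (rule grad_locally_const[OF chart_at W(1) p, where t = 0]) (use empty in auto)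
    ultimately show ?thesis by (simp add: green_def metric_inner_def Let_def)
  qed (simp add: green_outside_supp)
  then have "green \<phi> u = (\<lambda>p. 0)" by auto
  then show ?case by simp
next
  case (insert b B)
  obtain c y r where b: "b = (c, y, r)" by (cases b) auto
  have vb: "valid_ball c y r" using insert.prems(1)[of c y r] b by simp
  let ?b = "chart_bump c y r"
  let ?v = "\<lambda>p. ?b p * u p" and ?w = "\<lambda>p. (1 - ?b p) * u p"
  have Cb: "C1_fun ?b" by (rule C1_fun_chart_bump[OF vb])
  have Cv: "C1_fun ?v" and Cw: "C1_fun ?w"
    using Cb insert.prems(2) by (auto intro: C1_fun_mult C1_fun_one_minus)
  have "green \<phi> u p = green \<phi> ?v p + green \<phi> ?w p" for p
    by (rule green_add[OF phi Cv Cw insert.prems(2)]) (simp add: algebra_simps)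
  then have eq: "green \<phi> u = (\<lambda>p. green \<phi> ?v p + green \<phi> ?w p)" by auto
  have "integrable vol (green \<phi> ?w) \<and> integral\<^sup>L vol (green \<phi> ?w) = 0"
  proof (rule insert.IH[OF _ Cw])
    show "valid_ball c y r" if "(c, y, r) \<in> B" for c y r using insert.prems(1) that by blast
    fix p assume p: "p \<in> W" "?w p \<noteq> 0"
    then have "p \<notin> chart_ball c y r" using chart_bump_eq_1[of p c y r] by auto
    moreover have "\<exists>(c, y, r)\<in>insert b B. p \<in> chart_ball c y r"
      using insert.prems(3)[OF p(1)] p(2) by auto
    ultimately show "\<exists>(c, y, r)\<in>B. p \<in> chart_ball c y r" unfolding b by auto
  qed
  then show ?case using green_local[OF phi vb insert.prems(2)] by (simp add: eq)
qed

theorem green_formula: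
  assumes "test_fun A \<Omega> \<phi>" "C1_fun u"
  shows "integrable vol (green \<phi> u)" "integral\<^sup>L vol (green \<phi> u) = 0"
proof -
  let ?T = "{(c, y, r). valid_ball c y r}"
  let ?f = "\<lambda>(c, y, r). chart_ball c y r"
  have "supp \<phi> \<subseteq> (\<Union>t\<in>?T. ?f t)"
  proof
    fix p assume p: "p \<in> supp \<phi>"
    let ?c = "chart_at A p"
    have "p \<in> interior_dom ?c" by (rule supp_interior_dom[OF assms(1) p chart_at])
    then obtain r where "valid_ball ?c (coords ?c p) r" "p \<in> chart_ball ?c (coords ?c p) r"
      using valid_ball_in_open[OF chart_at(1) open_interior_dom[OF chart_at(1)] subset_refl] by metis
    then show "p \<in> (\<Union>t\<in>?T. ?f t)" by (intro UN_I[of "(?c, coords ?c p, r)"]) auto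
  qed
  moreover have op: "open (?f t)" if "t \<in> ?T" for t
    using that open_chart_ball by (auto simp: valid_ball_def)
  ultimately obtain B where B: "B \<subseteq> ?T" "finite B" "supp \<phi> \<subseteq> (\<Union>t\<in>B. ?f t)"
    using compactE_image[OF test_fun_compact[OF assms(1)], of ?T ?f] by metis
  have "open (\<Union>t\<in>B. ?f t)" using B(1) op by (intro open_UN ballI) blast
  from green_cover[OF assms(1) this B(3,2) _ assms(2)] B(1)
  show "integrable vol (green \<phi> u)" "integral\<^sup>L vol (green \<phi> u) = 0" by auto
qed

section \<open>Square integrable functions and fields\<close>

lemma set_integrable_vol_iff:
  fixes h :: "'a \<Rightarrow> real"
  shows "S \<in> sets borel \<Longrightarrow> set_integrable vol S h \<longleftrightarrow> integrable (restrict_space vol S) h"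
  by (simp add: set_integrable_def integrable_restrict_space)

lemma set_integral_vol:
  fixes h :: "'a \<Rightarrow> real"
  shows "S \<in> sets borel \<Longrightarrow> (LINT p:S|vol. h p) = integral\<^sup>L (restrict_space vol S) h"
  by (simp add: set_lebesgue_integral_def integral_restrict_space)

lemma measurable_vol_restrict:
  fixes h :: "'a \<Rightarrow> real"
  shows "h \<in> borel_measurable borel \<Longrightarrow> h \<in> borel_measurable (restrict_space vol S)"
  by (intro measurable_restrict_space1) simp

lemma L2_on_iff: "S \<in> sets borel \<Longrightarrow> L2_on vol S u \<longleftrightarrow>
    u \<in> borel_measurable borel \<and> integrable (restrict_space vol S) (\<lambda>p. (u p)\<^sup>2)"
  by (simp add: L2_on_def set_integrable_vol_iff)

lemma L2_field_on_iff: "S \<in> sets borel \<Longrightarrow> L2_field_on A g vol S X \<longleftrightarrow>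
    measurable_vector_field A X \<and> integrable (restrict_space vol S) (metric_inner A g X X)"
  by (simp add: L2_field_on_def set_integrable_vol_iff)

lemma L2_on_product:
  assumes S: "S \<in> sets borel" and u: "L2_on vol S u" and v: "L2_on vol S v"
  shows "integrable (restrict_space vol S) (\<lambda>p. u p * v p)"
proof (rule Bochner_Integration.integrable_bound)
  show "integrable (restrict_space vol S) (\<lambda>p. (u p)\<^sup>2 + (v p)\<^sup>2)"
    using S u v by (simp add: L2_on_iff)
  show "(\<lambda>p. u p * v p) \<in> borel_measurable (restrict_space vol S)"
    using S u v by (intro measurable_vol_restrict borel_measurable_times) (simp_all add: L2_on_iff)
  have "\<bar>a * b\<bar> \<le> a\<^sup>2 + b\<^sup>2" for a b :: real
  proof -
    have "2 * (\<bar>a\<bar> * \<bar>b\<bar>) \<le> a\<^sup>2 + b\<^sup>2" using sum_squares_bound[of "\<bar>a\<bar>" "\<bar>b\<bar>"] by simp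
    moreover have "0 \<le> \<bar>a\<bar> * \<bar>b\<bar>" by simp
    ultimately have "\<bar>a\<bar> * \<bar>b\<bar> \<le> a\<^sup>2 + b\<^sup>2" by linarith
    then show ?thesis by (simp add: abs_mult)
  qed
  then show "AE p in restrict_space vol S. norm (u p * v p) \<le> norm ((u p)\<^sup>2 + (v p)\<^sup>2)"
    by (intro AE_I2) simp
qed

lemma L2_on_lin:
  assumes S: "S \<in> sets borel" and u: "L2_on vol S u" and v: "L2_on vol S v"
  shows "L2_on vol S (\<lambda>p. a * u p + b * v p)"
proof -
  have "integrable (restrict_space vol S) (\<lambda>p. a\<^sup>2 * (u p)\<^sup>2 + 2 * a * b * (u p * v p) + b\<^sup>2 * (v p)\<^sup>2)"
    using S u v L2_on_product[OF assms] by (simp add: L2_on_iff)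
  moreover have "(\<lambda>p. a\<^sup>2 * (u p)\<^sup>2 + 2 * a * b * (u p * v p) + b\<^sup>2 * (v p)\<^sup>2) = (\<lambda>p. (a * u p + b * v p)\<^sup>2)"
    by (simp add: power2_eq_square algebra_simps)
  moreover have "(\<lambda>p. a * u p + b * v p) \<in> borel_measurable borel"
    using u v by (intro borel_measurable_add borel_measurable_times) (auto simp: L2_on_def)
  ultimately show ?thesis using S by (simp add: L2_on_iff)
qed

lemma integral_square_lin:
  assumes S: "S \<in> sets borel" and u: "L2_on vol S u" and v: "L2_on vol S v"
  shows "(LINT p|restrict_space vol S. (a * u p + b * v p)\<^sup>2) =
    a\<^sup>2 * (LINT p|restrict_space vol S. (u p)\<^sup>2) + 2 * a * b * (LINT p|restrict_space vol S. u p * v p)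
    + b\<^sup>2 * (LINT p|restrict_space vol S. (v p)\<^sup>2)"
proof -
  have eq: "(\<lambda>p. (a * u p + b * v p)\<^sup>2) = (\<lambda>p. a\<^sup>2 * (u p)\<^sup>2 + 2 * a * b * (u p * v p) + b\<^sup>2 * (v p)\<^sup>2)"
    by (simp add: power2_eq_square algebra_simps)
  show ?thesis
    unfolding eq using S u v L2_on_product[OF assms] by (simp add: L2_on_iff)
qed

lemma L2_field_product:
  assumes S: "S \<in> sets borel" and X: "L2_field_on A g vol S X" and Y: "L2_field_on A g vol S Y"
  shows "integrable (restrict_space vol S) (metric_inner A g X Y)"
proof (rule Bochner_Integration.integrable_bound)
  show "integrable (restrict_space vol S) (\<lambda>p. metric_inner A g X X p + metric_inner A g Y Y p)"
    using S X Y by (simp add: L2_field_on_iff)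
  show "metric_inner A g X Y \<in> borel_measurable (restrict_space vol S)"
    using S X Y by (intro measurable_vol_restrict measurable_metric_inner) (simp_all add: L2_field_on_iff)
  have "\<bar>metric_inner A g X Y p\<bar> \<le> metric_inner A g X X p + metric_inner A g Y Y p" for p
    using metric_inner_abs_le[of X Y p] by linarith
  then show "AE p in restrict_space vol S. norm (metric_inner A g X Y p) \<le>
      norm (metric_inner A g X X p + metric_inner A g Y Y p)"
    using metric_inner_nonneg by (intro AE_I2) (simp add: abs_of_nonneg)
qed

abbreviation lin :: "real \<Rightarrow> 'a vector_field \<Rightarrow> real \<Rightarrow> 'a vector_field \<Rightarrow> 'a vector_field" where
  "lin a X b Y \<equiv> lin_comb (\<lambda>_. a) X (\<lambda>_. b) Y"

lemma L2_field_lin: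
  assumes S: "S \<in> sets borel" and X: "L2_field_on A g vol S X" and Y: "L2_field_on A g vol S Y"
  shows "L2_field_on A g vol S (lin a X b Y)"
proof -
  have "integrable (restrict_space vol S) (\<lambda>p. a\<^sup>2 * metric_inner A g X X p
      + 2 * a * b * metric_inner A g X Y p + b\<^sup>2 * metric_inner A g Y Y p)"
    using S X Y L2_field_product[OF assms] by (simp add: L2_field_on_iff)
  then show ?thesis
    using S X Y by (simp add: L2_field_on_iff measurable_field_lin_comb metric_inner_lin_comb_self[abs_def])
qed

lemma integral_energy_lin:
  assumes S: "S \<in> sets borel" and X: "L2_field_on A g vol S X" and Y: "L2_field_on A g vol S Y"
  shows "(LINT p|restrict_space vol S. metric_inner A g (lin a X b Y) (lin a X b Y) p) =
    a\<^sup>2 * (LINT p|restrict_space vol S. metric_inner A g X X p)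
    + 2 * a * b * (LINT p|restrict_space vol S. metric_inner A g X Y p)
    + b\<^sup>2 * (LINT p|restrict_space vol S. metric_inner A g Y Y p)"
  using S X Y L2_field_product[OF assms] by (simp add: metric_inner_lin_comb_self L2_field_on_iff)

lemma metric_inner_eq_on_charts:
  assumes "\<And>c p. c \<in> A \<Longrightarrow> p \<in> chart_dom c \<Longrightarrow> X c p = Y c p"
  shows "metric_inner A g X Z = metric_inner A g Y Z" "metric_inner A g X X = metric_inner A g Y Y"
  using assms[OF chart_at] by (auto intro!: ext metric_inner_cong)

lemma field_diff_eq_lin: "X - Y = lin 1 X (-1) Y"
  by (simp add: lin_comb_def fun_eq_iff)

section \<open>The Dirichlet space is a vector space\<close>

lemma test_fun_mult:
  assumes "test_fun A \<Omega> f" "smooth_fun_on A UNIV s"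
  shows "test_fun A \<Omega> (\<lambda>p. s p * f p)"
proof -
  have sub: "closure {p. s p * f p \<noteq> 0} \<subseteq> supp f" by (intro closure_mono) auto
  have "compact (supp f \<inter> closure {p. s p * f p \<noteq> 0})"
    using test_fun_compact[OF assms(1)] by (intro compact_Int_closed) auto
  then have "compact (closure {p. s p * f p \<noteq> 0})" using sub by (simp add: Int_absorb1)
  then show ?thesis
    using assms sub unfolding test_fun_def by (auto intro: smooth_fun_mult)
qed

lemma test_fun_add:
  assumes "test_fun A \<Omega> f" "test_fun A \<Omega> h"
  shows "test_fun A \<Omega> (\<lambda>p. f p + h p)"
proof -
  have sub: "closure {p. f p + h p \<noteq> 0} \<subseteq> supp f \<union> supp h"
    unfolding closure_Un[symmetric] by (intro closure_mono) auto
  have "compact ((supp f \<union> supp h) \<inter> closure {p. f p + h p \<noteq> 0})"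
    using test_fun_compact[OF assms(1)] test_fun_compact[OF assms(2)]
    by (intro compact_Int_closed compact_Un) auto
  then have "compact (closure {p. f p + h p \<noteq> 0})" using sub by (simp add: Int_absorb1)
  then show ?thesis
    using assms sub unfolding test_fun_def by (auto intro: smooth_fun_add)
qed

lemma sobolev_closureE:
  assumes "sobolev_closure A g vol S P u U"
  obtains s where "\<forall>n. P (s n)" "\<forall>n. L2_on vol S (s n)" "\<forall>n. L2_field_on A g vol S (grad g (s n))"
    "(\<lambda>n. LINT p:S|vol. (s n p - u p)\<^sup>2) \<longlonglongrightarrow> 0"
    "(\<lambda>n. LINT p:S|vol. metric_inner A g (grad g (s n) - U) (grad g (s n) - U) p) \<longlonglongrightarrow> 0"
  using assms unfolding sobolev_closure_def by blast

lemma W12_0_L2: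
  assumes "W12_0 A g vol \<Omega> u U"
  shows "L2_on vol \<Omega> u" "L2_field_on A g vol \<Omega> U"
  using assms by (auto simp: W12_0_def sobolev_closure_def)

lemma tendsto_zero_dominated:
  fixes a x y :: "nat \<Rightarrow> real"
  assumes "x \<longlonglongrightarrow> 0" "y \<longlonglongrightarrow> 0" "\<And>n. 0 \<le> a n" "\<And>n. a n \<le> C * x n + D * y n"
  shows "a \<longlonglongrightarrow> 0"
proof (rule real_tendsto_sandwich[OF _ _ tendsto_const])
  show "(\<lambda>n. C * x n + D * y n) \<longlonglongrightarrow> 0"
    using tendsto_add[OF tendsto_mult_left[OF assms(1)] tendsto_mult_left[OF assms(2)]] by simp
qed (use assms in auto)

text \<open>The coefficient \<open>1\<close> makes the function and the field instances of the linear combinations above.\<close>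

lemma W12_0_add_scaled:
  assumes O: "\<Omega> \<in> sets borel" and u: "W12_0 A g vol \<Omega> u U" and v: "W12_0 A g vol \<Omega> v V"
  shows "W12_0 A g vol \<Omega> (\<lambda>p. 1 * u p + t * v p) (lin 1 U t V)"
proof -
  note L = W12_0_L2[OF u] W12_0_L2[OF v]
  obtain s where s': "\<forall>n. test_fun A \<Omega> (s n)" "\<forall>n. L2_on vol \<Omega> (s n)"
    "\<forall>n. L2_field_on A g vol \<Omega> (grad g (s n))" "(\<lambda>n. LINT p:\<Omega>|vol. (s n p - u p)\<^sup>2) \<longlonglongrightarrow> 0"
    "(\<lambda>n. LINT p:\<Omega>|vol. metric_inner A g (grad g (s n) - U) (grad g (s n) - U) p) \<longlonglongrightarrow> 0"
    by (rule sobolev_closureE[OF u[unfolded W12_0_def]])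
  note s = s'(1-3)[rule_format] s'(4,5)
  obtain r where r': "\<forall>n. test_fun A \<Omega> (r n)" "\<forall>n. L2_on vol \<Omega> (r n)"
    "\<forall>n. L2_field_on A g vol \<Omega> (grad g (r n))" "(\<lambda>n. LINT p:\<Omega>|vol. (r n p - v p)\<^sup>2) \<longlonglongrightarrow> 0"
    "(\<lambda>n. LINT p:\<Omega>|vol. metric_inner A g (grad g (r n) - V) (grad g (r n) - V) p) \<longlonglongrightarrow> 0"
    by (rule sobolev_closureE[OF v[unfolded W12_0_def]])
  note r = r'(1-3)[rule_format] r'(4,5)
  let ?q = "\<lambda>n p. 1 * s n p + t * r n p"
  let ?R = "restrict_space vol \<Omega>"
  have test: "test_fun A \<Omega> (?q n)" for n
    using test_fun_add[OF s(1) test_fun_mult[OF r(1) smooth_fun_const]] by simp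
  have L2: "L2_on vol \<Omega> (?q n)" for n by (rule L2_on_lin[OF O s(2) r(2)])
  have gr: "grad g (?q n) c p = lin 1 (grad g (s n)) t (grad g (r n)) c p" if "c \<in> A" "p \<in> chart_dom c" for n c p
  proof -
    have d: "chart_differentiable c (s n) p" "chart_differentiable c (r n) p"
      using test_fun_smooth[OF s(1)] test_fun_smooth[OF r(1)] that by (blast intro: smooth_fun_chart_differentiable)+
    have "grad g (\<lambda>p. t * r n p) c p = t *\<^sub>R grad g (r n) c p"
      using grad_mult[OF that chart_grad_const(1)[OF that] d(2), of t]
        grad_locally_const[OF that open_UNIV, of "\<lambda>_. t" t] by simp
    then have "grad g (\<lambda>p. s n p + t * r n p) c p = grad g (s n) c p + t *\<^sub>R grad g (r n) c p"
      using grad_add[OF that d(1) chart_grad_mult(1)[OF that chart_grad_const(1)[OF that] d(2)], of t] by simp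
    then show ?thesis by (simp add: lin_comb_def)
  qed
  have fld: "L2_field_on A g vol \<Omega> (grad g (?q n))" for n
    using L2_field_lin[OF O s(3)[of n] r(3)[of n], of 1 t] measurable_field_grad[OF test_fun_smooth[OF test]]
    by (simp only: L2_field_on_iff[OF O] metric_inner_eq_on_charts(2)[OF gr])
  have lim1: "(\<lambda>n. LINT p:\<Omega>|vol. (?q n p - (1 * u p + t * v p))\<^sup>2) \<longlonglongrightarrow> 0"
  proof (rule tendsto_zero_dominated[OF s(4) r(4)])
    let ?b = "\<lambda>n. 2 * (LINT p:\<Omega>|vol. (s n p - u p)\<^sup>2) + 2 * t\<^sup>2 * (LINT p:\<Omega>|vol. (r n p - v p)\<^sup>2)"
    show "0 \<le> (LINT p:\<Omega>|vol. (?q n p - (1 * u p + t * v p))\<^sup>2)" for n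
      by (simp add: set_integral_vol[OF O])
    show "(LINT p:\<Omega>|vol. (?q n p - (1 * u p + t * v p))\<^sup>2) \<le> ?b n" for n
    proof -
      have a: "L2_on vol \<Omega> (\<lambda>p. 1 * s n p + (-1) * u p)" "L2_on vol \<Omega> (\<lambda>p. 1 * r n p + (-1) * v p)"
        by (rule L2_on_lin[OF O s(2) L(1)], rule L2_on_lin[OF O r(2) L(3)])
      have i: "integrable ?R (\<lambda>p. (s n p - u p)\<^sup>2)" "integrable ?R (\<lambda>p. (r n p - v p)\<^sup>2)"
        using a O by (simp_all add: L2_on_iff)
      have j: "integrable ?R (\<lambda>p. (?q n p - (1 * u p + t * v p))\<^sup>2)"
        using L2_on_lin[OF O L2[of n] L2_on_lin[OF O L(1,3), of 1 t], of 1 "-1"] O by (simp add: L2_on_iff algebra_simps)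
      have "(?q n p - (1 * u p + t * v p))\<^sup>2 \<le> 2 * (s n p - u p)\<^sup>2 + 2 * t\<^sup>2 * (r n p - v p)\<^sup>2" for p
      proof -
        have "(a + b)\<^sup>2 \<le> 2 * a\<^sup>2 + 2 * b\<^sup>2" for a b :: real
          using zero_le_power2[of "a - b"] by (simp add: power2_eq_square algebra_simps)
        from this[of "s n p - u p" "t * (r n p - v p)"]
        have "((s n p - u p) + t * (r n p - v p))\<^sup>2 \<le> 2 * (s n p - u p)\<^sup>2 + 2 * t\<^sup>2 * (r n p - v p)\<^sup>2"
          by (simp only: power_mult_distrib mult.assoc)
        moreover have "?q n p - (1 * u p + t * v p) = (s n p - u p) + t * (r n p - v p)"
          by (simp add: right_diff_distrib)
        ultimately show ?thesis by (simp only:)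
      qed
      then have "integral\<^sup>L ?R (\<lambda>p. (?q n p - (1 * u p + t * v p))\<^sup>2)
          \<le> integral\<^sup>L ?R (\<lambda>p. 2 * (s n p - u p)\<^sup>2 + 2 * t\<^sup>2 * (r n p - v p)\<^sup>2)"
        using i j by (intro integral_mono) auto
      also have "\<dots> = ?b n" using i by (simp add: set_integral_vol[OF O])
      finally show ?thesis by (simp add: set_integral_vol[OF O])
    qed
  qed
  let ?D = "\<lambda>n. grad g (?q n) - lin 1 U t V"
  have lim2: "(\<lambda>n. LINT p:\<Omega>|vol. metric_inner A g (?D n) (?D n) p) \<longlonglongrightarrow> 0"
  proof (rule tendsto_zero_dominated[OF s(5) r(5)])
    let ?X = "\<lambda>n. grad g (s n) - U" and ?Y = "\<lambda>n. grad g (r n) - V"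
    let ?b = "\<lambda>n. 2 * (LINT p:\<Omega>|vol. metric_inner A g (?X n) (?X n) p)
      + 2 * t\<^sup>2 * (LINT p:\<Omega>|vol. metric_inner A g (?Y n) (?Y n) p)"
    show "0 \<le> (LINT p:\<Omega>|vol. metric_inner A g (?D n) (?D n) p)" for n
      by (simp add: set_integral_vol[OF O] metric_inner_nonneg)
    show "(LINT p:\<Omega>|vol. metric_inner A g (?D n) (?D n) p) \<le> ?b n" for n
    proof -
      have a: "L2_field_on A g vol \<Omega> (?X n)" "L2_field_on A g vol \<Omega> (?Y n)"
        unfolding field_diff_eq_lin by (rule L2_field_lin[OF O s(3) L(2)], rule L2_field_lin[OF O r(3) L(4)])
      have D: "metric_inner A g (?D n) (?D n) = metric_inner A g (lin 1 (?X n) t (?Y n)) (lin 1 (?X n) t (?Y n))"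
        by (rule metric_inner_eq_on_charts(2), simp only: minus_apply gr lin_comb_def)
           (simp add: algebra_simps)
      have i: "integrable ?R (metric_inner A g (?X n) (?X n))" "integrable ?R (metric_inner A g (?Y n) (?Y n))"
        using a O by (simp_all add: L2_field_on_iff)
      have j: "integrable ?R (metric_inner A g (?D n) (?D n))"
        unfolding D using L2_field_lin[OF O a, of 1 t] O by (simp add: L2_field_on_iff)
      have "integral\<^sup>L ?R (metric_inner A g (?D n) (?D n))
          \<le> integral\<^sup>L ?R (\<lambda>p. 2 * metric_inner A g (?X n) (?X n) p + 2 * t\<^sup>2 * metric_inner A g (?Y n) (?Y n) p)"
        using i j metric_inner_lin_comb_self_le[of "\<lambda>_. 1" "?X n" "\<lambda>_. t" "?Y n"]
        unfolding D by (intro integral_mono) auto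
      also have "\<dots> = ?b n" using i by (simp add: set_integral_vol[OF O])
      finally show ?thesis by (simp add: set_integral_vol[OF O])
    qed
  qed
  show ?thesis
    unfolding W12_0_def sobolev_closure_def
  proof (intro conjI exI[of _ ?q] allI)
    show "L2_on vol \<Omega> (\<lambda>p. 1 * u p + t * v p)" by (rule L2_on_lin[OF O L(1,3)])
    show "L2_field_on A g vol \<Omega> (lin 1 U t V)" by (rule L2_field_lin[OF O L(2,4)])
  qed (rule test L2 fld lim1 lim2)+
qed

section \<open>The Poincare inequality\<close>

text \<open>For unbounded \<open>\<Omega>\<close> the constant is \<open>0\<close>. Otherwise let \<open>m\<close> be the supremum of all constants for
which the inequality holds on the Dirichlet space; it is finite, because the eigenfunction lies
there, and is itself such a constant. If \<open>m\<close> were less than \<open>lam\<close>, it would lie outside the spectrum.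
For \<open>v\<close> in the Dirichlet space let then \<open>u\<close> solve
\<open>- \<Delta>u - m u = v\<close>, with \<open>\<parallel>u\<parallel> \<le> k \<parallel>v\<parallel>\<close>. The form \<open>a\<close> of \<open>- \<Delta> - m\<close> is nonnegative,
\<open>a(u, v) = \<parallel>v\<parallel>\<^sup>2\<close> and \<open>a(u, u) = \<integral> u v \<le> k \<parallel>v\<parallel>\<^sup>2\<close>, so \<open>0 \<le> a(u - k v, u - k v)\<close> yields
\<open>\<parallel>v\<parallel>\<^sup>2 \<le> k a(v, v)\<close>. This means that \<open>m + 1 / k\<close> is admissible, contrary to the choice of \<open>m\<close>.\<close>

lemma poincare_inequality:
  assumes O: "\<Omega> \<in> sets borel" and lam: "first_dirichlet_eigenvalue A g vol \<Omega> lam"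
    and v: "W12_0 A g vol \<Omega> v V"
  shows "lam * (LINT p|restrict_space vol \<Omega>. (v p)\<^sup>2) \<le> (LINT p|restrict_space vol \<Omega>. metric_inner A g V V p)"
proof (cases "riemannian_bounded A g \<Omega>")
  case False
  then show ?thesis
    using lam by (simp add: first_dirichlet_eigenvalue_def metric_inner_nonneg)
next
  case True
  let ?R = "restrict_space vol \<Omega>"
  let ?N = "\<lambda>u :: 'a \<Rightarrow> real. LINT p|?R. (u p)\<^sup>2" and ?D = "\<lambda>U. LINT p|?R. metric_inner A g U U p"
  have N0: "0 \<le> ?N u" for u by (rule Bochner_Integration.integral_nonneg) simp
  have D0: "0 \<le> ?D U" for U by (rule Bochner_Integration.integral_nonneg) (rule metric_inner_nonneg)
  define S where "S = {m. \<forall>u U. W12_0 A g vol \<Omega> u U \<longrightarrow> m * ?N u \<le> ?D U}"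
  have S0: "0 \<in> S" using D0 by (simp add: S_def)
  have eig: "dirichlet_eigenvalue A g vol \<Omega> lam" and bot: "\<And>\<nu>. \<nu> \<in> dirichlet_spectrum A g vol \<Omega> \<Longrightarrow> lam \<le> \<nu>"
    using lam True by (auto simp: first_dirichlet_eigenvalue_def)
  obtain u0 U0 where u0: "W12_0 A g vol \<Omega> u0 U0" "\<not> (AE p in vol. p \<in> \<Omega> \<longrightarrow> u0 p = 0)"
    using eig by (auto simp: dirichlet_eigenvalue_def weak_solution_def)
  have "0 < ?N u0"
  proof (rule ccontr)
    assume "\<not> 0 < ?N u0"
    then have "?N u0 = 0" using N0[of u0] by linarith
    moreover have "integrable ?R (\<lambda>p. (u0 p)\<^sup>2)" using W12_0_L2(1)[OF u0(1)] O by (simp add: L2_on_iff)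
    ultimately have "AE p in ?R. (u0 p)\<^sup>2 = 0"
      using integral_nonneg_eq_0_iff_AE[of ?R "\<lambda>p. (u0 p)\<^sup>2"] by simp
    then have "AE p in vol. p \<in> \<Omega> \<longrightarrow> u0 p = 0" using O by (simp add: AE_restrict_space_iff)
    then show False using u0(2) by simp
  qed
  then have bdd: "bdd_above S"
    using u0(1) by (intro bdd_aboveI[of _ "?D U0 / ?N u0"]) (auto simp: S_def field_simps)
  define m where "m = Sup S"
  have mS: "m \<in> S"
    unfolding S_def
  proof (intro CollectI allI impI)
    fix u U assume u: "W12_0 A g vol \<Omega> u U"
    show "m * ?N u \<le> ?D U"
    proof (cases "?N u = 0")
      case False
      then have pos: "0 < ?N u" using N0[of u] by linarith
      have "m \<le> ?D U / ?N u"
        unfolding m_def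
      proof (rule cSup_least)
        show "S \<noteq> {}" using S0 by blast
        show "x \<le> ?D U / ?N u" if "x \<in> S" for x
          using that u pos by (simp add: S_def pos_le_divide_eq)
      qed
      then show ?thesis using pos by (simp add: field_simps)
    qed (use D0 in simp)
  qed
  have "lam \<le> m"
  proof (rule ccontr)
    assume "\<not> lam \<le> m"
    then have "m \<notin> dirichlet_spectrum A g vol \<Omega>" using bot by blast
    then obtain C where C: "\<And>F. L2_on vol \<Omega> F \<Longrightarrow> \<exists>u U. weak_solution A g vol \<Omega> m F u U \<and> ?N u \<le> C * ?N F"
      unfolding dirichlet_spectrum_def set_integral_vol[OF O] by blast
    \<comment> \<open>the maximum makes \<open>k\<close> positive even if \<open>C\<close> is not\<close>
    define k where "k = sqrt (max C 1)"
    have k: "1 \<le> k" "C \<le> k\<^sup>2" by (auto simp: k_def)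
    have "m + 1 / k \<in> S"
      unfolding S_def
    proof (intro CollectI allI impI)
      fix v V assume v: "W12_0 A g vol \<Omega> v V"
      note Lv = W12_0_L2[OF v]
      obtain u U where sol: "weak_solution A g vol \<Omega> m v u U" and Nu: "?N u \<le> C * ?N v"
        using C[OF Lv(1)] by blast
      have u: "W12_0 A g vol \<Omega> u U" using sol by (simp add: weak_solution_def)
      note Lu = W12_0_L2[OF u]
      let ?uv = "LINT p|?R. u p * v p" and ?UV = "LINT p|?R. metric_inner A g U V p"
      have vu: "(LINT p|?R. v p * u p) = ?uv" by (simp add: mult.commute)
      have weak: "(LINT p|?R. metric_inner A g U Z p) - m * (LINT p|?R. u p * z p) = (LINT p|?R. v p * z p)"
        if "W12_0 A g vol \<Omega> z Z" for z Z
        using sol that unfolding weak_solution_def set_integral_vol[OF O] by blast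
      have 1: "?UV - m * ?uv = ?N v" using weak[OF v] by (simp add: power2_eq_square)
      have 2: "?D U - m * ?N u = ?uv" using weak[OF u] vu by (simp add: power2_eq_square)
      \<comment> \<open>the form is nonnegative at \<open>u - k v\<close>\<close>
      have "m * ?N (\<lambda>p. 1 * u p + (- k) * v p) \<le> ?D (lin 1 U (- k) V)"
        using mS W12_0_add_scaled[OF O u v, of "- k"] unfolding S_def by blast
      then have "m * (?N u - 2 * k * ?uv + k\<^sup>2 * ?N v) \<le> ?D U - 2 * k * ?UV + k\<^sup>2 * ?D V"
        unfolding integral_square_lin[OF O Lu(1) Lv(1)] integral_energy_lin[OF O Lu(2) Lv(2)] by simp
      then have 3: "0 \<le> ?uv - 2 * k * ?N v + k\<^sup>2 * (?D V - m * ?N v)"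
        using 1 2 by (simp add: algebra_simps)
      have "0 \<le> (LINT p|?R. (1 * u p + (- k) * v p)\<^sup>2)" by simp
      then have "2 * k * ?uv \<le> ?N u + k\<^sup>2 * ?N v"
        unfolding integral_square_lin[OF O Lu(1) Lv(1)] by simp
      also have "\<dots> \<le> C * ?N v + k\<^sup>2 * ?N v" using Nu by simp
      also have "\<dots> \<le> k\<^sup>2 * ?N v + k\<^sup>2 * ?N v" using k(2) N0 by (intro add_mono mult_right_mono) auto
      finally have "k * ?uv \<le> k * (k * ?N v)" by (simp add: power2_eq_square)
      then have "?uv \<le> k * ?N v" using k(1) by simp
      then have "k * ?N v \<le> k * (k * (?D V - m * ?N v))" using 3 by (simp add: power2_eq_square)
      then have "?N v \<le> k * (?D V - m * ?N v)" using k(1) by simp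
      then show "(m + 1 / k) * ?N v \<le> ?D V" using k(1) by (simp add: field_simps)
    qed
    then have "m + 1 / k \<le> m" unfolding m_def by (intro cSup_upper bdd)
    then show False using k(1) by simp
  qed
  then have "lam * ?N v \<le> m * ?N v" using N0 by (rule mult_right_mono)
  also have "\<dots> \<le> ?D V" using mS v unfolding S_def by blast
  finally show ?thesis .
qed

section \<open>Products with test functions\<close>

lemma L2_on_UNIV: "L2_on vol UNIV u \<longleftrightarrow> u \<in> borel_measurable borel \<and> integrable vol (\<lambda>p. (u p)\<^sup>2)"
  by (simp add: L2_on_def set_integrable_def)

lemma L2_field_on_UNIV: "L2_field_on A g vol UNIV X \<longleftrightarrow>
    measurable_vector_field A X \<and> integrable vol (metric_inner A g X X)"
  by (simp add: L2_field_on_def set_integrable_def)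

lemma measurable_vol: "(h :: 'a \<Rightarrow> real) \<in> borel_measurable borel \<Longrightarrow> h \<in> borel_measurable vol"
  by simp

lemma dominated_on_subset:
  fixes h k :: "'a \<Rightarrow> real"
  assumes S: "S \<in> sets borel" and h: "h \<in> borel_measurable borel" "\<And>p. 0 \<le> h p" "\<And>p. h p \<le> k p"
    and k: "integrable vol k"
  shows "integrable (restrict_space vol S) h" "integral\<^sup>L (restrict_space vol S) h \<le> integral\<^sup>L vol k"
proof -
  have m: "(\<lambda>p. indicator S p *\<^sub>R h p) \<in> borel_measurable vol"
    using S h(1) by (intro measurable_vol borel_measurable_scaleR borel_measurable_indicator) auto
  have le: "indicator S p *\<^sub>R h p \<le> k p" "0 \<le> indicator S p *\<^sub>R h p" for p
    using h(2,3)[of p] by (auto simp: indicator_def intro: order_trans)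
  have i: "integrable vol (\<lambda>p. indicator S p *\<^sub>R h p)"
  proof (rule Bochner_Integration.integrable_bound[OF k m], intro AE_I2)
    fix p show "norm (indicator S p *\<^sub>R h p) \<le> norm (k p)" using le[of p] by simp
  qed
  then show "integrable (restrict_space vol S) h"
    using S by (simp add: integrable_restrict_space)
  have "integral\<^sup>L vol (\<lambda>p. indicator S p *\<^sub>R h p) \<le> integral\<^sup>L vol k"
    using i k le(1) by (intro integral_mono)
  then show "integral\<^sup>L (restrict_space vol S) h \<le> integral\<^sup>L vol k"
    using S by (simp add: integral_restrict_space)
qed

lemma test_fun_bounds:
  assumes "test_fun A \<Omega> f"
  obtains B where "0 \<le> B" "\<forall>p. \<bar>f p\<bar> \<le> B" "\<forall>p. metric_inner A g (grad g f) (grad g f) p \<le> B"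
    "\<forall>p. \<bar>laplace_beltrami A g (\<lambda>p. f p * f p) p\<bar> \<le> B"
proof -
  note sm = test_fun_smooth[OF assms]
  have ff: "test_fun A \<Omega> (\<lambda>p. f p * f p)" by (rule test_fun_mult[OF assms sm])
  obtain B1 where B1: "0 \<le> B1" "\<And>p. \<bar>f p\<bar> \<le> B1"
    using bounded_compact_support[OF smooth_fun_continuous[OF sm] test_fun_compact[OF assms]] zero_outside_supp[of _ f] by blast
  have "metric_inner A g (grad g f) (grad g f) p = 0" if "p \<notin> supp f" for p
    using grad_outside_supp(2)[OF chart_at that] by (simp add: metric_inner_def Let_def)
  then obtain B2 where B2: "0 \<le> B2" "\<And>p. \<bar>metric_inner A g (grad g f) (grad g f) p\<bar> \<le> B2"
    using bounded_compact_support[OF continuous_metric_inner_grad[OF sm sm] test_fun_compact[OF assms]] by blast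
  have "laplace_beltrami A g (\<lambda>p. f p * f p) p = 0" if "p \<notin> supp (\<lambda>p. f p * f p)" for p
    unfolding laplace_beltrami_eq by (rule laplace_outside_supp[OF chart_at that])
  then obtain B3 where B3: "0 \<le> B3" "\<And>p. \<bar>laplace_beltrami A g (\<lambda>p. f p * f p) p\<bar> \<le> B3"
    using bounded_compact_support[OF continuous_laplace[OF ff] test_fun_compact[OF ff]] by blast
  let ?B = "B1 + B2 + B3"
  have "\<bar>f p\<bar> \<le> ?B" "metric_inner A g (grad g f) (grad g f) p \<le> ?B"
    "\<bar>laplace_beltrami A g (\<lambda>p. f p * f p) p\<bar> \<le> ?B" for p
    using B1(1) B2(1) B3(1) B1(2)[of p] B2(2)[of p] B3(2)[of p] by linarith+
  then show ?thesis using that[of ?B] B1(1) B2(1) B3(1) by simp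
qed

lemma test_fun_measurable: "test_fun A \<Omega> f \<Longrightarrow> f \<in> borel_measurable borel"
  by (rule borel_measurable_continuous_onI[OF smooth_fun_continuous[OF test_fun_smooth]])

text \<open>The bounds on the norms, applied to differences, show that multiplication by a test function is
continuous from \<open>W\<^sup>1\<^sup>,\<^sup>2\<close> of the manifold to \<open>W\<^sup>1\<^sup>,\<^sup>2(S)\<close>.\<close>

lemma product_L2:
  assumes S: "S \<in> sets borel" and f: "test_fun A \<Omega> f"
    and B: "0 \<le> B" "\<forall>p. \<bar>f p\<bar> \<le> B" "\<forall>p. metric_inner A g (grad g f) (grad g f) p \<le> B"
    and u: "L2_on vol UNIV u" and U: "L2_field_on A g vol UNIV U"
  shows "L2_on vol S (\<lambda>p. u p * f p)"
    and "L2_field_on A g vol S (lin_comb f U u (grad g f))"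
    and "(LINT p|restrict_space vol S. (u p * f p)\<^sup>2) \<le> B\<^sup>2 * (LINT p|vol. (u p)\<^sup>2)"
    and "(LINT p|restrict_space vol S. metric_inner A g (lin_comb f U u (grad g f)) (lin_comb f U u (grad g f)) p)
      \<le> 2 * B\<^sup>2 * (LINT p|vol. metric_inner A g U U p) + 2 * B * (LINT p|vol. (u p)\<^sup>2)"
proof -
  have um: "u \<in> borel_measurable borel" and ui: "integrable vol (\<lambda>p. (u p)\<^sup>2)" using u by (auto simp: L2_on_UNIV)
  have Um: "measurable_vector_field A U" and Ui: "integrable vol (metric_inner A g U U)" using U by (auto simp: L2_field_on_UNIV)
  note fm = test_fun_measurable[OF f]
  have f2: "(f p)\<^sup>2 \<le> B\<^sup>2" for p using B(1,2) by (metis abs_ge_zero power2_abs power_mono)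
  have m1: "(\<lambda>p. u p * f p) \<in> borel_measurable borel" by (intro borel_measurable_times um fm)
  have le1: "(u p * f p)\<^sup>2 \<le> B\<^sup>2 * (u p)\<^sup>2" for p
    using mult_right_mono[OF f2[of p], of "(u p)\<^sup>2"] by (simp add: power_mult_distrib mult.commute)
  have m1': "(\<lambda>p. (u p * f p)\<^sup>2) \<in> borel_measurable borel" by (intro borel_measurable_power m1)
  have "integrable vol (\<lambda>p. B\<^sup>2 * (u p)\<^sup>2)" using ui by simp
  note d1 = dominated_on_subset[OF S m1' zero_le_power2 le1 this]
  show "L2_on vol S (\<lambda>p. u p * f p)" using d1(1) m1 S by (simp add: L2_on_iff)
  show "(LINT p|restrict_space vol S. (u p * f p)\<^sup>2) \<le> B\<^sup>2 * (LINT p|vol. (u p)\<^sup>2)" using d1(2) by simp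
  let ?X = "lin_comb f U u (grad g f)"
  have mX: "measurable_vector_field A ?X"
    by (rule measurable_field_lin_comb[OF Um measurable_field_grad[OF test_fun_smooth[OF f]] fm um])
  have le2: "metric_inner A g ?X ?X p \<le> 2 * B\<^sup>2 * metric_inner A g U U p + 2 * B * (u p)\<^sup>2" for p
  proof -
    have "metric_inner A g ?X ?X p \<le> 2 * (f p)\<^sup>2 * metric_inner A g U U p
        + 2 * (u p)\<^sup>2 * metric_inner A g (grad g f) (grad g f) p"
      by (rule metric_inner_lin_comb_self_le)
    also have "\<dots> \<le> 2 * B\<^sup>2 * metric_inner A g U U p + 2 * (u p)\<^sup>2 * B"
      using f2[of p] B(3) metric_inner_nonneg[of U p] by (intro add_mono mult_right_mono mult_left_mono) auto
    finally show ?thesis by (simp add: mult.commute mult.left_commute)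
  qed
  have "integrable vol (\<lambda>p. 2 * B\<^sup>2 * metric_inner A g U U p + 2 * B * (u p)\<^sup>2)" using ui Ui by simp
  note d2 = dominated_on_subset[OF S measurable_metric_inner[OF mX mX] metric_inner_nonneg le2 this]
  show "L2_field_on A g vol S ?X" using d2(1) mX S by (simp add: L2_field_on_iff)
  show "(LINT p|restrict_space vol S. metric_inner A g ?X ?X p)
      \<le> 2 * B\<^sup>2 * (LINT p|vol. metric_inner A g U U p) + 2 * B * (LINT p|vol. (u p)\<^sup>2)"
    using d2(2) ui Ui by simp
qed

lemma W12E:
  assumes "W12 A g vol w W"
  obtains s where "\<forall>n. smooth_fun_on A UNIV (s n)" "\<forall>n. L2_on vol UNIV (s n)"
    "\<forall>n. L2_field_on A g vol UNIV (grad g (s n))"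
    "(\<lambda>n. LINT p|vol. (s n p - w p)\<^sup>2) \<longlonglongrightarrow> 0"
    "(\<lambda>n. LINT p|vol. metric_inner A g (grad g (s n) - W) (grad g (s n) - W) p) \<longlonglongrightarrow> 0"
  using sobolev_closureE[OF assms[unfolded W12_def]] by (auto simp: set_lebesgue_integral_def)

lemma W12_L2:
  "W12 A g vol w W \<Longrightarrow> L2_on vol UNIV w" "W12 A g vol w W \<Longrightarrow> L2_field_on A g vol UNIV W"
  by (auto simp: W12_def sobolev_closure_def)

text \<open>If smooth functions \<open>s\<^sub>n\<close> approximate \<open>w\<close>, the test functions \<open>s\<^sub>n f\<close> approximate \<open>w f\<close>.\<close>

lemma W12_times_test_fun:
  assumes O: "\<Omega> \<in> sets borel" and w: "W12 A g vol w W" and f: "test_fun A \<Omega> f"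
  shows "W12_0 A g vol \<Omega> (\<lambda>p. w p * f p) (lin_comb f W w (grad g f))"
proof -
  obtain B where B: "0 \<le> B" "\<forall>p. \<bar>f p\<bar> \<le> B" "\<forall>p. metric_inner A g (grad g f) (grad g f) p \<le> B"
    using test_fun_bounds[OF f] by metis
  note P = product_L2[OF O f B]
  obtain s where s': "\<forall>n. smooth_fun_on A UNIV (s n)" "\<forall>n. L2_on vol UNIV (s n)"
    "\<forall>n. L2_field_on A g vol UNIV (grad g (s n))"
    "(\<lambda>n. LINT p|vol. (s n p - w p)\<^sup>2) \<longlonglongrightarrow> 0"
    "(\<lambda>n. LINT p|vol. metric_inner A g (grad g (s n) - W) (grad g (s n) - W) p) \<longlonglongrightarrow> 0"
    by (rule W12E[OF w])
  note s = s'(1-3)[rule_format] s'(4,5)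
  let ?q = "\<lambda>n p. s n p * f p" and ?d = "\<lambda>n p. 1 * s n p + (-1) * w p"
  let ?D = "\<lambda>n. grad g (s n) - W" and ?W = "lin_comb f W w (grad g f)"
  have test: "test_fun A \<Omega> (?q n)" for n by (rule test_fun_mult[OF f s(1)])
  have gr: "grad g (?q n) c p = lin_comb f (grad g (s n)) (s n) (grad g f) c p" if "c \<in> A" "p \<in> chart_dom c" for n c p
  proof -
    have "chart_differentiable c (s n) p" "chart_differentiable c f p"
      using s(1)[of n] test_fun_smooth[OF f] that by (blast intro: smooth_fun_chart_differentiable)+
    from grad_mult[OF that this] show ?thesis by (simp add: lin_comb_def add.commute)
  qed
  have d: "L2_on vol UNIV (?d n)" for n by (rule L2_on_lin[OF _ s(2) W12_L2(1)[OF w]]) simp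
  have D: "L2_field_on A g vol UNIV (?D n)" for n
    unfolding field_diff_eq_lin by (rule L2_field_lin[OF _ s(3) W12_L2(2)[OF w]]) simp
  have fld: "L2_field_on A g vol \<Omega> (grad g (?q n))" for n
    using P(2)[OF s(2)[of n] s(3)[of n]] measurable_field_grad[OF test_fun_smooth[OF test]]
    by (simp only: L2_field_on_iff[OF O] metric_inner_eq_on_charts(2)[OF gr])
  have lim1: "(\<lambda>n. LINT p:\<Omega>|vol. (?q n p - w p * f p)\<^sup>2) \<longlonglongrightarrow> 0"
  proof (rule tendsto_zero_dominated[OF s(4) s(4)])
    show "0 \<le> (LINT p:\<Omega>|vol. (?q n p - w p * f p)\<^sup>2)" for n
      by (simp add: set_integral_vol[OF O])
    show "(LINT p:\<Omega>|vol. (?q n p - w p * f p)\<^sup>2)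
        \<le> B\<^sup>2 * (LINT p|vol. (s n p - w p)\<^sup>2) + 0 * (LINT p|vol. (s n p - w p)\<^sup>2)" for n
      using P(3)[OF d[of n] D[of n]] by (simp add: set_integral_vol[OF O] left_diff_distrib)
  qed
  have lim2: "(\<lambda>n. LINT p:\<Omega>|vol. metric_inner A g (grad g (?q n) - ?W) (grad g (?q n) - ?W) p) \<longlonglongrightarrow> 0"
  proof (rule tendsto_zero_dominated[OF s(5,4)])
    fix n
    have eq: "metric_inner A g (grad g (?q n) - ?W) (grad g (?q n) - ?W) =
        metric_inner A g (lin_comb f (?D n) (?d n) (grad g f)) (lin_comb f (?D n) (?d n) (grad g f))"
      by (rule metric_inner_eq_on_charts(2), simp only: minus_apply gr lin_comb_def) (simp add: algebra_simps)
    show "0 \<le> (LINT p:\<Omega>|vol. metric_inner A g (grad g (?q n) - ?W) (grad g (?q n) - ?W) p)"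
      by (simp add: set_integral_vol[OF O] metric_inner_nonneg)
    show "(LINT p:\<Omega>|vol. metric_inner A g (grad g (?q n) - ?W) (grad g (?q n) - ?W) p)
        \<le> 2 * B\<^sup>2 * (LINT p|vol. metric_inner A g (?D n) (?D n) p) + 2 * B * (LINT p|vol. (s n p - w p)\<^sup>2)"
      using P(4)[OF d[of n] D[of n]] by (simp add: set_integral_vol[OF O] eq)
  qed
  show ?thesis
    unfolding W12_0_def sobolev_closure_def
  proof (intro conjI exI[of _ ?q] allI)
    show "L2_on vol \<Omega> (\<lambda>p. w p * f p)" by (rule P(1)[OF W12_L2[OF w]])
    show "L2_field_on A g vol \<Omega> ?W" by (rule P(2)[OF W12_L2[OF w]])
    show "L2_on vol \<Omega> (?q n)" for n by (rule P(1)[OF s(2) s(3)])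
  qed (rule test fld lim1 lim2)+
qed

section \<open>Green's formula for the square of a Sobolev function\<close>

text \<open>For smooth \<open>u\<close> with \<open>U = \<nabla>u\<close> this is the integrand of Green's formula for \<open>u\<^sup>2\<close> and \<open>f\<^sup>2\<close>. As a
quadratic expression in \<open>(u, U)\<close> without derivatives of \<open>u\<close> it makes sense for Sobolev functions.\<close>

definition green_sq :: "('a \<Rightarrow> real) \<Rightarrow> ('a \<Rightarrow> real) \<Rightarrow> 'a vector_field \<Rightarrow> 'a \<Rightarrow> real" where
  "green_sq f u U p = (u p)\<^sup>2 * laplace_beltrami A g (\<lambda>p. f p * f p) p
     + 4 * (u p * f p * metric_inner A g U (grad g f) p)"

lemma green_sq_smooth:
  assumes f: "test_fun A \<Omega> f" and s: "smooth_fun_on A UNIV s"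
  shows "integral\<^sup>L vol (green_sq f s (grad g s)) = 0" "integrable vol (green_sq f s (grad g s))"
proof -
  let ?u = "\<lambda>p. s p * s p" and ?phi = "\<lambda>p. f p * f p"
  have phi: "test_fun A \<Omega> ?phi" by (rule test_fun_mult[OF f test_fun_smooth[OF f]])
  have "green ?phi ?u p = green_sq f s (grad g s) p" for p
  proof -
    let ?c = "chart_at A p"
    have d: "chart_differentiable ?c s p" "chart_differentiable ?c f p"
      using s test_fun_smooth[OF f] chart_at by (blast intro: smooth_fun_chart_differentiable)+
    have "metric_inner A g (grad g ?u) (grad g ?phi) p =
        metric_inner A g (lin_comb (\<lambda>p. 2 * s p) (grad g s) (\<lambda>_. 0) (grad g s))
          (lin_comb (\<lambda>p. 2 * f p) (grad g f) (\<lambda>_. 0) (grad g f)) p"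
      by (rule metric_inner_cong)
         (simp_all add: grad_mult[OF chart_at d(1) d(1)] grad_mult[OF chart_at d(2) d(2)] lin_comb_def
            scaleR_left_distrib[symmetric])
    then show ?thesis
      by (simp add: green_def green_sq_def metric_inner_lin_comb_left metric_inner_lin_comb_right power2_eq_square)
  qed
  then have "green ?phi ?u = green_sq f s (grad g s)" by auto
  with green_formula[OF phi smooth_imp_C1_fun[OF smooth_fun_mult[OF s s]]]
  show "integral\<^sup>L vol (green_sq f s (grad g s)) = 0" "integrable vol (green_sq f s (grad g s))" by simp_all
qed

text \<open>Expand \<open>|\<surd>e X \<plusminus> (x / \<surd>e) Y|\<^sup>2 \<ge> 0\<close>.\<close>

lemma metric_inner_young:
  assumes "0 < e"
  shows "2 * \<bar>x * metric_inner A g X Y p\<bar> \<le> e * metric_inner A g X X p + x\<^sup>2 * metric_inner A g Y Y p / e"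
proof -
  have s: "sqrt e * sqrt e = e" "(sqrt e)\<^sup>2 = e" "sqrt e \<noteq> 0" using assms by auto
  have "0 \<le> metric_inner A g (lin_comb (\<lambda>_. sqrt e) X (\<lambda>_. y / sqrt e) Y) (lin_comb (\<lambda>_. sqrt e) X (\<lambda>_. y / sqrt e) Y) p" for y
    by (rule metric_inner_nonneg)
  then have "0 \<le> e * metric_inner A g X X p + 2 * y * metric_inner A g X Y p + y\<^sup>2 / e * metric_inner A g Y Y p" for y
    using s by (simp add: metric_inner_lin_comb_self power_divide)
  from this[of x] this[of "- x"] show ?thesis by (simp add: abs_le_iff)
qed

text \<open>The difference of the quadratic expressions contains products of \<open>w\<close> or \<open>W\<close> with \<open>u - w\<close> or
\<open>U - W\<close>. Young's inequality with a free parameter separates them into a part that is small by the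
choice of \<open>e\<close>, and a part that is small when \<open>u\<close> is close to \<open>w\<close>.\<close>

lemma green_sq_diff_le:
  assumes e: "0 < e" and B: "0 \<le> B" "\<forall>p. \<bar>f p\<bar> \<le> B" "\<forall>p. metric_inner A g (grad g f) (grad g f) p \<le> B"
    "\<forall>p. \<bar>laplace_beltrami A g (\<lambda>p. f p * f p) p\<bar> \<le> B"
  shows "\<bar>green_sq f u U p - green_sq f w W p\<bar> \<le> (3 * B + 2 * B\<^sup>2) *
    (e * ((w p)\<^sup>2 + metric_inner A g W W p) + (1 / e + 1) * ((u p - w p)\<^sup>2 + metric_inner A g (U - W) (U - W) p))"
proof -
  let ?G = "grad g f"
  define l where "l = laplace_beltrami A g (\<lambda>p. f p * f p) p"
  define d where "d = u p - w p"
  define a where "a = metric_inner A g W ?G p"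
  define b where "b = metric_inner A g (U - W) ?G p"
  define x where "x = w p"
  define y where "y = metric_inner A g W W p"
  define z where "z = metric_inner A g (U - W) (U - W) p"
  define G where "G = metric_inner A g ?G ?G p"
  have U: "metric_inner A g U ?G p = a + b"
    unfolding a_def b_def field_diff_eq_lin by (simp add: metric_inner_lin_comb_left)
  have u: "u p = x + d" by (simp add: x_def d_def)
  have nn: "0 \<le> y" "0 \<le> z" "0 \<le> G" by (simp_all add: y_def z_def G_def metric_inner_nonneg)
  have G: "G \<le> B" "\<bar>f p\<bar> \<le> B" "\<bar>l\<bar> \<le> B" using B by (auto simp: G_def l_def)
  have eq: "green_sq f u U p - green_sq f w W p =
      l * (2 * (x * d)) + l * d\<^sup>2 + 2 * f p * (2 * (d * a)) + 2 * f p * (2 * (x * b)) + 2 * f p * (2 * (d * b))"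
    unfolding green_sq_def U u l_def[symmetric] a_def[symmetric] x_def[symmetric]
    by (simp add: power2_eq_square algebra_simps)
  have t1: "\<bar>2 * (x * d)\<bar> \<le> e * x\<^sup>2 + d\<^sup>2 / e"
  proof -
    have "0 \<le> (sqrt e * \<bar>x\<bar> - \<bar>d\<bar> / sqrt e)\<^sup>2" by simp
    then show ?thesis using e by (simp add: power2_diff power_mult_distrib power_divide abs_mult)
  qed
  have t2: "\<bar>2 * (d * a)\<bar> \<le> e * y + d\<^sup>2 * B / e"
  proof -
    have "\<bar>2 * (d * a)\<bar> \<le> e * y + d\<^sup>2 * G / e"
      using metric_inner_young[OF e, of d W ?G p] by (simp add: a_def y_def G_def abs_mult)
    also have "d\<^sup>2 * G / e \<le> d\<^sup>2 * B / e" using G(1) e by (intro divide_right_mono mult_left_mono) auto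
    finally show ?thesis by simp
  qed
  have t3: "\<bar>2 * (x * b)\<bar> \<le> z / e + x\<^sup>2 * B * e"
  proof -
    have "\<bar>2 * (x * b)\<bar> \<le> z / e + x\<^sup>2 * G * e"
      using metric_inner_young[of "1 / e" x "U - W" ?G p] e by (simp add: b_def z_def G_def abs_mult)
    also have "x\<^sup>2 * G * e \<le> x\<^sup>2 * B * e" using G(1) e by (intro mult_right_mono mult_left_mono) auto
    finally show ?thesis by simp
  qed
  have t4: "\<bar>2 * (d * b)\<bar> \<le> z + d\<^sup>2 * B"
  proof -
    have "\<bar>2 * (d * b)\<bar> \<le> z + d\<^sup>2 * G"
      using metric_inner_young[of 1 d "U - W" ?G p] by (simp add: b_def z_def G_def abs_mult)
    also have "d\<^sup>2 * G \<le> d\<^sup>2 * B" using G(1) by (intro mult_left_mono) auto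
    finally show ?thesis by simp
  qed
  \<comment> \<open>each of the five summands in \<open>eq\<close> is a bounded factor times a term estimated above\<close>
  have mult: "\<bar>h * k\<bar> \<le> M * K" if "\<bar>h\<bar> \<le> M" "\<bar>k\<bar> \<le> K" for h k M K :: real
    unfolding abs_mult using that by (intro mult_mono) auto
  have f2: "\<bar>2 * f p\<bar> \<le> 2 * B" using G(2) by simp
  have d2: "\<bar>d\<^sup>2\<bar> \<le> d\<^sup>2" by simp
  have "\<bar>green_sq f u U p - green_sq f w W p\<bar> \<le>
      B * (e * x\<^sup>2 + d\<^sup>2 / e) + B * d\<^sup>2 + 2 * B * (e * y + d\<^sup>2 * B / e) + 2 * B * (z / e + x\<^sup>2 * B * e)
      + 2 * B * (z + d\<^sup>2 * B)"
    unfolding eq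
    using mult[OF G(3) t1] mult[OF G(3) d2] mult[OF f2 t2] mult[OF f2 t3] mult[OF f2 t4] by linarith
  also have "\<dots> \<le> B * (e * x\<^sup>2 + d\<^sup>2 / e) + B * d\<^sup>2 + 2 * B * (e * y + d\<^sup>2 * B / e) + 2 * B * (z / e + x\<^sup>2 * B * e)
      + 2 * B * (z + d\<^sup>2 * B)
      + (2 * B * (e * x\<^sup>2) + (B + 2 * B\<^sup>2) * (e * y) + 2 * B * (d\<^sup>2 / e) + 2 * B * d\<^sup>2 + (B + 2 * B\<^sup>2) * (z / e) + (B + 2 * B\<^sup>2) * z)"
    using B(1) e nn by simp
  also have "\<dots> = (3 * B + 2 * B\<^sup>2) * (e * (x\<^sup>2 + y) + (1 / e + 1) * (d\<^sup>2 + z))"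
    using e by (simp add: power2_eq_square field_simps)
  finally show ?thesis by (simp add: x_def y_def d_def z_def)
qed

text \<open>The functional \<open>integral\<^sup>L vol (green_sq f u U)\<close> vanishes on smooth functions. The estimate of its
differences carries this over to \<open>w\<close>, by approximation first and then \<open>e \<longlonglongrightarrow> 0\<close>.\<close>

lemma weak_green:
  assumes w: "W12 A g vol w W" and f: "test_fun A \<Omega> f"
  shows "integrable vol (\<lambda>p. (w p)\<^sup>2 * laplace_beltrami A g (\<lambda>p. f p * f p) p)"
    and "integrable vol (\<lambda>p. w p * f p * metric_inner A g W (grad g f) p)"
    and "(LINT p|vol. (w p)\<^sup>2 * laplace_beltrami A g (\<lambda>p. f p * f p) p) =
      - 4 * (LINT p|vol. w p * f p * metric_inner A g W (grad g f) p)"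
proof -
  let ?L = "laplace_beltrami A g (\<lambda>p. f p * f p)"
  obtain B where B: "0 \<le> B" "\<forall>p. \<bar>f p\<bar> \<le> B" "\<forall>p. metric_inner A g (grad g f) (grad g f) p \<le> B"
    "\<forall>p. \<bar>?L p\<bar> \<le> B"
    by (rule test_fun_bounds[OF f])
  note est = green_sq_diff_le[OF _ B]
  have wm: "w \<in> borel_measurable borel" and wi: "integrable vol (\<lambda>p. (w p)\<^sup>2)"
    using W12_L2(1)[OF w] by (auto simp: L2_on_UNIV)
  have Wm: "measurable_vector_field A W" and Wi: "integrable vol (metric_inner A g W W)"
    using W12_L2(2)[OF w] by (auto simp: L2_field_on_UNIV)
  have Lm: "?L \<in> borel_measurable borel"
    by (rule borel_measurable_continuous_onI[OF continuous_laplace[OF test_fun_mult[OF f test_fun_smooth[OF f]]]])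
  have Gm: "metric_inner A g W (grad g f) \<in> borel_measurable borel"
    by (rule measurable_metric_inner[OF Wm measurable_field_grad[OF test_fun_smooth[OF f]]])
  have qm: "green_sq f w W \<in> borel_measurable vol"
    unfolding green_sq_def[abs_def]
    by (intro measurable_vol borel_measurable_add borel_measurable_times borel_measurable_power
        borel_measurable_const wm Lm Gm test_fun_measurable[OF f])
  show wL: "integrable vol (\<lambda>p. (w p)\<^sup>2 * ?L p)"
  proof (rule Bochner_Integration.integrable_bound)
    show "integrable vol (\<lambda>p. B * (w p)\<^sup>2)" using wi by simp
    show "(\<lambda>p. (w p)\<^sup>2 * ?L p) \<in> borel_measurable vol"
      by (intro measurable_vol borel_measurable_times borel_measurable_power wm Lm)
    show "AE p in vol. norm ((w p)\<^sup>2 * ?L p) \<le> norm (B * (w p)\<^sup>2)"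
    proof (rule AE_I2)
      fix p
      have "\<bar>?L p\<bar> * (w p)\<^sup>2 \<le> B * (w p)\<^sup>2" using B(4) by (intro mult_right_mono) auto
      then show "norm ((w p)\<^sup>2 * ?L p) \<le> norm (B * (w p)\<^sup>2)"
        using B(1) by (simp add: abs_mult mult.commute)
    qed
  qed
  have qi: "integrable vol (green_sq f w W)"
  proof (rule Bochner_Integration.integrable_bound[OF _ qm])
    show "integrable vol (\<lambda>p. (3 * B + 2 * B\<^sup>2) * (2 * ((w p)\<^sup>2 + metric_inner A g W W p)))"
      using wi Wi by simp
    have "\<bar>green_sq f w W p\<bar> \<le> (3 * B + 2 * B\<^sup>2) * (2 * ((w p)\<^sup>2 + metric_inner A g W W p))" for p
    proof -
      have "green_sq f (\<lambda>_. 0) (lin 0 W 0 W) p = 0" "metric_inner A g (lin 0 W 0 W) (lin 0 W 0 W) p = 0"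
        by (simp_all add: green_sq_def metric_inner_lin_comb_left)
      moreover have "W - lin 0 W 0 W = W" by (simp add: fun_eq_iff lin_comb_def)
      ultimately show ?thesis using est[of 1 w W p "\<lambda>_. 0" "lin 0 W 0 W"] by simp
    qed
    then show "AE p in vol. norm (green_sq f w W p) \<le> norm ((3 * B + 2 * B\<^sup>2) * (2 * ((w p)\<^sup>2 + metric_inner A g W W p)))"
      using B(1) metric_inner_nonneg[of W] by (intro AE_I2) (simp add: abs_of_nonneg)
  qed
  have "(\<lambda>p. (green_sq f w W p - (w p)\<^sup>2 * ?L p) / 4) = (\<lambda>p. w p * f p * metric_inner A g W (grad g f) p)"
    by (simp add: green_sq_def)
  moreover have "integrable vol (\<lambda>p. (green_sq f w W p - (w p)\<^sup>2 * ?L p) / 4)" using qi wL by simp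
  ultimately show wG: "integrable vol (\<lambda>p. w p * f p * metric_inner A g W (grad g f) p)" by simp
  obtain s where s': "\<forall>n. smooth_fun_on A UNIV (s n)" "\<forall>n. L2_on vol UNIV (s n)"
    "\<forall>n. L2_field_on A g vol UNIV (grad g (s n))"
    "(\<lambda>n. LINT p|vol. (s n p - w p)\<^sup>2) \<longlonglongrightarrow> 0"
    "(\<lambda>n. LINT p|vol. metric_inner A g (grad g (s n) - W) (grad g (s n) - W) p) \<longlonglongrightarrow> 0"
    by (rule W12E[OF w])
  note s = s'(1-3)[rule_format] s'(4,5)
  define K where "K = 3 * B + 2 * B\<^sup>2"
  define M where "M = (LINT p|vol. (w p)\<^sup>2) + (LINT p|vol. metric_inner A g W W p)"
  define E where "E n = (LINT p|vol. (s n p - w p)\<^sup>2)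
    + (LINT p|vol. metric_inner A g (grad g (s n) - W) (grad g (s n) - W) p)" for n
  have E: "E \<longlonglongrightarrow> 0" unfolding E_def using tendsto_add[OF s(4,5)] by simp
  let ?I = "integral\<^sup>L vol (green_sq f w W)"
  have le: "\<bar>?I\<bar> \<le> K * (e * M + (1 / e + 1) * E n)" if e: "0 < e" for e n
  proof -
    note gs = green_sq_smooth[OF f s(1)[of n]]
    have dd: "L2_on vol UNIV (\<lambda>p. 1 * s n p + (-1) * w p)" by (rule L2_on_lin[OF _ s(2) W12_L2(1)[OF w]]) simp
    have DD: "L2_field_on A g vol UNIV (grad g (s n) - W)"
      unfolding field_diff_eq_lin by (rule L2_field_lin[OF _ s(3) W12_L2(2)[OF w]]) simp
    have di: "integrable vol (\<lambda>p. (s n p - w p)\<^sup>2)" using dd by (simp add: L2_on_UNIV)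
    have Di: "integrable vol (metric_inner A g (grad g (s n) - W) (grad g (s n) - W))"
      using DD by (simp add: L2_field_on_UNIV)
    let ?r = "\<lambda>p. K * (e * ((w p)\<^sup>2 + metric_inner A g W W p) + (1 / e + 1) *
      ((s n p - w p)\<^sup>2 + metric_inner A g (grad g (s n) - W) (grad g (s n) - W) p))"
    have "\<bar>?I\<bar> = \<bar>LINT p|vol. green_sq f (s n) (grad g (s n)) p - green_sq f w W p\<bar>"
      using gs qi by simp
    also have "\<dots> \<le> (LINT p|vol. \<bar>green_sq f (s n) (grad g (s n)) p - green_sq f w W p\<bar>)"
      by (rule integral_abs_bound)
    also have "\<dots> \<le> integral\<^sup>L vol ?r"
    proof (rule integral_mono)
      show "integrable vol (\<lambda>p. \<bar>green_sq f (s n) (grad g (s n)) p - green_sq f w W p\<bar>)" using gs qi by simp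
      show "integrable vol ?r" using wi Wi di Di by simp
      show "\<bar>green_sq f (s n) (grad g (s n)) p - green_sq f w W p\<bar> \<le> ?r p" for p
        unfolding K_def by (rule est[OF e])
    qed
    also have "\<dots> = K * (e * M + (1 / e + 1) * E n)"
      using wi Wi di Di by (simp add: M_def E_def)
    finally show ?thesis .
  qed
  have le2: "\<bar>?I\<bar> \<le> K * (e * M)" if e: "0 < e" for e
  proof (rule LIMSEQ_le_const)
    show "(\<lambda>n. K * (e * M + (1 / e + 1) * E n)) \<longlonglongrightarrow> K * (e * M)"
      using tendsto_mult_left[OF tendsto_add[OF tendsto_const[of "e * M"] tendsto_mult_left[OF E, of "1 / e + 1"]], of K]
      by simp
  qed (use le[OF e] in blast)
  have "\<bar>?I\<bar> \<le> 0"
  proof (rule LIMSEQ_le_const)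
    show "(\<lambda>n. K * (inverse (real (Suc n)) * M)) \<longlonglongrightarrow> 0"
      using tendsto_mult_left[OF tendsto_mult_right[OF LIMSEQ_inverse_real_of_nat, of M], of K] by simp
  qed (use le2 in auto)
  then have "0 = (LINT p|vol. (w p)\<^sup>2 * ?L p + 4 * (w p * f p * metric_inner A g W (grad g f) p))"
    by (simp add: green_sq_def[abs_def])
  also have "\<dots> = (LINT p|vol. (w p)\<^sup>2 * ?L p) + 4 * (LINT p|vol. w p * f p * metric_inner A g W (grad g f) p)"
    using wL wG by simp
  finally show "(LINT p|vol. (w p)\<^sup>2 * ?L p) = - 4 * (LINT p|vol. w p * f p * metric_inner A g W (grad g f) p)" by simp
qed

end

text \<open>What remains is to combine the weak equation, Green's formula and the Poincare inequality. All
integrands vanish outside \<open>\<Omega>\<close>, so that they can be integrated over the whole manifold.\<close>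

theorem theorem1p1:
  fixes A :: "'a::{t2_space,second_countable_topology} chart set"
    and g :: "'a metric_field" and vol :: "'a measure" and \<Omega> :: "'a set"
    and w \<kappa> f :: "'a \<Rightarrow> real" and W :: "'a vector_field" and lam1 :: real
  assumes "smooth_atlas A" and "connected (UNIV :: 'a set)"
    and "riemannian_metric A g" and "riemannian_volume A g vol"
    and "smooth_domain A \<Omega>"
    and "first_dirichlet_eigenvalue A g vol \<Omega> lam1"
    and "admissible_weight A g vol \<Omega> w W \<kappa>"
    and "\<forall>p\<in>\<Omega>. \<kappa> p \<le> lam1"
    and "test_fun A \<Omega> f"
  shows "(LINT p:\<Omega>|vol. metric_inner A g W W p * \<bar>f p\<bar>\<^sup>2)
       \<le> (LINT p:\<Omega>|vol. (w p)\<^sup>2 * metric_inner A g (grad g f) (grad g f) p)"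
proof -
  interpret riemannian_surface A g vol
    using assms by unfold_locales
  note f = assms(9)
  have O: "\<Omega> \<in> sets borel" using assms(5) by (simp add: smooth_domain_def)
  have w: "W12 A g vol w W" and \<kappa>: "\<And>K. compact K \<Longrightarrow> K \<subseteq> \<Omega> - manifold_boundary A \<Longrightarrow>
        set_integrable vol K (\<lambda>p. \<kappa> p * (w p)\<^sup>2)"
    and weak: "\<And>\<phi>. test_fun A \<Omega> \<phi> \<Longrightarrow>
        (LINT p:\<Omega>|vol. (4 * metric_inner A g W W p - 2 * \<kappa> p * (w p)\<^sup>2) * \<phi> p
            - (w p)\<^sup>2 * laplace_beltrami A g \<phi> p) = 0"
    using assms(7) unfolding admissible_weight_def by blast+
  let ?phi = "\<lambda>p. f p * f p" and ?G = "grad g f" and ?K = "supp f"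
  let ?X = "lin_comb f W w ?G"
  have phi: "test_fun A \<Omega> ?phi" by (rule test_fun_mult[OF f test_fun_smooth[OF f]])
  have out: "f p = 0" "metric_inner A g X ?G p = 0" "laplace_beltrami A g ?phi p = 0" if "p \<notin> \<Omega>" for p X
  proof -
    have p: "p \<notin> ?K" using test_fun_subset[OF f] that by blast
    show "f p = 0" by (rule zero_outside_supp[OF p])
    show "metric_inner A g X ?G p = 0"
      using grad_outside_supp(2)[OF chart_at p] by (simp add: metric_inner_def Let_def)
    have "p \<notin> supp ?phi" using test_fun_subset[OF phi] that by blast
    then show "laplace_beltrami A g ?phi p = 0"
      unfolding laplace_beltrami_eq by (rule laplace_outside_supp[OF chart_at])
  qed
  have global: "(LINT p:\<Omega>|vol. h p) = integral\<^sup>L vol h" if "\<And>p. p \<notin> \<Omega> \<Longrightarrow> h p = 0" for h :: "'a \<Rightarrow> real"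
    unfolding set_lebesgue_integral_def
    by (rule Bochner_Integration.integral_cong) (use that in \<open>auto simp: indicator_def\<close>)
  obtain B where B: "0 \<le> B" "\<forall>p. \<bar>f p\<bar> \<le> B" "\<forall>p. metric_inner A g ?G ?G p \<le> B"
    using test_fun_bounds[OF f] by metis
  have wm: "w \<in> borel_measurable borel" and wi: "integrable vol (\<lambda>p. (w p)\<^sup>2)"
    using W12_L2(1)[OF w] by (auto simp: L2_on_UNIV)
  have Wm: "measurable_vector_field A W" and Wi: "integrable vol (metric_inner A g W W)"
    using W12_L2(2)[OF w] by (auto simp: L2_field_on_UNIV)
  note fm = test_fun_measurable[OF f]
  have bounded_mult: "integrable vol (\<lambda>p. h p * k p)"
    if h: "integrable vol h" and k: "k \<in> borel_measurable borel" "\<And>p. \<bar>k p\<bar> \<le> C" for h k :: "'a \<Rightarrow> real" and C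
  proof (rule Bochner_Integration.integrable_bound)
    show "integrable vol (\<lambda>p. h p * C)" using h by simp
    show "(\<lambda>p. h p * k p) \<in> borel_measurable vol"
      using borel_measurable_integrable[OF h] measurable_vol[OF k(1)] by (rule borel_measurable_times)
    show "AE p in vol. norm (h p * k p) \<le> norm (h p * C)"
      using k(2) order_trans[OF k(2) abs_ge_self] by (intro AE_I2) (simp add: abs_mult mult_left_mono)
  qed
  have phim: "?phi \<in> borel_measurable borel" by (intro borel_measurable_times fm)
  have phib: "\<bar>?phi p\<bar> \<le> B * B" for p
    unfolding abs_mult using B(1,2) by (intro mult_mono) auto
  have ia: "integrable vol (\<lambda>p. metric_inner A g W W p * ?phi p)" by (rule bounded_mult[OF Wi phim phib])
  \<comment> \<open>local integrability of \<open>\<kappa> w\<^sup>2\<close> is only known on compact sets, here the support of \<open>f\<close>\<close>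
  have on_supp: "indicat_real ?K p *\<^sub>R (\<kappa> p * (w p)\<^sup>2) * ?phi p = \<kappa> p * (w p)\<^sup>2 * ?phi p" for p
    by (cases "p \<in> ?K") (simp_all add: zero_outside_supp[of p f])
  have "integrable vol (\<lambda>p. indicat_real ?K p *\<^sub>R (\<kappa> p * (w p)\<^sup>2))"
    using \<kappa>[of ?K] f by (simp add: test_fun_def set_integrable_def)
  from bounded_mult[OF this phim phib]
  have ik: "integrable vol (\<lambda>p. \<kappa> p * (w p)\<^sup>2 * ?phi p)" unfolding on_supp .
  have iN: "integrable vol (\<lambda>p. (w p)\<^sup>2 * ?phi p)" by (rule bounded_mult[OF wi phim phib])
  have Gm: "metric_inner A g ?G ?G \<in> borel_measurable borel"
    using measurable_field_grad[OF test_fun_smooth[OF f]] by (intro measurable_metric_inner)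
  have ie: "integrable vol (\<lambda>p. (w p)\<^sup>2 * metric_inner A g ?G ?G p)"
    by (rule bounded_mult[OF wi Gm, of B]) (use B(3) metric_inner_nonneg in \<open>simp add: abs_of_nonneg\<close>)
  note wg = weak_green[OF w f]
  define a where "a = (LINT p|vol. metric_inner A g W W p * ?phi p)"
  define b where "b = (LINT p|vol. w p * f p * metric_inner A g W ?G p)"
  define e where "e = (LINT p|vol. (w p)\<^sup>2 * metric_inner A g ?G ?G p)"
  define k where "k = (LINT p|vol. \<kappa> p * (w p)\<^sup>2 * ?phi p)"
  define N where "N = (LINT p|vol. (w p)\<^sup>2 * ?phi p)"
  have "0 = (LINT p|vol. 4 * (metric_inner A g W W p * ?phi p) - 2 * (\<kappa> p * (w p)\<^sup>2 * ?phi p)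
            - (w p)\<^sup>2 * laplace_beltrami A g ?phi p)"
    using weak[OF phi] by (subst (asm) global) (simp_all add: out algebra_simps)
  also have "\<dots> = 4 * a - 2 * k + 4 * b"
    using ia ik wg(1,3) by (simp add: a_def b_def k_def)
  finally have weak_eq: "4 * a + 4 * b = 2 * k" by simp
  have "k \<le> (LINT p|vol. lam1 * ((w p)\<^sup>2 * ?phi p))"
    unfolding k_def
  proof (rule integral_mono[OF ik])
    show "\<kappa> p * (w p)\<^sup>2 * ?phi p \<le> lam1 * ((w p)\<^sup>2 * ?phi p)" for p
    proof (cases "p \<in> \<Omega>")
      case True
      then have "\<kappa> p * ((w p)\<^sup>2 * ?phi p) \<le> lam1 * ((w p)\<^sup>2 * ?phi p)"
        using assms(8) by (intro mult_right_mono) auto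
      then show ?thesis by (simp add: mult.assoc)
    qed (simp add: out)
  qed (use iN in simp)
  then have k_le: "k \<le> lam1 * N" by (simp add: N_def)
  have XX: "metric_inner A g ?X ?X = (\<lambda>p. metric_inner A g W W p * ?phi p
      + 2 * (w p * f p * metric_inner A g W ?G p) + (w p)\<^sup>2 * metric_inner A g ?G ?G p)"
    by (rule ext) (simp add: metric_inner_lin_comb_self power2_eq_square algebra_simps)
  have "lam1 * (LINT p|restrict_space vol \<Omega>. (w p * f p)\<^sup>2)
      \<le> (LINT p|restrict_space vol \<Omega>. metric_inner A g ?X ?X p)"
    by (rule poincare_inequality[OF O assms(6) W12_times_test_fun[OF O w f]])
  then have "lam1 * (LINT p:\<Omega>|vol. (w p * f p)\<^sup>2) \<le> (LINT p:\<Omega>|vol. metric_inner A g ?X ?X p)"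
    by (simp add: set_integral_vol[OF O])
  moreover have "(LINT p:\<Omega>|vol. (w p * f p)\<^sup>2) = N"
    unfolding N_def by (subst global) (simp_all add: out power2_eq_square algebra_simps)
  moreover have "(LINT p:\<Omega>|vol. metric_inner A g ?X ?X p) = (LINT p|vol. metric_inner A g W W p * ?phi p
      + 2 * (w p * f p * metric_inner A g W ?G p) + (w p)\<^sup>2 * metric_inner A g ?G ?G p)"
    unfolding XX by (rule global) (simp add: out)
  moreover have "\<dots> = a + 2 * b + e"
    using ia ie wg(2) by (simp add: a_def b_def e_def)
  ultimately have "lam1 * N \<le> a + 2 * b + e" by simp
  with weak_eq k_le have "a \<le> e" by linarith
  moreover have "(LINT p:\<Omega>|vol. metric_inner A g W W p * \<bar>f p\<bar>\<^sup>2) = a"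
    unfolding a_def by (subst global) (simp_all add: out power2_eq_square)
  moreover have "(LINT p:\<Omega>|vol. (w p)\<^sup>2 * metric_inner A g ?G ?G p) = e"
    unfolding e_def by (rule global) (simp add: out)
  ultimately show ?thesis by simp
qed

end
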